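(* Let $(M,J,F)$ be a strongly pseudoconvex complex Finsler manifold. Then the unitary frame bundle $U_F(M)$ has a unique non-linear connection of Hermitian type. This connection is invariant under any biholomorphic isometry of $(M,J,F)$ (i.e. under the lifted map $\hat f(u)=f_*\circ u$ on frames, for every biholomorphic isometry $f$).
   Context: $(M,J)$ is a complex manifold of complex dimension $n$, $\tilde TM=TM\setminus\{\text{zero section}\}$. A complex Finsler metric is a continuous $F:TM\to\mathbb R_{\ge 0}$, smooth and positive on $\tilde TM$, with $F(\lambda v)=|\lambda|F(v)$ for $\lambda\in\mathbb C$ (scalars act through $J$). For $0\ne v\in T_xM$ and $w\in T_x^{\mathbb C}M$, let $\hat w$ be the constant (translation invariant) complex vector field on the vector space $T_xM$ with value $w$; put $\mathrm h_v(w,z)=\hat w(\hat z(F^2))|_v$. Let $S_x=\{v\in T_xM: F(v)=1\}$ and let $\mathcal D_v$ be the maximal $J$-invariant subspace of $T_vS_x$ (viewed inside $T_xM$), with holomorphic part $\mathcal D_v^{10}$. $F$ is strongly pseudoconvex if for every $x$ and $v\in S_x$ the Levi form $(X,Y)\mapsto \mathrm h_v(X,\overline Y)$ is positive definite on $\mathcal D_v^{10}$. A biholomorphic isometry is a biholomorphism preserving $F$. $L^{\mathbb C}(M)$ is the principal $GL_n(\mathbb C)$-bundle of complex linear frames, i.e. $\mathbb C$-linear isomorphisms $u:\mathbb C^n\to T_xM$. Let $\epsilon_0,\dots,\epsilon_{2n-1}$ be the standard real basis of $\mathbb C^n$ with $J_o\epsilon_{2\alpha}=\epsilon_{2\alpha+1}$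 ($J_o$ the complex structure of $\mathbb C^n$); a frame is identified with $\{f_i=u(\epsilon_i)\}$, and $e_\alpha=\frac12(f_{2\alpha}-\sqrt{-1}f_{2\alpha+1})$, $e_{\bar\alpha}=\overline{e_\alpha}$. The standard complex structure $\hat J$ of $L^{\mathbb C}(M)$ is the unique one for which $\pi:L^{\mathbb C}(M)\to M$ is holomorphic and which on vertical subspaces is the complex structure of $GL_n(\mathbb C)$. The unitary frame bundle $U_F(M)\subset L^{\mathbb C}(M)$ consists of the frames $u=\{f_i\}$ such that $F(f_0)=1$, $f_2,\dots,f_{2n-1}$ span $\mathcal D_{f_0}$, and $\mathrm h_{f_0}(e_\lambda,e_{\bar\mu})=\delta_{\lambda\mu}$ for $1\le\lambda,\mu\le n-1$. It is a (generally not principal) subbundle of $L^{\mathbb C}(M)$. A non-linear connection on $U_F(M)$ is a distribution on $U_F(M)$ of real dimension $2n=\dim_{\mathbb R} M$ complementary to the vertical distribution of $U_F(M)\to M$; it is of Hermitian type if each of its subspaces is $\hat J$-invariant. *)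

theory Defs
  imports "HOL-Analysis.Analysis"
begin

section \<open>Smooth and holomorphic maps between open subsets of model spaces\<close>

primrec Ck_on :: "nat \<Rightarrow> 'e::euclidean_space set \<Rightarrow> ('e \<Rightarrow> 'f::euclidean_space) \<Rightarrow> bool" where
  "Ck_on 0 S f \<longleftrightarrow> continuous_on S f"
| "Ck_on (Suc k) S f \<longleftrightarrow>
     f differentiable_on S \<and> (\<forall>v. Ck_on k S (\<lambda>x. frechet_derivative f (at x) v))"

text \<open>Only ever used for open \<open>S\<close>.\<close>

definition smooth_on :: "'e::euclidean_space set \<Rightarrow> ('e \<Rightarrow> 'f::euclidean_space) \<Rightarrow> bool" where
  "smooth_on S f \<longleftrightarrow> (\<forall>k. Ck_on k S f)"

text \<open>The complex structure of a model space is given by its multiplication by the imaginary unit,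
  an endomorphism \<open>I\<close>.\<close>

definition holo_on ::
  "('e \<Rightarrow> 'e) \<Rightarrow> ('f \<Rightarrow> 'f) \<Rightarrow> 'e::euclidean_space set \<Rightarrow> ('e \<Rightarrow> 'f::euclidean_space) \<Rightarrow> bool" where
  "holo_on I I' S f \<longleftrightarrow> smooth_on S f \<and>
     (\<forall>p\<in>S. \<forall>w. frechet_derivative f (at p) (I w) = I' (frechet_derivative f (at p) w))"

definition I_vec :: "complex^'n \<Rightarrow> complex^'n" where
  "I_vec w = \<i> *s w"

section \<open>Manifolds given by atlases\<close>

text \<open>A chart is a pair of its domain and its coordinate map; the values of the coordinate map
  outside the domain are irrelevant.\<close>

type_synonym ('a, 'e) chart = "'a set \<times> ('a \<Rightarrow> 'e)"

definition chart_inv :: "('a, 'e) chart \<Rightarrow> 'e \<Rightarrow> 'a" where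
  "chart_inv c = inv_into (fst c) (snd c)"

definition carrier_of :: "('a, 'e) chart set \<Rightarrow> 'a set" where
  "carrier_of A = (\<Union>c\<in>A. fst c)"

definition atlas_topology :: "('a, 'e::euclidean_space) chart set \<Rightarrow> 'a topology" where
  "atlas_topology A =
     topology (\<lambda>W. W \<subseteq> carrier_of A \<and> (\<forall>c\<in>A. open (snd c ` (W \<inter> fst c))))"

definition complex_atlas :: "('e \<Rightarrow> 'e) \<Rightarrow> ('a, 'e::euclidean_space) chart set \<Rightarrow> bool" where
  "complex_atlas I A \<longleftrightarrow>
     (\<forall>c\<in>A. inj_on (snd c) (fst c)) \<and>
     (\<forall>c\<in>A. \<forall>c'\<in>A. open (snd c ` (fst c \<inter> fst c'))) \<and>
     (\<forall>c\<in>A. \<forall>c'\<in>A. holo_on I I (snd c ` (fst c \<inter> fst c')) (snd c' \<circ> chart_inv c))"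

definition complex_manifold :: "('a, complex^'n) chart set \<Rightarrow> bool" where
  "complex_manifold A \<longleftrightarrow> complex_atlas I_vec A \<and>
     Hausdorff_space (atlas_topology A) \<and> second_countable (atlas_topology A)"

definition chart_at :: "('a, 'e) chart set \<Rightarrow> 'a \<Rightarrow> ('a, 'e) chart" where
  "chart_at A x = (SOME c. c \<in> A \<and> x \<in> fst c)"

definition smooth_fun ::
  "('a, 'e::euclidean_space) chart set \<Rightarrow> 'a set \<Rightarrow> ('a \<Rightarrow> 'f::euclidean_space) \<Rightarrow> bool" where
  "smooth_fun A W f \<longleftrightarrow> (\<forall>c\<in>A. smooth_on (snd c ` (W \<inter> fst c)) (f \<circ> chart_inv c))"

definition holomorphic_map ::
  "('a, complex^'n) chart set \<Rightarrow> ('b, complex^'m) chart set \<Rightarrow> ('a \<Rightarrow> 'b) \<Rightarrow> bool" where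
  "holomorphic_map A B f \<longleftrightarrow>
     continuous_map (atlas_topology A) (atlas_topology B) f \<and>
     (\<forall>c\<in>A. \<forall>c'\<in>B. holo_on I_vec I_vec (snd c ` (fst c \<inter> f -` fst c')) (snd c' \<circ> f \<circ> chart_inv c))"

section \<open>Tangent vectors\<close>

text \<open>A tangent vector at \<open>x\<close> is \<open>x\<close> together with the family of its components in all charts
  around \<open>x\<close>, related by the Jacobians of the coordinate changes.  The components with respect to
  charts not containing \<open>x\<close> are set to \<open>0\<close>, so that equality is equality of tangent vectors.\<close>

type_synonym ('a, 'e) tvec = "'a \<times> (('a, 'e) chart \<Rightarrow> 'e)"

definition mk_tvec ::
  "('a, 'e::euclidean_space) chart set \<Rightarrow> ('a, 'e) chart \<Rightarrow> 'a \<Rightarrow> 'e \<Rightarrow> ('a, 'e) tvec" where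
  "mk_tvec A c x w =
     (x, \<lambda>c'. if c' \<in> A \<and> x \<in> fst c'
              then frechet_derivative (snd c' \<circ> chart_inv c) (at (snd c x)) w else 0)"

definition tspace :: "('a, 'e::euclidean_space) chart set \<Rightarrow> 'a \<Rightarrow> ('a, 'e) tvec set" where
  "tspace A x = {mk_tvec A c x w | c w. c \<in> A \<and> x \<in> fst c}"

definition tbundle :: "('a, 'e::euclidean_space) chart set \<Rightarrow> ('a, 'e) tvec set" where
  "tbundle A = (\<Union>x\<in>carrier_of A. tspace A x)"

definition tv_zero :: "'a \<Rightarrow> ('a, 'e::euclidean_space) tvec" where
  "tv_zero x = (x, \<lambda>c. 0)"

definition tv_add ::
  "('a, 'e::euclidean_space) tvec \<Rightarrow> ('a, 'e) tvec \<Rightarrow> ('a, 'e) tvec" where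
  "tv_add v w = (fst v, \<lambda>c. snd v c + snd w c)"

definition tv_scale :: "real \<Rightarrow> ('a, 'e::euclidean_space) tvec \<Rightarrow> ('a, 'e) tvec" where
  "tv_scale r v = (fst v, \<lambda>c. r *\<^sub>R snd v c)"

definition tv_J :: "('e \<Rightarrow> 'e) \<Rightarrow> ('a, 'e::euclidean_space) tvec \<Rightarrow> ('a, 'e) tvec" where
  "tv_J I v = (fst v, \<lambda>c. I (snd v c))"

definition tv_cscale :: "complex \<Rightarrow> ('a, complex^'n) tvec \<Rightarrow> ('a, complex^'n) tvec" where
  "tv_cscale z v = tv_add (tv_scale (Re z) v) (tv_scale (Im z) (tv_J I_vec v))"

definition tsubspace ::
  "('a, 'e::euclidean_space) chart set \<Rightarrow> 'a \<Rightarrow> ('a, 'e) tvec set \<Rightarrow> bool" where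
  "tsubspace A x W \<longleftrightarrow> W \<subseteq> tspace A x \<and> tv_zero x \<in> W \<and>
     (\<forall>v\<in>W. \<forall>w\<in>W. tv_add v w \<in> W) \<and> (\<forall>r. \<forall>v\<in>W. tv_scale r v \<in> W)"

definition tspan ::
  "('a, 'e::euclidean_space) chart set \<Rightarrow> 'a \<Rightarrow> ('a, 'e) tvec set \<Rightarrow> ('a, 'e) tvec set" where
  "tspan A x B = \<Inter>{W. tsubspace A x W \<and> B \<subseteq> W}"

text \<open>Real dimension of a subspace of the tangent space at \<open>x\<close>, computed in any chart around \<open>x\<close>.\<close>

definition tdim :: "('a, 'e::euclidean_space) chart set \<Rightarrow> 'a \<Rightarrow> ('a, 'e) tvec set \<Rightarrow> nat" where
  "tdim A x W = dim ((\<lambda>v. snd v (chart_at A x)) ` W)"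

definition tangent_atlas ::
  "('a, 'e::euclidean_space) chart set \<Rightarrow> (('a, 'e) tvec, 'e \<times> 'e) chart set" where
  "tangent_atlas A =
     (\<lambda>c. ({v \<in> tbundle A. fst v \<in> fst c}, \<lambda>v. (snd c (fst v), snd v c))) ` A"

definition pushforward ::
  "('a, 'e::euclidean_space) chart set \<Rightarrow> ('b, 'f::euclidean_space) chart set \<Rightarrow>
   ('a \<Rightarrow> 'b) \<Rightarrow> ('a, 'e) tvec \<Rightarrow> ('b, 'f) tvec" where
  "pushforward A B f v = (let c = chart_at A (fst v) in
     (f (fst v), \<lambda>c'. if c' \<in> B \<and> f (fst v) \<in> fst c'
        then frechet_derivative (snd c' \<circ> f \<circ> chart_inv c) (at (snd c (fst v))) (snd v c)
        else 0))"

text \<open>Tangent space at \<open>x\<close> of a submanifold \<open>S\<close>: the velocities of smooth curves in \<open>S\<close>.\<close>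

definition sub_tspace ::
  "('a, 'e::euclidean_space) chart set \<Rightarrow> 'a set \<Rightarrow> 'a \<Rightarrow> ('a, 'e) tvec set" where
  "sub_tspace A S x = {v \<in> tspace A x. \<exists>c\<in>A. \<exists>\<gamma>. \<exists>e>0.
     \<gamma> ` {-e<..<e} \<subseteq> S \<inter> fst c \<and> \<gamma> 0 = x \<and> smooth_on {-e<..<e::real} (snd c \<circ> \<gamma>) \<and>
     ((snd c \<circ> \<gamma>) has_vector_derivative snd v c) (at 0)}"

section \<open>Complex Finsler metrics\<close>

definition complex_finsler ::
  "('a, complex^'n) chart set \<Rightarrow> (('a, complex^'n) tvec \<Rightarrow> real) \<Rightarrow> bool" where
  "complex_finsler A F \<longleftrightarrow>
     (\<forall>v\<in>tbundle A. 0 \<le> F v) \<and>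
     continuous_map (atlas_topology (tangent_atlas A)) euclideanreal F \<and>
     smooth_fun (tangent_atlas A) {v \<in> tbundle A. v \<noteq> tv_zero (fst v)} F \<and>
     (\<forall>v\<in>tbundle A. v \<noteq> tv_zero (fst v) \<longrightarrow> 0 < F v) \<and>
     (\<forall>v\<in>tbundle A. \<forall>z. F (tv_cscale z v) = cmod z * F v)"

text \<open>An element \<open>a + \<i> b\<close> of the complexified tangent space is represented by the pair
  \<open>(a, b)\<close> of real tangent vectors.\<close>

type_synonym ('a, 'e) ctvec = "('a, 'e) tvec \<times> ('a, 'e) tvec"

definition ct_cnj :: "('a, 'e::euclidean_space) ctvec \<Rightarrow> ('a, 'e) ctvec" where
  "ct_cnj w = (fst w, tv_scale (-1) (snd w))"

definition dir_deriv ::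
  "(('a, 'e::euclidean_space) tvec \<Rightarrow> complex) \<Rightarrow> ('a, 'e) tvec \<Rightarrow> ('a, 'e) tvec \<Rightarrow> complex" where
  "dir_deriv g a v = vector_derivative (\<lambda>t. g (tv_add v (tv_scale t a))) (at 0)"

text \<open>\<open>const_field w g v\<close> is the derivative of \<open>g\<close> at \<open>v\<close> along the constant complex vector field
  \<open>w\<close> on the tangent space.\<close>

definition const_field ::
  "('a, 'e::euclidean_space) ctvec \<Rightarrow> (('a, 'e) tvec \<Rightarrow> complex) \<Rightarrow> ('a, 'e) tvec \<Rightarrow> complex" where
  "const_field w g v = dir_deriv g (fst w) v + \<i> * dir_deriv g (snd w) v"

definition finsler_h ::
  "(('a, complex^'n) tvec \<Rightarrow> real) \<Rightarrow> ('a, complex^'n) tvec \<Rightarrow>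
   ('a, complex^'n) ctvec \<Rightarrow> ('a, complex^'n) ctvec \<Rightarrow> complex" where
  "finsler_h F v w z =
     const_field w (const_field z (\<lambda>v'. complex_of_real ((F v')\<^sup>2))) v"

definition indicatrix ::
  "('a, complex^'n) chart set \<Rightarrow> (('a, complex^'n) tvec \<Rightarrow> real) \<Rightarrow> 'a \<Rightarrow> ('a, complex^'n) tvec set" where
  "indicatrix A F x = {v \<in> tspace A x. F v = 1}"

text \<open>The tangent space at \<open>v\<close> of the indicatrix through \<open>v\<close>, as a subset of the tangent space
  of the manifold at \<open>fst v\<close>.\<close>

definition indicatrix_tspace ::
  "('a, complex^'n) chart set \<Rightarrow> (('a, complex^'n) tvec \<Rightarrow> real) \<Rightarrow>
   ('a, complex^'n) tvec \<Rightarrow> ('a, complex^'n) tvec set" where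
  "indicatrix_tspace A F v = {w \<in> tspace A (fst v). \<exists>c\<in>A. \<exists>\<gamma>. \<exists>e>0. fst v \<in> fst c \<and>
     \<gamma> ` {-e<..<e} \<subseteq> indicatrix A F (fst v) \<and> \<gamma> 0 = v \<and>
     smooth_on {-e<..<e::real} (\<lambda>t. snd (\<gamma> t) c) \<and>
     ((\<lambda>t. snd (\<gamma> t) c) has_vector_derivative snd w c) (at 0)}"

text \<open>The maximal complex subspace \<open>\<D>\<^sub>v\<close>, as the union of all complex subspaces.\<close>

definition D_space ::
  "('a, complex^'n) chart set \<Rightarrow> (('a, complex^'n) tvec \<Rightarrow> real) \<Rightarrow>
   ('a, complex^'n) tvec \<Rightarrow> ('a, complex^'n) tvec set" where
  "D_space A F v = \<Union>{W. tsubspace A (fst v) W \<and> W \<subseteq> indicatrix_tspace A F v \<and>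
     (\<forall>w\<in>W. tv_J I_vec w \<in> W)}"

text \<open>Its holomorphic part: the \<open>\<i>\<close>-eigenspace of \<open>J\<close> in the complexification;
  \<open>(- b, a)\<close> is \<open>\<i> (a + \<i> b)\<close>.\<close>

definition D10_space ::
  "('a, complex^'n) chart set \<Rightarrow> (('a, complex^'n) tvec \<Rightarrow> real) \<Rightarrow>
   ('a, complex^'n) tvec \<Rightarrow> ('a, complex^'n) ctvec set" where
  "D10_space A F v = {(a, b). a \<in> D_space A F v \<and> b \<in> D_space A F v \<and>
     (tv_J I_vec a, tv_J I_vec b) = (tv_scale (-1) b, a)}"

definition strongly_pseudoconvex ::
  "('a, complex^'n) chart set \<Rightarrow> (('a, complex^'n) tvec \<Rightarrow> real) \<Rightarrow> bool" where
  "strongly_pseudoconvex A F \<longleftrightarrow>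
     (\<forall>x\<in>carrier_of A. \<forall>v\<in>indicatrix A F x. \<forall>X\<in>D10_space A F v.
        X \<noteq> (tv_zero x, tv_zero x) \<longrightarrow>
        Im (finsler_h F v X (ct_cnj X)) = 0 \<and> 0 < Re (finsler_h F v X (ct_cnj X)))"

definition biholomorphic_isometry ::
  "('a, complex^'n) chart set \<Rightarrow> (('a, complex^'n) tvec \<Rightarrow> real) \<Rightarrow> ('a \<Rightarrow> 'a) \<Rightarrow> bool" where
  "biholomorphic_isometry A F f \<longleftrightarrow>
     bij_betw f (carrier_of A) (carrier_of A) \<and>
     holomorphic_map A A f \<and> holomorphic_map A A (inv_into (carrier_of A) f) \<and>
     (\<forall>v\<in>tbundle A. F (pushforward A A f v) = F v)"

section \<open>Complex linear frames\<close>

type_synonym ('a, 'n) frame = "complex^'n \<Rightarrow> ('a, complex^'n) tvec"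

definition frame_base :: "('a, 'n::finite) frame \<Rightarrow> 'a" where
  "frame_base u = fst (u 0)"

definition frame_bundle :: "('a, complex^'n) chart set \<Rightarrow> ('a, 'n) frame set" where
  "frame_bundle A = {u. \<exists>x\<in>carrier_of A. bij_betw u UNIV (tspace A x) \<and>
     (\<forall>z w. u (z + w) = tv_add (u z) (u w)) \<and> (\<forall>k z. u (k *s z) = tv_cscale k (u z))}"

text \<open>The holomorphic charts of the frame bundle induced by the holomorphic charts of the manifold:
  coordinates of the base point, and the components of the images under \<open>u\<close> of the standard complex
  basis vectors (the columns of the matrix of \<open>u\<close>).  These charts define the standard complex
  structure \<open>frame_J\<close> (the bundle structure as a holomorphic principal bundle): in them the
  projection is the holomorphic map \<open>(q, B) \<mapsto> q\<close>, and each fibre is identified with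
  the open subset \<open>GL\<^sub>n\<close> of the space of matrices.  (These two properties alone do not pin the
  structure down: they allow twisting it by an antilinear map from horizontal to vertical vectors.)\<close>

definition frame_atlas ::
  "('a, complex^'n) chart set \<Rightarrow> (('a, 'n) frame, (complex^'n) \<times> ((complex^'n)^'n)) chart set" where
  "frame_atlas A =
     (\<lambda>c. ({u \<in> frame_bundle A. frame_base u \<in> fst c},
           \<lambda>u. (snd c (frame_base u), \<chi> j. snd (u (axis j 1)) c))) ` A"

definition I_frame :: "(complex^'n) \<times> ((complex^'n)^'n) \<Rightarrow> (complex^'n) \<times> ((complex^'n)^'n)" where
  "I_frame = (\<lambda>(q, B). (\<i> *s q, \<chi> j. \<i> *s (B $ j)))"

type_synonym ('a, 'n) frame_tvec = "(('a, 'n) frame, (complex^'n) \<times> ((complex^'n)^'n)) tvec"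

definition frame_J :: "('a, 'n::finite) frame_tvec \<Rightarrow> ('a, 'n) frame_tvec" where
  "frame_J X = tv_J I_frame X"

definition frame_lift ::
  "('a, complex^'n) chart set \<Rightarrow> ('a \<Rightarrow> 'a) \<Rightarrow> ('a, 'n) frame \<Rightarrow> ('a, 'n) frame" where
  "frame_lift A f u = pushforward A A f \<circ> u"

section \<open>The unitary frame bundle\<close>

text \<open>The standard complex coordinates are indexed by the type \<open>'n\<close>, and the element \<open>k0\<close> plays the
  role of the index \<open>0\<close>.  The vectors with indices \<open>2 \<alpha>\<close> and \<open>2 \<alpha> + 1\<close> of the real
  frame \<open>f\<close> are \<open>f_even u \<alpha>\<close> and \<open>f_odd u \<alpha>\<close>.\<close>

definition f_even :: "('a, 'n::finite) frame \<Rightarrow> 'n \<Rightarrow> ('a, complex^'n) tvec" where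
  "f_even u \<alpha> = u (axis \<alpha> 1)"

definition f_odd :: "('a, 'n::finite) frame \<Rightarrow> 'n \<Rightarrow> ('a, complex^'n) tvec" where
  "f_odd u \<alpha> = u (axis \<alpha> \<i>)"

definition e_vec :: "('a, 'n::finite) frame \<Rightarrow> 'n \<Rightarrow> ('a, complex^'n) ctvec" where
  "e_vec u \<alpha> = (tv_scale (1/2) (f_even u \<alpha>), tv_scale (-1/2) (f_odd u \<alpha>))"

definition unitary_frame_bundle ::
  "('a, complex^'n) chart set \<Rightarrow> (('a, complex^'n) tvec \<Rightarrow> real) \<Rightarrow> 'n \<Rightarrow> ('a, 'n) frame set" where
  "unitary_frame_bundle A F k0 = {u \<in> frame_bundle A.
     F (f_even u k0) = 1 \<and>
     tspan A (frame_base u) (f_even u ` (- {k0}) \<union> f_odd u ` (- {k0})) = D_space A F (f_even u k0) \<and>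
     (\<forall>l m. l \<noteq> k0 \<longrightarrow> m \<noteq> k0 \<longrightarrow>
        finsler_h F (f_even u k0) (e_vec u l) (ct_cnj (e_vec u m)) = (if l = m then 1 else 0))}"

section \<open>Non-linear connections\<close>

definition fibre :: "('a, 'e) tvec set \<Rightarrow> 'a \<Rightarrow> ('a, 'e) tvec set" where
  "fibre H x = {X \<in> H. fst X = x}"

definition smooth_field ::
  "('a, 'e::euclidean_space) chart set \<Rightarrow> 'a set \<Rightarrow> ('a \<Rightarrow> ('a, 'e) tvec) \<Rightarrow> bool" where
  "smooth_field A W X \<longleftrightarrow> (\<forall>p\<in>W. X p \<in> tspace A p) \<and>
     (\<forall>c\<in>A. smooth_on (snd c ` (W \<inter> fst c)) (\<lambda>q. snd (X (chart_inv c q)) c))"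

text \<open>A smooth distribution of rank \<open>r\<close> on a submanifold \<open>S\<close>, as a subset of the tangent bundle.
  Smoothness along \<open>S\<close> is expressed by smooth vector fields on open subsets of the ambient manifold
  whose restrictions to \<open>S\<close> span the distribution.\<close>

definition distribution ::
  "('a, 'e::euclidean_space) chart set \<Rightarrow> 'a set \<Rightarrow> nat \<Rightarrow> ('a, 'e) tvec set \<Rightarrow> bool" where
  "distribution A S r H \<longleftrightarrow>
     H \<subseteq> (\<Union>x\<in>S. sub_tspace A S x) \<and>
     (\<forall>x\<in>S. tsubspace A x (fibre H x) \<and> tdim A x (fibre H x) = r) \<and>
     (\<forall>x\<in>S. \<exists>W X. openin (atlas_topology A) W \<and> x \<in> W \<and>
        (\<forall>i<r. smooth_field A W (X i)) \<and>
        (\<forall>p\<in>W \<inter> S. fibre H p = tspan A p ((\<lambda>i. X i p) ` {..<r})))"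

definition vertical_space ::
  "('a, complex^'n) chart set \<Rightarrow> (('a, complex^'n) tvec \<Rightarrow> real) \<Rightarrow> 'n \<Rightarrow>
   ('a, 'n) frame \<Rightarrow> ('a, 'n) frame_tvec set" where
  "vertical_space A F k0 u =
     {X \<in> sub_tspace (frame_atlas A) (unitary_frame_bundle A F k0) u.
        pushforward (frame_atlas A) A frame_base X = tv_zero (frame_base u)}"

definition nonlinear_connection ::
  "('a, complex^'n) chart set \<Rightarrow> (('a, complex^'n) tvec \<Rightarrow> real) \<Rightarrow> 'n \<Rightarrow>
   ('a, 'n) frame_tvec set \<Rightarrow> bool" where
  "nonlinear_connection A F k0 H \<longleftrightarrow>
     distribution (frame_atlas A) (unitary_frame_bundle A F k0) (2 * CARD('n)) H \<and>
     (\<forall>u\<in>unitary_frame_bundle A F k0.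
        fibre H u \<inter> vertical_space A F k0 u = {tv_zero u} \<and>
        {tv_add X Y | X Y. X \<in> fibre H u \<and> Y \<in> vertical_space A F k0 u} =
          sub_tspace (frame_atlas A) (unitary_frame_bundle A F k0) u)"

definition hermitian_type ::
  "('a, complex^'n) chart set \<Rightarrow> (('a, complex^'n) tvec \<Rightarrow> real) \<Rightarrow> 'n \<Rightarrow>
   ('a, 'n) frame_tvec set \<Rightarrow> bool" where
  "hermitian_type A F k0 H \<longleftrightarrow>
     (\<forall>u\<in>unitary_frame_bundle A F k0. \<forall>X\<in>fibre H u. frame_J X \<in> fibre H u)"

end

(*
The squared metric G = F^2 has, in holomorphic coordinates (x, v) of TM, the matrix H(x, v) of mixed
second derivatives with respect to v and its conjugate.  By Euler's identities H has degree 0 in v and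
H(v, v) = G, H(w, v) = dG(w) (holomorphic derivative).  So, writing b_j for the columns of a frame B
and b_0 for the distinguished one, the conditions defining the unitary frame bundle merge into a
single equation: the Gram matrix Psi_jk(x, B) = H(x, b_0)(b_j, b_k) is the identity.

Velocities of curves in the bundle are exactly the kernel of d Psi; to realise a vector of the kernel,
apply the Gram-Schmidt process along the straight line with this velocity.  A connection of Hermitian
type has to lie in ker d Psi and in J (ker d Psi).  As Psi is Hermitian, this intersection is the kernel
of the complex linear part of d Psi, that is, the set of solutions (xi, beta) of

  H(beta_j, b_k) + (d_(xi, beta_0) H)(b_j, b_k) = 0   for all j, k.

The derivative of H in the direction (0, beta_0) vanishes on b_0, so the equations with j = 0 determine
beta_0 by xi, and then the others determine all beta_j.  Hence the intersection is the graph of a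
complex linear map of the horizontal component xi: it is a connection, and it is the only candidate.
Being described in terms of J and of the bundle only, it is preserved by every isometry.
*)

theory Submission
  imports Defs
begin

section \<open>Calculus of smooth maps\<close>

text \<open>The tangent space of the unitary frame bundle is a set of velocities of curves, so
  neither its linearity nor its dimension is given in advance. The obstacle to producing curves is
  that the form measuring a frame depends on the distinguished vector of that same frame. Two facts
  remove it: the form has degree 0 in that vector, and Gram-Schmidt started at that vector only
  rescales it. A frame orthonormalised for the form of the uncorrected line is therefore orthonormal
  for its own form as well. Definiteness of the full matrix is also a conclusion: pseudoconvexity
  gives it on the complex tangent space of the indicatrix, and Euler's identities make the remaining
  direction orthogonal to that space and of positive length. Uniqueness is a dimension count:
  invariance under the complex structure puts each fibre inside the candidate, and both have real
  dimension 2n. Coordinate changes of the frame bundle are treated as lifts of the identity map, so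
  one argument, resting on the symmetry of second derivatives, shows that they and the lifts of
  isometries are holomorphic.\<close>

abbreviation dd :: "('e::euclidean_space \<Rightarrow> 'f::euclidean_space) \<Rightarrow> 'e \<Rightarrow> 'e \<Rightarrow> 'f" where
  "dd f v x \<equiv> frechet_derivative f (at x) v"

lemma dd_eqI: "(f has_derivative f') (at x) \<Longrightarrow> dd f v x = f' v"
  using frechet_derivative_at by metis

section \<open>Congruence, restriction and continuity\<close>

lemma Ck_on_cong:
  assumes "open S" "\<And>x. x \<in> S \<Longrightarrow> f x = g x"
  shows "Ck_on k S f \<longleftrightarrow> Ck_on k S g"
proof -
  \<comment> \<open>One implication, for arbitrary functions, is enough because agreement on
    \<open>S\<close> is symmetric.\<close>
  have "Ck_on k S f \<Longrightarrow> Ck_on k S g" if "\<And>x. x \<in> S \<Longrightarrow> f x = g x" for f g :: "'a \<Rightarrow> 'b"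
    using that
  proof (induction k arbitrary: f g)
    case 0
    then show ?case using continuous_on_cong[of S S f g] by auto
  next
    case (Suc k)
    have d: "f differentiable_on S" using Suc.prems(1) by simp
    then have "g differentiable_on S"
      using Suc.prems(2) differentiable_transform_within[of f _ S 1 g] zero_less_one
      unfolding differentiable_on_def by fastforce
    moreover have "Ck_on k S (dd g v)" for v
    proof (rule Suc.IH)
      show "Ck_on k S (dd f v)" using Suc.prems(1) by simp
      fix x assume x: "x \<in> S"
      then have "f differentiable at x"
        using d \<open>open S\<close> by (metis at_within_open differentiable_on_def)
      then show "dd f v x = dd g v x"
        using frechet_derivative_transform_within_open[OF _ \<open>open S\<close> x, of f g] Suc.prems(2) by auto
    qed
    ultimately show ?case by simp
  qed
  then show ?thesis using assms(2) by metis
qed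

lemma smooth_on_cong:
  assumes "open S" "\<And>x. x \<in> S \<Longrightarrow> f x = g x"
  shows "smooth_on S f \<longleftrightarrow> smooth_on S g"
  unfolding smooth_on_def using Ck_on_cong[of S f g] assms by simp

lemma Ck_on_subset: "Ck_on k S f \<Longrightarrow> T \<subseteq> S \<Longrightarrow> Ck_on k T f"
  by (induction k arbitrary: f) (auto intro: continuous_on_subset differentiable_on_subset)

lemma smooth_on_subset: "smooth_on S f \<Longrightarrow> T \<subseteq> S \<Longrightarrow> smooth_on T f"
  unfolding smooth_on_def using Ck_on_subset by blast

lemma Ck_on_imp_continuous_on: "Ck_on k S f \<Longrightarrow> continuous_on S f"
  by (cases k) (auto intro: differentiable_imp_continuous_on)

lemma Ck_on_SucD: "Ck_on (Suc k) S f \<Longrightarrow> Ck_on k S f"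
  by (induction k arbitrary: f) (auto intro: differentiable_imp_continuous_on)

lemma smooth_on_imp_continuous_on: "smooth_on S f \<Longrightarrow> continuous_on S f"
  unfolding smooth_on_def using Ck_on_imp_continuous_on by blast

lemma smooth_on_imp_differentiable_on: "smooth_on S f \<Longrightarrow> f differentiable_on S"
  unfolding smooth_on_def by (metis Ck_on.simps(2))

lemma Ck_on_imp_differentiable: "Ck_on (Suc k) S f \<Longrightarrow> open S \<Longrightarrow> x \<in> S \<Longrightarrow> f differentiable at x"
  by (metis Ck_on.simps(2) at_within_open differentiable_on_def)

lemma smooth_on_imp_differentiable: "smooth_on S f \<Longrightarrow> open S \<Longrightarrow> x \<in> S \<Longrightarrow> f differentiable at x"
  using smooth_on_imp_differentiable_on by (metis at_within_open differentiable_on_def)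

lemma smooth_on_has_derivative:
  "smooth_on S f \<Longrightarrow> open S \<Longrightarrow> x \<in> S \<Longrightarrow> (f has_derivative (\<lambda>v. dd f v x)) (at x)"
  using smooth_on_imp_differentiable frechet_derivative_works by metis

lemma Ck_on_has_derivative:
  "Ck_on (Suc k) S f \<Longrightarrow> open S \<Longrightarrow> x \<in> S \<Longrightarrow> (f has_derivative (\<lambda>v. dd f v x)) (at x)"
  using Ck_on_imp_differentiable frechet_derivative_works by metis

lemma smooth_on_dd: "smooth_on S f \<Longrightarrow> smooth_on S (dd f v)"
  unfolding smooth_on_def by (metis Ck_on.simps(2))

text \<open>Most closure properties below are inductions on the order; this rule lets their steps
  work with an explicit derivative in place of \<open>frechet_derivative\<close>, with which it
  agrees at every point of the open set.\<close>

lemma Ck_on_SucI: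
  assumes "open S" "\<And>x. x \<in> S \<Longrightarrow> (f has_derivative f' x) (at x)" "\<And>v. Ck_on k S (\<lambda>x. f' x v)"
  shows "Ck_on (Suc k) S f"
proof -
  have "dd f v x = f' x v" if "x \<in> S" for x v
    using dd_eqI assms(2)[OF that] by blast
  then have "Ck_on k S (dd f v)" for v
    using Ck_on_cong[OF \<open>open S\<close>, of "dd f v" "\<lambda>x. f' x v"] assms(3) by blast
  moreover have "f differentiable_on S"
    using assms(1,2) by (meson differentiable_at_withinI differentiable_def differentiable_on_def)
  ultimately show ?thesis by simp
qed

section \<open>Closure properties of smooth maps\<close>

lemma Ck_on_const: "open S \<Longrightarrow> Ck_on k S (\<lambda>x. c)"
proof (induction k arbitrary: c)
  case (Suc k)
  show ?case by (rule Ck_on_SucI[where f' = "\<lambda>x v. 0"]) (use Suc in auto)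
qed simp

lemma smooth_on_const [intro]: "open S \<Longrightarrow> smooth_on S (\<lambda>x. c)"
  unfolding smooth_on_def using Ck_on_const by blast

lemma smooth_on_linear:
  assumes "bounded_linear f" "open S"
  shows "smooth_on S f"
  unfolding smooth_on_def
proof
  fix k show "Ck_on k S f"
  proof (cases k)
    case 0
    then show ?thesis using assms linear_continuous_on by auto
  next
    case (Suc n)
    show ?thesis unfolding Suc
      by (rule Ck_on_SucI[where f' = "\<lambda>x. f"])
        (use assms Ck_on_const bounded_linear_imp_has_derivative in auto)
  qed
qed

lemma smooth_on_id: "open S \<Longrightarrow> smooth_on S (\<lambda>x. x)"
  by (rule smooth_on_linear[OF bounded_linear_ident])

lemma Ck_on_add:
  assumes "open S" "Ck_on k S f" "Ck_on k S g"
  shows "Ck_on k S (\<lambda>x. f x + g x)"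
  using assms(2,3)
proof (induction k arbitrary: f g)
  case 0 then show ?case by (auto intro: continuous_on_add)
next
  case (Suc k)
  show ?case
    by (rule Ck_on_SucI[where f' = "\<lambda>x v. dd f v x + dd g v x"])
      (use Suc assms(1) in \<open>auto intro!: has_derivative_add Ck_on_has_derivative\<close>)
qed

lemma Ck_on_sum:
  assumes "open S" "\<And>i. i \<in> I \<Longrightarrow> Ck_on k S (f i)"
  shows "Ck_on k S (\<lambda>x. \<Sum>i\<in>I. f i x)"
  using assms(2)
  by (induction I rule: infinite_finite_induct) (auto intro!: Ck_on_add Ck_on_const assms(1))

lemma Ck_on_bilinear:
  assumes "bounded_bilinear p" "open S" "Ck_on k S f" "Ck_on k S g"
  shows "Ck_on k S (\<lambda>x. p (f x) (g x))"
  using assms(3,4)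
proof (induction k arbitrary: f g)
  case 0 then show ?case using bounded_bilinear.continuous_on[OF assms(1)] by auto
next
  case (Suc k)
  show ?case
  proof (rule Ck_on_SucI[where f' = "\<lambda>x v. p (f x) (dd g v x) + p (dd f v x) (g x)"])
    fix v
    have "Ck_on k S (dd f v)" "Ck_on k S (dd g v)" using Suc.prems by auto
    then show "Ck_on k S (\<lambda>x. p (f x) (dd g v x) + p (dd f v x) (g x))"
      using Ck_on_add[OF assms(2) Suc.IH Suc.IH] Suc.prems Ck_on_SucD by metis
  qed (use Suc.prems assms in \<open>auto intro!: bounded_bilinear.FDERIV Ck_on_has_derivative\<close>)
qed

text \<open>The chain rule differentiates \<open>g\<close> in the direction \<open>dd f v x\<close>,
  which varies with \<open>x\<close>, whereas \<open>Ck_on\<close> speaks of fixed directions.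
  Expanding the direction in the basis leaves a finite sum of products, and the induction hypothesis
  covers each factor that involves \<open>g\<close>.\<close>

lemma Ck_on_compose:
  assumes "open S" "open T" "Ck_on k T g" "Ck_on k S f" "f ` S \<subseteq> T"
  shows "Ck_on k S (\<lambda>x. g (f x))"
  using assms(3,4)
proof (induction k arbitrary: g)
  case 0
  then show ?case using continuous_on_compose2[of T g S f] assms(5) by auto
next
  case (Suc k)
  have g': "(g has_derivative (\<lambda>v. dd g v (f x))) (at (f x))" if "x \<in> S" for x
    using Ck_on_has_derivative[OF Suc.prems(1) assms(2)] that assms(5) by blast
  show ?case
  proof (rule Ck_on_SucI[where f' = "\<lambda>x v. \<Sum>b\<in>Basis. (dd f v x \<bullet> b) *\<^sub>R dd g b (f x)"])
    fix x assume x: "x \<in> S"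
    interpret l: bounded_linear "\<lambda>v. dd g v (f x)"
      using g'[OF x] by (rule has_derivative_bounded_linear)
    have "dd g (dd f v x) (f x) = (\<Sum>b\<in>Basis. (dd f v x \<bullet> b) *\<^sub>R dd g b (f x))" for v
      by (subst euclidean_representation[of "dd f v x", symmetric]) (simp add: l.sum l.scaleR)
    then have "(\<lambda>v. dd g (dd f v x) (f x)) = (\<lambda>v. \<Sum>b\<in>Basis. (dd f v x \<bullet> b) *\<^sub>R dd g b (f x))"
      by blast
    then show "((\<lambda>x. g (f x)) has_derivative (\<lambda>v. \<Sum>b\<in>Basis. (dd f v x \<bullet> b) *\<^sub>R dd g b (f x))) (at x)"
      using has_derivative_compose[OF Ck_on_has_derivative[OF Suc.prems(2) assms(1) x] g'[OF x]] by metis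
  next
    fix v
    have "Ck_on k S (\<lambda>x. dd f v x \<bullet> b)" for b
      by (rule Ck_on_bilinear[OF bounded_bilinear_inner assms(1) _ Ck_on_const[OF assms(1)]])
        (use Suc.prems in auto)
    moreover have "Ck_on k S (\<lambda>x. dd g b (f x))" for b
      using Suc.prems(1) Ck_on_SucD[OF Suc.prems(2)] by (intro Suc.IH) auto
    ultimately show "Ck_on k S (\<lambda>x. \<Sum>b\<in>Basis. (dd f v x \<bullet> b) *\<^sub>R dd g b (f x))"
      by (intro Ck_on_sum Ck_on_bilinear[OF bounded_bilinear_scaleR] assms(1))
  qed (rule assms(1))
qed

lemma smooth_on_compose:
  "open S \<Longrightarrow> open T \<Longrightarrow> smooth_on T g \<Longrightarrow> smooth_on S f \<Longrightarrow> f ` S \<subseteq> T \<Longrightarrow> smooth_on S (\<lambda>x. g (f x))"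
  unfolding smooth_on_def using Ck_on_compose by blast

lemma smooth_on_compose_linear:
  "bounded_linear g \<Longrightarrow> open S \<Longrightarrow> smooth_on S f \<Longrightarrow> smooth_on S (\<lambda>x. g (f x))"
  using smooth_on_compose[OF _ open_UNIV smooth_on_linear] by blast

lemma smooth_on_add:
  "open S \<Longrightarrow> smooth_on S f \<Longrightarrow> smooth_on S g \<Longrightarrow> smooth_on S (\<lambda>x. f x + g x)"
  unfolding smooth_on_def using Ck_on_add by blast

lemma smooth_on_sum:
  "open S \<Longrightarrow> (\<And>i. i \<in> I \<Longrightarrow> smooth_on S (f i)) \<Longrightarrow> smooth_on S (\<lambda>x. \<Sum>i\<in>I. f i x)"
  by (simp add: smooth_on_def Ck_on_sum)

lemma smooth_on_bilinear:
  "bounded_bilinear p \<Longrightarrow> open S \<Longrightarrow> smooth_on S f \<Longrightarrow> smooth_on S g \<Longrightarrow> smooth_on S (\<lambda>x. p (f x) (g x))"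
  by (simp add: smooth_on_def Ck_on_bilinear)

lemmas smooth_on_mult = smooth_on_bilinear[OF bounded_bilinear_mult]
  and smooth_on_scaleR = smooth_on_bilinear[OF bounded_bilinear_scaleR]

lemma smooth_on_minus: "open S \<Longrightarrow> smooth_on S f \<Longrightarrow> smooth_on S (\<lambda>x. - f x)"
  by (rule smooth_on_compose_linear[OF bounded_linear_minus[OF bounded_linear_ident]])

lemma smooth_on_diff:
  "open S \<Longrightarrow> smooth_on S f \<Longrightarrow> smooth_on S g \<Longrightarrow> smooth_on S (\<lambda>x. f x - g x)"
  using smooth_on_add[OF _ _ smooth_on_minus, of S f g] by simp

lemma smooth_on_prod:
  fixes f :: "'i \<Rightarrow> 'e::euclidean_space \<Rightarrow> complex"
  shows "open S \<Longrightarrow> (\<And>i. i \<in> I \<Longrightarrow> smooth_on S (f i)) \<Longrightarrow> smooth_on S (\<lambda>x. \<Prod>i\<in>I. f i x)"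
  by (induction I rule: infinite_finite_induct) (auto intro!: smooth_on_mult)

lemma smooth_on_Pair:
  assumes "open S" "smooth_on S f" "smooth_on S g"
  shows "smooth_on S (\<lambda>x. (f x, g x))"
proof -
  have "smooth_on S (\<lambda>x. (f x, 0) + (0, g x))"
    by (intro smooth_on_add assms smooth_on_compose_linear[where f = f] smooth_on_compose_linear[where f = g]
        bounded_linear_Pair bounded_linear_ident bounded_linear_zero)
  then show ?thesis by simp
qed

lemma smooth_on_fst: "open S \<Longrightarrow> smooth_on S f \<Longrightarrow> smooth_on S (\<lambda>x. fst (f x))"
  and smooth_on_snd: "open S \<Longrightarrow> smooth_on S f \<Longrightarrow> smooth_on S (\<lambda>x. snd (f x))"
  by (auto intro: smooth_on_compose_linear bounded_linear_fst bounded_linear_snd)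

lemma bounded_linear_vec_axis: "bounded_linear (\<lambda>w::'f::euclidean_space. \<chi> i. if i = j then w else 0)"
  by (rule linear_conv_bounded_linear[THEN iffD1], rule linearI) (auto simp: vec_eq_iff)

lemma smooth_on_vec_nth: "open S \<Longrightarrow> smooth_on S f \<Longrightarrow> smooth_on S (\<lambda>x. f x $ i)"
  by (rule smooth_on_compose_linear[OF bounded_linear_vec_nth])

lemma smooth_on_vec_lambda:
  fixes f :: "'i::finite \<Rightarrow> 'e::euclidean_space \<Rightarrow> 'f::euclidean_space"
  assumes "open S" "\<And>i. smooth_on S (f i)"
  shows "smooth_on S (\<lambda>x. \<chi> i. f i x)"
proof -
  have "smooth_on S (\<lambda>x. \<Sum>j\<in>UNIV. \<chi> i. if i = j then f j x else 0)"
    by (intro smooth_on_sum assms smooth_on_compose_linear[OF bounded_linear_vec_axis])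
  moreover have "(\<Sum>j\<in>UNIV. \<chi> i. if i = j then f j x else 0) = (\<chi> i. f i x)" for x
    by (simp add: vec_eq_iff)
  ultimately show ?thesis by simp
qed

lemma Ck_on_inverse:
  fixes f :: "'e::euclidean_space \<Rightarrow> 'f::{real_normed_field,euclidean_space}"
  assumes "open S" "Ck_on k S f" "\<And>x. x \<in> S \<Longrightarrow> f x \<noteq> 0"
  shows "Ck_on k S (\<lambda>x. inverse (f x))"
  using assms(2)
proof (induction k)
  case 0 then show ?case using assms by (auto intro: continuous_on_inverse)
next
  case (Suc k)
  show ?case
  \<comment> \<open>The derivative contains the reciprocal again, but only to the order that the
    induction hypothesis supplies. Writing the sign as a factor keeps the expression a
    product.\<close>
  proof (rule Ck_on_SucI[where f' = "\<lambda>x v. - 1 * (inverse (f x) * dd f v x * inverse (f x))"])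
    fix x assume "x \<in> S"
    then show "((\<lambda>x. inverse (f x)) has_derivative
        (\<lambda>v. - 1 * (inverse (f x) * dd f v x * inverse (f x)))) (at x)"
      using Deriv.has_derivative_inverse[OF _ Ck_on_has_derivative[OF Suc.prems assms(1)]] assms(3) by simp
  next
    fix v show "Ck_on k S (\<lambda>x. - 1 * (inverse (f x) * dd f v x * inverse (f x)))"
      using Suc Ck_on_SucD[OF Suc.prems]
      by (intro Ck_on_bilinear[OF bounded_bilinear_mult] Ck_on_const assms(1)) auto
  qed (rule assms(1))
qed

lemma smooth_on_inverse:
  fixes f :: "'e::euclidean_space \<Rightarrow> 'f::{real_normed_field,euclidean_space}"
  shows "open S \<Longrightarrow> smooth_on S f \<Longrightarrow> (\<And>x. x \<in> S \<Longrightarrow> f x \<noteq> 0) \<Longrightarrow> smooth_on S (\<lambda>x. inverse (f x))"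
  by (simp add: smooth_on_def Ck_on_inverse)

lemma smooth_on_divide:
  fixes f :: "'e::euclidean_space \<Rightarrow> 'f::{real_normed_field,euclidean_space}"
  shows "open S \<Longrightarrow> smooth_on S f \<Longrightarrow> smooth_on S g \<Longrightarrow> (\<And>x. x \<in> S \<Longrightarrow> g x \<noteq> 0) \<Longrightarrow>
    smooth_on S (\<lambda>x. f x / g x)"
  unfolding divide_inverse by (intro smooth_on_mult smooth_on_inverse)

lemma Ck_on_sqrt:
  fixes f :: "'e::euclidean_space \<Rightarrow> real"
  assumes "open S" "Ck_on k S f" "\<And>x. x \<in> S \<Longrightarrow> f x > 0"
  shows "Ck_on k S (\<lambda>x. sqrt (f x))"
  using assms(2)
proof (induction k)
  case 0 then show ?case using assms by (auto intro: continuous_intros)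
next
  case (Suc k)
  show ?case
  proof (rule Ck_on_SucI[where f' = "\<lambda>x v. dd f v x * inverse (2 * sqrt (f x))"])
    fix x assume x: "x \<in> S"
    have "inverse (sqrt (f x)) / 2 = inverse (2 * sqrt (f x))" by (simp add: field_simps)
    then show "((\<lambda>x. sqrt (f x)) has_derivative (\<lambda>v. dd f v x * inverse (2 * sqrt (f x)))) (at x)"
      using has_derivative_real_sqrt[OF assms(3)[OF x] Ck_on_has_derivative[OF Suc.prems assms(1) x]]
      by metis
  next
    have "2 * sqrt (f x) \<noteq> 0" if "x \<in> S" for x using assms(3)[OF that] by simp
    moreover have "Ck_on k S (\<lambda>x. sqrt (f x))" using Suc.IH Ck_on_SucD[OF Suc.prems] by blast
    ultimately show "Ck_on k S (\<lambda>x. dd f v x * inverse (2 * sqrt (f x)))" for v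
      using Suc.prems
      by (intro Ck_on_bilinear[OF bounded_bilinear_mult] Ck_on_inverse Ck_on_const assms(1)) auto
  qed (rule assms(1))
qed

lemma smooth_on_sqrt:
  fixes f :: "'e::euclidean_space \<Rightarrow> real"
  shows "open S \<Longrightarrow> smooth_on S f \<Longrightarrow> (\<And>x. x \<in> S \<Longrightarrow> f x > 0) \<Longrightarrow> smooth_on S (\<lambda>x. sqrt (f x))"
  by (simp add: smooth_on_def Ck_on_sqrt)

lemma smooth_on_det:
  fixes M :: "'e::euclidean_space \<Rightarrow> complex^'n^'n"
  assumes "open S" "\<And>i j. smooth_on S (\<lambda>x. M x $ i $ j)"
  shows "smooth_on S (\<lambda>x. det (M x))"
  unfolding det_def by (intro smooth_on_sum smooth_on_mult smooth_on_const smooth_on_prod assms)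

section \<open>Variable directions and symmetry of second derivatives\<close>

lemma dd_linear:
  assumes "smooth_on S f" "open S" "x \<in> S"
  shows "linear (\<lambda>v. dd f v x)"
  using smooth_on_has_derivative[OF assms] has_derivative_linear by blast

text \<open>Base point and direction both vary here. Linearity in the direction reduces this to the
  finitely many fixed directions of the basis. It serves the derivative of the Levi matrix along a
  moving frame and the Jacobians acting on frame vectors.\<close>

lemma smooth_on_dd_apply:
  assumes "open S" "open T" "smooth_on T f" "smooth_on S p" "p ` S \<subseteq> T" "smooth_on S w"
  shows "smooth_on S (\<lambda>x. dd f (w x) (p x))"
proof -
  have "dd f (w x) (p x) = (\<Sum>b\<in>Basis. (w x \<bullet> b) *\<^sub>R dd f b (p x))" if "x \<in> S" for x
  proof -
    interpret l: linear "\<lambda>v. dd f v (p x)"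
      using dd_linear assms(2,3,5) that by blast
    show ?thesis
      by (subst euclidean_representation[of "w x", symmetric]) (simp add: l.sum l.scaleR)
  qed
  moreover have "smooth_on S (\<lambda>x. \<Sum>b\<in>Basis. (w x \<bullet> b) *\<^sub>R dd f b (p x))"
    by (intro smooth_on_sum smooth_on_scaleR smooth_on_bilinear[OF bounded_bilinear_inner] assms smooth_on_const
        smooth_on_compose[OF assms(1,2) smooth_on_dd[OF assms(3)]])
  ultimately show ?thesis by (subst smooth_on_cong[OF \<open>open S\<close>])
qed

lemma has_vector_derivative_dd:
  assumes "smooth_on S f" "open S" "p t \<in> S" "(p has_vector_derivative v) (at t)"
  shows "((\<lambda>t. f (p t)) has_vector_derivative dd f v (p t)) (at t)"
proof -
  have "(\<lambda>h. dd f (h *\<^sub>R v) (p t)) = (\<lambda>h. h *\<^sub>R dd f v (p t))"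
    using linear_scale[OF dd_linear[OF assms(1-3)]] by (intro ext)
  then show ?thesis
    using has_derivative_compose[OF assms(4)[unfolded has_vector_derivative_def] smooth_on_has_derivative[OF assms(1-3)]]
    unfolding has_vector_derivative_def by metis
qed

text \<open>Two applications of the mean value theorem to the second difference.\<close>

lemma second_difference_mvt:
  fixes f :: "'e::euclidean_space \<Rightarrow> real"
  assumes f: "smooth_on S f" "open S" and e: "e > 0"
    and S: "\<And>s t. 0 \<le> s \<Longrightarrow> s \<le> e \<Longrightarrow> 0 \<le> t \<Longrightarrow> t \<le> e \<Longrightarrow> x + s *\<^sub>R v + t *\<^sub>R w \<in> S"
  shows "\<exists>s t. 0 < s \<and> s < e \<and> 0 < t \<and> t < e \<and>
    f (x + e *\<^sub>R v + e *\<^sub>R w) - f (x + e *\<^sub>R v) - f (x + e *\<^sub>R w) + f x = e * e * dd (dd f v) w (x + s *\<^sub>R v + t *\<^sub>R w)"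
proof -
  \<comment> \<open>With the \<open>w\<close>-increment kept at its full length \<open>e\<close>,
    the second difference is the increment of \<open>\<phi>\<close> from 0 to
    \<open>e\<close>.\<close>
  define \<phi> where "\<phi> s = f (x + s *\<^sub>R v + e *\<^sub>R w) - f (x + s *\<^sub>R v)" for s
  have d1: "((\<lambda>s. f (x + s *\<^sub>R v + t *\<^sub>R w)) has_real_derivative dd f v (x + s *\<^sub>R v + t *\<^sub>R w)) (at s)"
    if "0 \<le> s" "s \<le> e" "0 \<le> t" "t \<le> e" for s t
  proof -
    have "((\<lambda>s. x + s *\<^sub>R v + t *\<^sub>R w) has_vector_derivative v) (at s)"
      by (auto intro!: derivative_eq_intros)
    from has_vector_derivative_dd[OF f S[OF that] this]
    show ?thesis unfolding has_real_derivative_iff_has_vector_derivative .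
  qed
  have "(\<phi> has_real_derivative dd f v (x + s *\<^sub>R v + e *\<^sub>R w) - dd f v (x + s *\<^sub>R v)) (at s)"
    if "0 \<le> s" "s \<le> e" for s
    unfolding \<phi>_def using d1[OF that, of e] d1[OF that, of 0] e by (intro DERIV_diff) auto
  then obtain s where s: "0 < s" "s < e"
    and \<phi>: "\<phi> e - \<phi> 0 = (e - 0) * (dd f v (x + s *\<^sub>R v + e *\<^sub>R w) - dd f v (x + s *\<^sub>R v))"
    using MVT2[OF e, of \<phi> "\<lambda>s. dd f v (x + s *\<^sub>R v + e *\<^sub>R w) - dd f v (x + s *\<^sub>R v)"] by auto
  have d2: "((\<lambda>t. dd f v (x + s *\<^sub>R v + t *\<^sub>R w)) has_real_derivative dd (dd f v) w (x + s *\<^sub>R v + t *\<^sub>R w)) (at t)"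
    if "0 \<le> t" "t \<le> e" for t
  proof -
    have in_S: "x + s *\<^sub>R v + t *\<^sub>R w \<in> S" using S s that by auto
    have "((\<lambda>t. x + s *\<^sub>R v + t *\<^sub>R w) has_vector_derivative w) (at t)"
      by (auto intro!: derivative_eq_intros)
    from has_vector_derivative_dd[OF smooth_on_dd[OF f(1)] f(2) in_S this]
    show ?thesis unfolding has_real_derivative_iff_has_vector_derivative .
  qed
  obtain t where "0 < t" "t < e"
    "dd f v (x + s *\<^sub>R v + e *\<^sub>R w) - dd f v (x + s *\<^sub>R v + 0 *\<^sub>R w) = (e - 0) * dd (dd f v) w (x + s *\<^sub>R v + t *\<^sub>R w)"
    using MVT2[OF e, of "\<lambda>t. dd f v (x + s *\<^sub>R v + t *\<^sub>R w)" "\<lambda>t. dd (dd f v) w (x + s *\<^sub>R v + t *\<^sub>R w)"] d2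
    by auto
  then show ?thesis using s \<phi> unfolding \<phi>_def by (intro exI[of _ s] exI[of _ t]) (simp add: algebra_simps)
qed

text \<open>The second difference is symmetric in \<open>v\<close> and \<open>w\<close>, so the two
  orders of applying the mean value theorem give equal mixed derivatives at two points of one small
  parallelogram. Continuity at \<open>x\<close> then excludes a gap.\<close>

lemma dd_commute_real:
  fixes f :: "'e::euclidean_space \<Rightarrow> real"
  assumes f: "smooth_on S f" "open S" and x: "x \<in> S"
  shows "dd (dd f v) w x = dd (dd f w) v x"
proof (rule ccontr)
  assume ne: "dd (dd f v) w x \<noteq> dd (dd f w) v x"
  \<comment> \<open>Half the gap: values closer than \<open>d\<close> to the two mixed derivatives
    at \<open>x\<close> cannot coincide.\<close>
  define d where "d = \<bar>dd (dd f v) w x - dd (dd f w) v x\<bar> / 2"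
  have "d > 0" using ne by (simp add: d_def)
  have c: "continuous_on S (dd (dd f a) b)" for a b
    by (intro smooth_on_imp_continuous_on smooth_on_dd f(1))
  obtain e1 where e1: "e1 > 0" "\<And>y. y \<in> S \<Longrightarrow> dist y x < e1 \<Longrightarrow> dist (dd (dd f v) w y) (dd (dd f v) w x) < d"
    using c[of v w, unfolded continuous_on_iff, rule_format, OF x \<open>d > 0\<close>] by blast
  obtain e2 where e2: "e2 > 0" "\<And>y. y \<in> S \<Longrightarrow> dist y x < e2 \<Longrightarrow> dist (dd (dd f w) v y) (dd (dd f w) v x) < d"
    using c[of w v, unfolded continuous_on_iff, rule_format, OF x \<open>d > 0\<close>] by blast
  obtain e3 where e3: "e3 > 0" "ball x e3 \<subseteq> S" using f(2) x openE by blast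
  define r where "r = min e1 (min e2 e3)"
  \<comment> \<open>Chosen so that the parallelogram with parameters up to \<open>e\<close> stays
    within distance \<open>r\<close> of \<open>x\<close>. The summand 1 keeps the denominator
    positive when both vectors vanish and makes the estimate strict.\<close>
  define e where "e = r / (norm v + norm w + 1)"
  have r: "r > 0" "r \<le> e1" "r \<le> e2" "r \<le> e3" using e1 e2 e3 by (auto simp: r_def)
  have pos: "norm v + norm w + 1 > 0" by (smt (verit) norm_ge_zero)
  have e: "e > 0" using r(1) pos by (simp add: e_def)
  have near: "dist (x + s *\<^sub>R v + t *\<^sub>R w) x < r" if "0 \<le> s" "s \<le> e" "0 \<le> t" "t \<le> e" for s t
  proof -
    have "dist (x + s *\<^sub>R v + t *\<^sub>R w) x = norm (s *\<^sub>R v + t *\<^sub>R w)" by (simp add: dist_norm add.assoc)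
    also have "\<dots> \<le> s * norm v + t * norm w"
      using norm_triangle_ineq[of "s *\<^sub>R v" "t *\<^sub>R w"] that by simp
    also have "\<dots> \<le> e * norm v + e * norm w"
      using that by (intro add_mono mult_right_mono) auto
    also have "\<dots> < e * (norm v + norm w + 1)" using e by (simp add: algebra_simps)
    also have "\<dots> = r" using pos by (simp add: e_def)
    finally show ?thesis .
  qed
  then have in_S: "x + s *\<^sub>R v + t *\<^sub>R w \<in> S" if "0 \<le> s" "s \<le> e" "0 \<le> t" "t \<le> e" for s t
    using e3(2) r(4) that by (smt (verit) dist_commute mem_ball subsetD)
  obtain s t where st: "0 < s" "s < e" "0 < t" "t < e"
    "f (x + e *\<^sub>R v + e *\<^sub>R w) - f (x + e *\<^sub>R v) - f (x + e *\<^sub>R w) + f x = e * e * dd (dd f v) w (x + s *\<^sub>R v + t *\<^sub>R w)"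
    using second_difference_mvt[OF f e in_S] by blast
  have in_S': "x + s *\<^sub>R w + t *\<^sub>R v \<in> S" if "0 \<le> s" "s \<le> e" "0 \<le> t" "t \<le> e" for s t
    using in_S[OF that(3,4,1,2)] by (simp add: add.commute add.left_commute)
  obtain s' t' where st': "0 < s'" "s' < e" "0 < t'" "t' < e"
    "f (x + e *\<^sub>R w + e *\<^sub>R v) - f (x + e *\<^sub>R w) - f (x + e *\<^sub>R v) + f x = e * e * dd (dd f w) v (x + s' *\<^sub>R w + t' *\<^sub>R v)"
    using second_difference_mvt[OF f e in_S'] by blast
  have "e * e * dd (dd f v) w (x + s *\<^sub>R v + t *\<^sub>R w) = e * e * dd (dd f w) v (x + s' *\<^sub>R w + t' *\<^sub>R v)"
    using st(5) st'(5) by (simp add: algebra_simps)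
  then have eq: "dd (dd f v) w (x + s *\<^sub>R v + t *\<^sub>R w) = dd (dd f w) v (x + t' *\<^sub>R v + s' *\<^sub>R w)"
    using e by (simp add: algebra_simps)
  have "dist (dd (dd f v) w (x + s *\<^sub>R v + t *\<^sub>R w)) (dd (dd f v) w x) < d"
    using e1(2) near[of s t] in_S[of s t] st r by auto
  moreover have "dist (dd (dd f w) v (x + t' *\<^sub>R v + s' *\<^sub>R w)) (dd (dd f w) v x) < d"
    using e2(2) near[of t' s'] in_S[of t' s'] st' r by auto
  ultimately show False using eq d_def by (simp add: dist_real_def abs_if split: if_splits)
qed

lemma dd_compose_linear:
  assumes "bounded_linear l" "f differentiable at x"
  shows "dd (\<lambda>y. l (f y)) v x = l (dd f v x)"
  using bounded_linear.has_derivative[OF assms(1) assms(2)[unfolded frechet_derivative_works]] dd_eqI by fast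

lemma dd_cong_open:
  assumes "open S" "x \<in> S" "f differentiable at x" "\<And>y. y \<in> S \<Longrightarrow> f y = g y"
  shows "dd f v x = dd g v x"
  using frechet_derivative_transform_within_open[OF assms(3,1,2)] assms(4) by metis

lemma dd_commute:
  fixes f :: "'e::euclidean_space \<Rightarrow> 'f::euclidean_space"
  assumes f: "smooth_on S f" "open S" and x: "x \<in> S"
  shows "dd (dd f v) w x = dd (dd f w) v x"
proof (rule euclidean_eqI)
  fix b :: 'f
  have fb: "smooth_on S (\<lambda>y. f y \<bullet> b)"
    by (rule smooth_on_compose_linear[OF bounded_linear_inner_left f(2,1)])
  have "dd (dd (\<lambda>y. f y \<bullet> b) a) c x = dd (dd f a) c x \<bullet> b" for a c
  proof -
    have "dd (\<lambda>y. f y \<bullet> b) a y = dd f a y \<bullet> b" if "y \<in> S" for y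
      by (rule dd_compose_linear[OF bounded_linear_inner_left smooth_on_imp_differentiable[OF f that]])
    then have "dd (dd (\<lambda>y. f y \<bullet> b) a) c x = dd (\<lambda>y. dd f a y \<bullet> b) c x"
      by (rule dd_cong_open[OF f(2) x smooth_on_imp_differentiable[OF smooth_on_dd[OF fb] f(2) x]])
    also have "\<dots> = dd (dd f a) c x \<bullet> b"
      by (rule dd_compose_linear[OF bounded_linear_inner_left smooth_on_imp_differentiable[OF smooth_on_dd[OF f(1)] f(2) x]])
    finally show ?thesis .
  qed
  then show "dd (dd f v) w x \<bullet> b = dd (dd f w) v x \<bullet> b"
    using dd_commute_real[OF fb f(2) x] by metis
qed

section \<open>Atlases, tangent spaces and holomorphic maps\<close>

lemma coord_chart_inv: "q \<in> snd c ` fst c \<Longrightarrow> snd c (chart_inv c q) = q"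
  and chart_inv_in: "q \<in> snd c ` fst c \<Longrightarrow> chart_inv c q \<in> fst c"
  unfolding chart_inv_def by (auto intro: f_inv_into_f inv_into_into)

text \<open>A common setting for the manifold, with \<open>I_vec\<close>, and for its frame bundle,
  with \<open>I_frame\<close>. Linearity gives \<open>I 0 = 0\<close>, so that \<open>tv_J\<close>
  respects the value 0 of components in charts away from the point.\<close>

definition linear_atlas :: "('e \<Rightarrow> 'e) \<Rightarrow> ('a, 'e::euclidean_space) chart set \<Rightarrow> bool" where
  "linear_atlas I A \<longleftrightarrow> complex_atlas I A \<and> bounded_linear I"

lemma chart_inv_coord: "linear_atlas I A \<Longrightarrow> c \<in> A \<Longrightarrow> x \<in> fst c \<Longrightarrow> chart_inv c (snd c x) = x"
  unfolding linear_atlas_def complex_atlas_def chart_inv_def by (auto intro: inv_into_f_f)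

lemma coord_inj: "linear_atlas I A \<Longrightarrow> c \<in> A \<Longrightarrow> inj_on (snd c) (fst c)"
  unfolding linear_atlas_def complex_atlas_def by auto

lemma open_overlap: "linear_atlas I A \<Longrightarrow> c \<in> A \<Longrightarrow> c' \<in> A \<Longrightarrow> open (snd c ` (fst c \<inter> fst c'))"
  unfolding linear_atlas_def complex_atlas_def by auto

lemma open_coord_image: "linear_atlas I A \<Longrightarrow> c \<in> A \<Longrightarrow> open (snd c ` fst c)"
  using open_overlap[of I A c c] by simp

definition coord_rep :: "('a \<Rightarrow> 'b) \<Rightarrow> ('a, 'e) chart \<Rightarrow> ('b, 'f) chart \<Rightarrow> 'e \<Rightarrow> 'f" where
  "coord_rep f c c' = snd c' \<circ> f \<circ> chart_inv c"

text \<open>Continuity is built in as openness of the coordinate images of chart preimages. The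
  notion covers isometries, their lifts to frames and the bundle projection, which have different
  model spaces.\<close>

definition atlas_holo ::
  "('e \<Rightarrow> 'e) \<Rightarrow> ('a, 'e::euclidean_space) chart set \<Rightarrow> ('f \<Rightarrow> 'f) \<Rightarrow> ('b, 'f::euclidean_space) chart set \<Rightarrow>
   ('a \<Rightarrow> 'b) \<Rightarrow> bool" where
  "atlas_holo I A I' B f \<longleftrightarrow> linear_atlas I A \<and> linear_atlas I' B \<and> f ` carrier_of A \<subseteq> carrier_of B \<and>
     (\<forall>c\<in>A. \<forall>c'\<in>B. open (snd c ` (fst c \<inter> f -` fst c')) \<and>
        holo_on I I' (snd c ` (fst c \<inter> f -` fst c')) (coord_rep f c c'))"

lemma atlas_holoD:
  assumes "atlas_holo I A I' B f"
  shows "linear_atlas I A" "linear_atlas I' B" "x \<in> carrier_of A \<Longrightarrow> f x \<in> carrier_of B"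
  using assms unfolding atlas_holo_def by auto

lemma atlas_holo_rep:
  assumes "atlas_holo I A I' B f" "c \<in> A" "c' \<in> B"
  shows "open (snd c ` (fst c \<inter> f -` fst c'))"
    and "smooth_on (snd c ` (fst c \<inter> f -` fst c')) (coord_rep f c c')"
    and "q \<in> snd c ` (fst c \<inter> f -` fst c') \<Longrightarrow>
      dd (coord_rep f c c') (I w) q = I' (dd (coord_rep f c c') w q)"
  using assms unfolding atlas_holo_def holo_on_def by blast+

lemma atlas_holo_id: "linear_atlas I A \<Longrightarrow> atlas_holo I A I A id"
  unfolding atlas_holo_def linear_atlas_def complex_atlas_def coord_rep_def by auto

lemma coord_rep_coord:
  "linear_atlas I A \<Longrightarrow> c \<in> A \<Longrightarrow> x \<in> fst c \<Longrightarrow> coord_rep f c c' (snd c x) = snd c' (f x)"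
  by (simp add: coord_rep_def chart_inv_coord)

lemma dd_coord_rep_linear:
  assumes "atlas_holo I A I' B f" "c \<in> A" "c' \<in> B" "x \<in> fst c" "f x \<in> fst c'"
  shows "linear (\<lambda>w. dd (coord_rep f c c') w (snd c x))"
  using dd_linear[OF atlas_holo_rep(2,1)[OF assms(1-3)]] assms(4,5) by auto

text \<open>The chain rule in charts. With \<open>id\<close> for one of the maps it becomes the rule
  for changing the chart in the source or in the target.\<close>

lemma coord_rep_comp:
  assumes f: "atlas_holo I A I' B f" and g: "atlas_holo I' B I'' C g"
    and c: "c \<in> A" "c' \<in> B" "c'' \<in> C" and x: "x \<in> fst c" "f x \<in> fst c'" "g (f x) \<in> fst c''"
  shows "dd (coord_rep g c' c'') (dd (coord_rep f c c') w (snd c x)) (snd c' (f x)) =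
    dd (coord_rep (g \<circ> f) c c'') w (snd c x)"
proof -
  note A = atlas_holoD(1)[OF f] and B = atlas_holoD(1)[OF g]
  let ?S = "snd c ` (fst c \<inter> f -` fst c')" and ?T = "snd c' ` (fst c' \<inter> g -` fst c'')"
  note fr = atlas_holo_rep[OF f c(1,2)] and gr = atlas_holo_rep[OF g c(2,3)]
  have xS: "snd c x \<in> ?S" and xT: "snd c' (f x) \<in> ?T" using x by auto
  have fd: "(coord_rep f c c' has_derivative (\<lambda>w. dd (coord_rep f c c') w (snd c x))) (at (snd c x))"
    by (rule smooth_on_has_derivative[OF fr(2,1) xS])
  have gd: "(coord_rep g c' c'' has_derivative (\<lambda>w. dd (coord_rep g c' c'') w (snd c' (f x)))) 
      (at (coord_rep f c c' (snd c x)))"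
    using smooth_on_has_derivative[OF gr(2,1) xT] coord_rep_coord[OF A c(1) x(1)] by metis
  have eq: "coord_rep g c' c'' (coord_rep f c c' q) = coord_rep (g \<circ> f) c c'' q" if "q \<in> ?S" for q
    using that A B c by (auto simp: coord_rep_def chart_inv_coord)
  have "(coord_rep (g \<circ> f) c c'' has_derivative
      (\<lambda>w. dd (coord_rep g c' c'') (dd (coord_rep f c c') w (snd c x)) (snd c' (f x)))) (at (snd c x))"
    by (rule has_derivative_transform_within_open[OF has_derivative_compose[OF fd gd] fr(1) xS eq])
  from dd_eqI[OF this] show ?thesis by simp
qed

lemma carrierI: "c \<in> A \<Longrightarrow> x \<in> fst c \<Longrightarrow> x \<in> carrier_of A"
  unfolding carrier_of_def by auto

lemma coord_rep_cong:
  assumes f: "atlas_holo I A I' B f" and c: "c \<in> A" "c' \<in> B" and x: "x \<in> fst c" "f x \<in> fst c'"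
    and eq: "\<And>y. y \<in> carrier_of A \<Longrightarrow> f y = g y"
  shows "dd (coord_rep f c c') w (snd c x) = dd (coord_rep g c c') w (snd c x)"
proof (rule dd_cong_open[OF atlas_holo_rep(1)[OF f c]])
  note A = atlas_holoD(1)[OF f]
  show "snd c x \<in> snd c ` (fst c \<inter> f -` fst c')" using x by auto
  then show "coord_rep f c c' differentiable at (snd c x)"
    by (rule smooth_on_imp_differentiable[OF atlas_holo_rep(2,1)[OF f c]])
  fix q assume "q \<in> snd c ` (fst c \<inter> f -` fst c')"
  then have "chart_inv c q \<in> fst c" by (auto intro: chart_inv_in)
  then show "coord_rep f c c' q = coord_rep g c c' q"
    using eq[OF carrierI[OF c(1)]] by (simp add: coord_rep_def)
qed

section \<open>Tangent spaces in a chart\<close>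

lemma dd_coord_rep_id:
  assumes "linear_atlas I A" "c \<in> A" "x \<in> fst c"
  shows "dd (coord_rep id c c) w (snd c x) = w"
proof -
  have "((\<lambda>q. q) has_derivative (\<lambda>w. w)) (at (snd c x))" by (rule has_derivative_ident)
  then have "(coord_rep id c c has_derivative (\<lambda>w. w)) (at (snd c x))"
    by (rule has_derivative_transform_within_open[OF _ open_coord_image[OF assms(1,2)]])
      (use assms in \<open>auto simp: coord_rep_def coord_chart_inv\<close>)
  then show ?thesis by (rule dd_eqI)
qed

text \<open>Seeing a coordinate change as the representation of \<open>id\<close> makes the results
  on holomorphic maps available for components of tangent vectors.\<close>

lemma mk_tvec_eq:
  "mk_tvec A c x w = (x, \<lambda>c'. if c' \<in> A \<and> x \<in> fst c' then dd (coord_rep id c c') w (snd c x) else 0)"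
  by (simp add: mk_tvec_def coord_rep_def cong: if_cong)

lemma fst_mk_tvec [simp]: "fst (mk_tvec A c x w) = x"
  by (simp add: mk_tvec_def)

lemma snd_mk_tvec: "linear_atlas I A \<Longrightarrow> c \<in> A \<Longrightarrow> x \<in> fst c \<Longrightarrow> snd (mk_tvec A c x w) c = w"
  by (simp add: mk_tvec_eq dd_coord_rep_id)

lemma snd_mk_tvec_other:
  "c' \<in> A \<Longrightarrow> x \<in> fst c' \<Longrightarrow> snd (mk_tvec A c x w) c' = dd (coord_rep id c c') w (snd c x)"
  by (simp add: mk_tvec_eq)

lemma mk_tvec_change:
  assumes A: "linear_atlas I A" and c: "c \<in> A" "c' \<in> A" "x \<in> fst c" "x \<in> fst c'"
  shows "mk_tvec A c' x (dd (coord_rep id c c') w (snd c x)) = mk_tvec A c x w"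
  using coord_rep_comp[OF atlas_holo_id[OF A] atlas_holo_id[OF A], of c c' _ x] c
  by (auto simp: mk_tvec_eq)

lemma tspace_eq_range:
  assumes A: "linear_atlas I A" and c: "c \<in> A" "x \<in> fst c"
  shows "tspace A x = range (mk_tvec A c x)"
proof -
  have "mk_tvec A c' x w \<in> range (mk_tvec A c x)" if "c' \<in> A" "x \<in> fst c'" for c' w
    using mk_tvec_change[OF A that(1) c(1) that(2) c(2)] by (metis rangeI)
  then show ?thesis unfolding tspace_def using c by blast
qed

lemma mk_tvec_in: "c \<in> A \<Longrightarrow> x \<in> fst c \<Longrightarrow> mk_tvec A c x w \<in> tspace A x"
  unfolding tspace_def by blast

lemma mk_tvec_snd:
  assumes A: "linear_atlas I A" and c: "c \<in> A" "x \<in> fst c" and v: "v \<in> tspace A x"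
  shows "mk_tvec A c x (snd v c) = v"
  using v snd_mk_tvec[OF A c] unfolding tspace_eq_range[OF A c] by auto

lemma fst_tspace: "v \<in> tspace A x \<Longrightarrow> fst v = x"
  unfolding tspace_def by auto

lemma tv_add_mk_tvec:
  assumes A: "linear_atlas I A" and c: "c \<in> A" "x \<in> fst c"
  shows "tv_add (mk_tvec A c x v) (mk_tvec A c x w) = mk_tvec A c x (v + w)"
  using linear_add[OF dd_coord_rep_linear[OF atlas_holo_id[OF A] c(1) _ c(2)]] c
  by (auto simp: tv_add_def mk_tvec_eq)

lemma tv_scale_mk_tvec:
  assumes A: "linear_atlas I A" and c: "c \<in> A" "x \<in> fst c"
  shows "tv_scale r (mk_tvec A c x v) = mk_tvec A c x (r *\<^sub>R v)"
  using linear_scale[OF dd_coord_rep_linear[OF atlas_holo_id[OF A] c(1) _ c(2)]] c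
  by (auto simp: tv_scale_def mk_tvec_eq)

lemma tv_zero_mk_tvec:
  assumes A: "linear_atlas I A" and c: "c \<in> A" "x \<in> fst c"
  shows "mk_tvec A c x 0 = tv_zero x"
  using linear_0[OF dd_coord_rep_linear[OF atlas_holo_id[OF A] c(1) _ c(2)]] c
  by (auto simp: tv_zero_def mk_tvec_eq)

lemma tv_J_mk_tvec:
  assumes A: "linear_atlas I A" and c: "c \<in> A" "x \<in> fst c"
  shows "tv_J I (mk_tvec A c x v) = mk_tvec A c x (I v)"
proof -
  have "I 0 = 0" using A by (simp add: linear_atlas_def bounded_linear.linear linear_0)
  then show ?thesis
    using atlas_holo_rep(3)[OF atlas_holo_id[OF A] c(1)] c by (auto simp: tv_J_def mk_tvec_eq)
qed

lemma mk_tvec_eq_iff: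
  assumes A: "linear_atlas I A" and c: "c \<in> A" "x \<in> fst c"
  shows "mk_tvec A c x v = mk_tvec A c x w \<longleftrightarrow> v = w"
  using snd_mk_tvec[OF A c] by metis

lemma inj_mk_tvec:
  assumes A: "linear_atlas I A" and c: "c \<in> A" "x \<in> fst c"
  shows "inj_on (mk_tvec A c x) S"
  by (rule inj_onI) (simp add: mk_tvec_eq_iff[OF assms])

lemma mk_tvec_image_iff:
  assumes A: "linear_atlas I A" and c: "c \<in> A" "x \<in> fst c"
  shows "mk_tvec A c x v \<in> mk_tvec A c x ` V \<longleftrightarrow> v \<in> V"
  using mk_tvec_eq_iff[OF assms] by auto

lemma tsubspace_mk_tvec:
  assumes A: "linear_atlas I A" and c: "c \<in> A" "x \<in> fst c"
  shows "tsubspace A x (mk_tvec A c x ` V) \<longleftrightarrow> subspace V"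
  unfolding tsubspace_def subspace_def
  by (simp add: tv_add_mk_tvec[OF assms] tv_scale_mk_tvec[OF assms] tv_zero_mk_tvec[OF assms, symmetric]
      mk_tvec_image_iff[OF assms] image_subset_iff mk_tvec_in[OF c])

lemma tsubspace_imp_image:
  assumes A: "linear_atlas I A" and c: "c \<in> A" "x \<in> fst c" and W: "tsubspace A x W"
  obtains V where "W = mk_tvec A c x ` V" "subspace V"
proof -
  have "W \<subseteq> range (mk_tvec A c x)"
    using W tspace_eq_range[OF A c] unfolding tsubspace_def by auto
  then obtain V where "W = mk_tvec A c x ` V" by (meson subset_imageE)
  then show ?thesis using that W tsubspace_mk_tvec[OF A c] by blast
qed

lemma tspan_mk_tvec:
  assumes A: "linear_atlas I A" and c: "c \<in> A" "x \<in> fst c"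
  shows "tspan A x (mk_tvec A c x ` B) = mk_tvec A c x ` span B"
proof
  have "tsubspace A x (mk_tvec A c x ` span B)"
    by (simp add: tsubspace_mk_tvec[OF assms])
  then show "tspan A x (mk_tvec A c x ` B) \<subseteq> mk_tvec A c x ` span B"
    unfolding tspan_def using span_superset[of B] by (intro Inter_lower) auto
next
  have "mk_tvec A c x ` span B \<subseteq> W" if W: "tsubspace A x W" "mk_tvec A c x ` B \<subseteq> W" for W
  proof -
    obtain V where V: "W = mk_tvec A c x ` V" "subspace V"
      using tsubspace_imp_image[OF A c W(1)] .
    then have "B \<subseteq> V" using W(2) by (simp add: inj_on_image_subset_iff[OF inj_mk_tvec[OF assms, of UNIV]])
    then show ?thesis using V span_minimal by blast
  qed
  then show "mk_tvec A c x ` span B \<subseteq> tspan A x (mk_tvec A c x ` B)"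
    unfolding tspan_def by blast
qed

lemma chart_at:
  assumes "x \<in> carrier_of A"
  shows "chart_at A x \<in> A" "x \<in> fst (chart_at A x)"
proof -
  have "\<exists>c. c \<in> A \<and> x \<in> fst c" using assms unfolding carrier_of_def by auto
  from someI_ex[OF this] show "chart_at A x \<in> A" "x \<in> fst (chart_at A x)"
    unfolding chart_at_def by auto
qed

text \<open>\<open>tdim\<close> reads components in the chart picked by \<open>chart_at\<close>,
  which may differ from \<open>c\<close>. The Jacobian between the two is injective, having the
  reverse Jacobian as left inverse, and so preserves dimensions.\<close>

lemma tdim_mk_tvec:
  assumes A: "linear_atlas I A" and c: "c \<in> A" "x \<in> fst c"
  shows "tdim A x (mk_tvec A c x ` V) = dim V"
proof -
  let ?c = "chart_at A x"
  note c' = chart_at[OF carrierI[OF c]]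
  define L where "L w = dd (coord_rep id c ?c) w (snd c x)" for w
  have lin: "linear L"
    unfolding L_def using dd_coord_rep_linear[OF atlas_holo_id[OF A] c(1) c'(1) c(2)] c'(2) by simp
  have "dd (coord_rep id ?c c) (L w) (snd ?c x) = w" for w
    using coord_rep_comp[OF atlas_holo_id[OF A] atlas_holo_id[OF A], of c ?c c x w] c c'
      dd_coord_rep_id[OF A c, of w] unfolding L_def by simp
  then have "inj L" by (metis injI)
  moreover have "(\<lambda>v. snd v ?c) ` mk_tvec A c x ` V = L ` V"
    unfolding image_image L_def using c' by (simp add: snd_mk_tvec_other)
  ultimately show ?thesis
    unfolding tdim_def using dim_image_eq[OF lin] by (metis inj_on_subset subset_UNIV)
qed

section \<open>The topology of an atlas\<close>

lemma openin_atlas_topology: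
  fixes A :: "('a, 'e::euclidean_space) chart set"
  assumes A: "linear_atlas I A"
  shows "openin (atlas_topology A) W \<longleftrightarrow> W \<subseteq> carrier_of A \<and> (\<forall>c\<in>A. open (snd c ` (W \<inter> fst c)))"
proof -
  have "open (snd c ` (S \<inter> T \<inter> fst c))"
    if "c \<in> A" "open (snd c ` (S \<inter> fst c))" "open (snd c ` (T \<inter> fst c))" for c S T
  proof -
    have "snd c ` (S \<inter> T \<inter> fst c) = snd c ` (S \<inter> fst c) \<inter> snd c ` (T \<inter> fst c)"
      using coord_inj[OF A that(1)] by (auto dest: inj_onD)
    then show ?thesis using that by (metis open_Int)
  qed
  moreover have "open (snd c ` (\<Union>K \<inter> fst c))" if "\<forall>W\<in>K. open (snd c ` (W \<inter> fst c))"
    for c :: "('a, 'e) chart" and K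
  proof -
    have "snd c ` (\<Union>K \<inter> fst c) = (\<Union>W\<in>K. snd c ` (W \<inter> fst c))" by auto
    then show ?thesis using that by (simp add: open_UN)
  qed
  ultimately have "istopology (\<lambda>W. W \<subseteq> carrier_of A \<and> (\<forall>c\<in>A. open (snd c ` (W \<inter> fst c))))"
    unfolding istopology_def by (simp add: Sup_le_iff le_infI1)
  then show ?thesis unfolding atlas_topology_def by simp
qed

lemma openin_chart_domain: "linear_atlas I A \<Longrightarrow> c \<in> A \<Longrightarrow> openin (atlas_topology A) (fst c)"
  by (auto simp: openin_atlas_topology carrier_of_def Int_commute[of "fst c"] intro: open_overlap)

lemma topspace_atlas_topology:
  assumes A: "linear_atlas I A"
  shows "topspace (atlas_topology A) = carrier_of A"
proof
  show "topspace (atlas_topology A) \<subseteq> carrier_of A"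
    unfolding topspace_def using openin_atlas_topology[OF A] by auto
  have "fst c \<subseteq> topspace (atlas_topology A)" if "c \<in> A" for c
    using openin_chart_domain[OF A that] by (rule openin_subset)
  then show "carrier_of A \<subseteq> topspace (atlas_topology A)"
    unfolding carrier_of_def by auto
qed

section \<open>Pushforward of tangent vectors\<close>

lemma pushforward_mk_tvec:
  assumes f: "atlas_holo I A I' B f" and c: "c \<in> A" "x \<in> fst c" and c': "c' \<in> B" "f x \<in> fst c'"
  shows "pushforward A B f (mk_tvec A c x w) = mk_tvec B c' (f x) (dd (coord_rep f c c') w (snd c x))"
proof -
  note A = atlas_holoD(1)[OF f] and B = atlas_holoD(2)[OF f]
  let ?c = "chart_at A x"
  note c0 = chart_at[OF carrierI[OF c]]
  \<comment> \<open>\<open>pushforward\<close> passes through the chart picked by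
    \<open>chart_at\<close>. Changing the chart once in the source and once in the target makes the
    formula independent of that choice.\<close>
  have "dd (snd d \<circ> f \<circ> chart_inv ?c) (snd (mk_tvec A c x w) ?c) (snd ?c x) =
      dd (coord_rep id c' d) (dd (coord_rep f c c') w (snd c x)) (snd c' (f x))"
    if d: "d \<in> B" "f x \<in> fst d" for d
    using coord_rep_comp[OF atlas_holo_id[OF A] f c(1) c0(1) d(1) c(2), of w]
      coord_rep_comp[OF f atlas_holo_id[OF B] c(1) c'(1) d(1) c(2), of w] c0 c' d
    by (simp add: snd_mk_tvec_other coord_rep_def)
  then show ?thesis
    unfolding pushforward_def Let_def fst_mk_tvec by (auto simp: mk_tvec_eq[of B])
qed

lemma tspaceE:
  assumes "linear_atlas I A" "c \<in> A" "x \<in> fst c" "v \<in> tspace A x"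
  obtains w where "v = mk_tvec A c x w"
  using assms(4) that unfolding tspace_eq_range[OF assms(1-3)] by blast

lemma pushforward_in_tspace:
  assumes f: "atlas_holo I A I' B f" and x: "x \<in> carrier_of A" and v: "v \<in> tspace A x"
  shows "pushforward A B f v \<in> tspace B (f x)"
proof -
  note c = chart_at[OF x] and d = chart_at[OF atlas_holoD(3)[OF f x]]
  obtain w where "v = mk_tvec A (chart_at A x) x w" using tspaceE[OF atlas_holoD(1)[OF f] c v] .
  then show ?thesis using pushforward_mk_tvec[OF f c d] mk_tvec_in[OF d] by simp
qed

lemma pushforward_comp:
  assumes f: "atlas_holo I A I' B f" and g: "atlas_holo I' B I'' C g"
    and x: "x \<in> carrier_of A" and v: "v \<in> tspace A x"
  shows "pushforward B C g (pushforward A B f v) = pushforward A C (g \<circ> f) v"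
proof -
  note A = atlas_holoD(1)[OF f] and B = atlas_holoD(1)[OF g] and C = atlas_holoD(2)[OF g]
  note fx = atlas_holoD(3)[OF f x]
  note c = chart_at[OF x] and d = chart_at[OF fx] and e = chart_at[OF atlas_holoD(3)[OF g fx]]
  obtain w where w: "v = mk_tvec A (chart_at A x) x w" using tspaceE[OF A c v] .
  have "dd (coord_rep id (chart_at C (g (f x))) c'') (dd (coord_rep g (chart_at B (f x)) (chart_at C (g (f x))))
         (dd (coord_rep f (chart_at A x) (chart_at B (f x))) w (snd (chart_at A x) x)) (snd (chart_at B (f x)) (f x)))
         (snd (chart_at C (g (f x))) (g (f x))) =
      dd (coord_rep (g \<circ> f) (chart_at A x) c'') w (snd (chart_at A x) x)"
    if c'': "c'' \<in> C" "g (f x) \<in> fst c''" for c''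
    using coord_rep_comp[OF g atlas_holo_id[OF C] d(1) e(1) c''(1) d(2) e(2)]
      coord_rep_comp[OF f g c(1) d(1) c''(1) c(2) d(2)] c'' by simp
  then have "mk_tvec C (chart_at C (g (f x))) (g (f x)) (dd (coord_rep g (chart_at B (f x)) (chart_at C (g (f x))))
         (dd (coord_rep f (chart_at A x) (chart_at B (f x))) w (snd (chart_at A x) x)) (snd (chart_at B (f x)) (f x)))
     = pushforward A C (g \<circ> f) v"
    unfolding w pushforward_def Let_def fst_mk_tvec snd_mk_tvec[OF A c]
    by (simp add: mk_tvec_eq[of C] coord_rep_def comp_assoc cong: if_cong)
  then show ?thesis
    unfolding w pushforward_mk_tvec[OF f c d] pushforward_mk_tvec[OF g d e] .
qed

lemma pushforward_id:
  assumes A: "linear_atlas I A" and x: "x \<in> carrier_of A" and v: "v \<in> tspace A x"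
  shows "pushforward A A id v = v"
proof -
  note c = chart_at[OF x]
  obtain w where w: "v = mk_tvec A (chart_at A x) x w" using tspaceE[OF A c v] .
  show ?thesis
    using pushforward_mk_tvec[OF atlas_holo_id[OF A] c, of "chart_at A x" w] c dd_coord_rep_id[OF A c, of w] w by simp
qed

text \<open>Maps are total functions on the type of points, and a map composed with its inverse is
  the identity on the carrier only; this allows it to be replaced by \<open>id\<close> all the
  same.\<close>

lemma pushforward_cong:
  assumes f: "atlas_holo I A I' B f" and x: "x \<in> carrier_of A" and v: "v \<in> tspace A x"
    and eq: "\<And>y. y \<in> carrier_of A \<Longrightarrow> f y = g y"
  shows "pushforward A B f v = pushforward A B g v"
proof -
  note A = atlas_holoD(1)[OF f] and c = chart_at[OF x]
  obtain w where w: "v = mk_tvec A (chart_at A x) x w" using tspaceE[OF A c v] .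
  show ?thesis
    using coord_rep_cong[OF f c(1) _ c(2) _ eq, of _ w]
    unfolding w pushforward_def Let_def fst_mk_tvec snd_mk_tvec[OF A c] by (simp add: coord_rep_def eq[OF x] cong: if_cong)
qed

lemma pushforward_tv_add:
  assumes f: "atlas_holo I A I' B f" and x: "x \<in> carrier_of A" and v: "v \<in> tspace A x" "w \<in> tspace A x"
  shows "pushforward A B f (tv_add v w) = tv_add (pushforward A B f v) (pushforward A B f w)"
proof -
  note A = atlas_holoD(1)[OF f] and B = atlas_holoD(2)[OF f]
  note c = chart_at[OF x] and d = chart_at[OF atlas_holoD(3)[OF f x]]
  obtain v' w' where "v = mk_tvec A (chart_at A x) x v'" "w = mk_tvec A (chart_at A x) x w'"
    using tspaceE[OF A c] v by metis
  then show ?thesis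
    using linear_add[OF dd_coord_rep_linear[OF f c(1) d(1) c(2) d(2)]]
    by (simp add: tv_add_mk_tvec[OF A c] tv_add_mk_tvec[OF B d] pushforward_mk_tvec[OF f c d])
qed

lemma pushforward_tv_scale:
  assumes f: "atlas_holo I A I' B f" and x: "x \<in> carrier_of A" and v: "v \<in> tspace A x"
  shows "pushforward A B f (tv_scale r v) = tv_scale r (pushforward A B f v)"
proof -
  note A = atlas_holoD(1)[OF f] and B = atlas_holoD(2)[OF f]
  note c = chart_at[OF x] and d = chart_at[OF atlas_holoD(3)[OF f x]]
  obtain v' where "v = mk_tvec A (chart_at A x) x v'" using tspaceE[OF A c] v by metis
  then show ?thesis
    using linear_scale[OF dd_coord_rep_linear[OF f c(1) d(1) c(2) d(2)]]
    by (simp add: tv_scale_mk_tvec[OF A c] tv_scale_mk_tvec[OF B d] pushforward_mk_tvec[OF f c d])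
qed

lemma pushforward_tv_J:
  assumes f: "atlas_holo I A I' B f" and x: "x \<in> carrier_of A" and v: "v \<in> tspace A x"
  shows "pushforward A B f (tv_J I v) = tv_J I' (pushforward A B f v)"
proof -
  note A = atlas_holoD(1)[OF f] and B = atlas_holoD(2)[OF f]
  note c = chart_at[OF x] and d = chart_at[OF atlas_holoD(3)[OF f x]]
  obtain v' where "v = mk_tvec A (chart_at A x) x v'" using tspaceE[OF A c] v by metis
  then show ?thesis
    using atlas_holo_rep(3)[OF f c(1) d(1)] c d
    by (simp add: tv_J_mk_tvec[OF A c] tv_J_mk_tvec[OF B d] pushforward_mk_tvec[OF f c d])
qed

section \<open>Velocities of curves in a subset\<close>

lemma curve_image:
  assumes f: "atlas_holo I A I' B f" and c: "c \<in> A" "x \<in> fst c" and c': "c' \<in> B" "f x \<in> fst c'"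
    and g: "\<gamma> ` {-e<..<e} \<subseteq> S \<inter> fst c" "\<gamma> 0 = x" "smooth_on {-e<..<e::real} (snd c \<circ> \<gamma>)"
      "((snd c \<circ> \<gamma>) has_vector_derivative w) (at 0)" and e: "e > 0" and ST: "f ` S \<subseteq> T"
  shows "\<exists>\<gamma>. \<exists>e>0. \<gamma> ` {-e<..<e} \<subseteq> T \<inter> fst c' \<and> \<gamma> 0 = f x \<and> smooth_on {-e<..<e::real} (snd c' \<circ> \<gamma>) \<and>
    ((snd c' \<circ> \<gamma>) has_vector_derivative dd (coord_rep f c c') w (snd c x)) (at 0)"
proof -
  note A = atlas_holoD(1)[OF f] and fr = atlas_holo_rep[OF f c(1) c'(1)]
  let ?S = "snd c ` (fst c \<inter> f -` fst c')" and ?p = "snd c \<circ> \<gamma>"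
  \<comment> \<open>The curve may leave the part of the chart that \<open>f\<close> maps into
    \<open>c'\<close>; by continuity it stays there on a shorter interval around 0.\<close>
  have "continuous_on {-e<..<e} ?p" by (rule smooth_on_imp_continuous_on[OF g(3)])
  then have "open (?p -` ?S \<inter> {-e<..<e})"
    using fr(1) by (subst (asm) continuous_on_open_vimage) auto
  moreover have "0 \<in> ?p -` ?S \<inter> {-e<..<e}" using c c' g(2) e by auto
  ultimately obtain e' where e': "e' > 0" "ball 0 e' \<subseteq> ?p -` ?S \<inter> {-e<..<e}"
    by (meson openE)
  have sub: "?p t \<in> ?S" "t \<in> {-e<..<e}" if "t \<in> {-e'<..<e'}" for t
    using e'(2) that by (auto simp: subset_iff dist_real_def abs_less_iff)
  then have ball: "{-e'<..<e'} \<subseteq> {-e<..<e}" by blast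
  have pS: "f (\<gamma> t) \<in> fst c'" "coord_rep f c c' (?p t) = (snd c' \<circ> (f \<circ> \<gamma>)) t" if t: "t \<in> {-e'<..<e'}" for t
  proof -
    have "\<gamma> t \<in> fst c" using sub(2)[OF t] g(1) by auto
    then show "coord_rep f c c' (?p t) = (snd c' \<circ> (f \<circ> \<gamma>)) t"
      using coord_rep_coord[OF A c(1)] by simp
    show "f (\<gamma> t) \<in> fst c'"
      using sub(1)[OF t] inj_onD[OF coord_inj[OF A c(1)] _ \<open>\<gamma> t \<in> fst c\<close>] by force
  qed
  have "smooth_on {-e'<..<e'} (\<lambda>t. coord_rep f c c' (?p t))"
    by (rule smooth_on_compose[OF _ fr(1,2) smooth_on_subset[OF g(3) ball]]) (use sub in auto)
  then have s: "smooth_on {-e'<..<e'} (snd c' \<circ> (f \<circ> \<gamma>))"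
    using smooth_on_cong[of "{-e'<..<e'}" "\<lambda>t. coord_rep f c c' (?p t)" "snd c' \<circ> (f \<circ> \<gamma>)"] pS(2) by simp
  have p0: "?p 0 = snd c x" using g(2) by simp
  have "((\<lambda>t. coord_rep f c c' (?p t)) has_vector_derivative dd (coord_rep f c c') w (snd c x)) (at 0)"
    using has_vector_derivative_dd[OF fr(2,1) sub(1) g(4)] e'(1) unfolding p0 by simp
  then have d: "((snd c' \<circ> (f \<circ> \<gamma>)) has_vector_derivative dd (coord_rep f c c') w (snd c x)) (at 0)"
    by (rule has_vector_derivative_transform_within_open[where S = "{-e'<..<e'}"]) (use e'(1) pS(2) in auto)
  have "(f \<circ> \<gamma>) ` {-e'<..<e'} \<subseteq> T \<inter> fst c'" using subset_trans[OF image_mono[OF ball] g(1)] ST pS(1) by fastforce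
  then show ?thesis using s d e'(1) g(2) by (intro exI[of _ "f \<circ> \<gamma>"] exI[of _ e']) auto
qed

text \<open>In the definition the chart carrying the curve depends on the vector.
  \<open>curve_image\<close> for \<open>id\<close> moves the curve, after shortening, into any
  prescribed chart around the point.\<close>

lemma sub_tspace_chart:
  assumes A: "linear_atlas I A" and c: "c \<in> A" "x \<in> fst c"
  shows "mk_tvec A c x w \<in> sub_tspace A S x \<longleftrightarrow> (\<exists>\<gamma>. \<exists>e>0.
     \<gamma> ` {-e<..<e} \<subseteq> S \<inter> fst c \<and> \<gamma> 0 = x \<and> smooth_on {-e<..<e::real} (snd c \<circ> \<gamma>) \<and>
     ((snd c \<circ> \<gamma>) has_vector_derivative w) (at 0))" (is "_ \<longleftrightarrow> ?R")
proof
  assume "mk_tvec A c x w \<in> sub_tspace A S x"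
  then obtain d \<gamma> e where d: "d \<in> A" "e > 0" "\<gamma> ` {-e<..<e} \<subseteq> S \<inter> fst d" "\<gamma> 0 = x"
      "smooth_on {-e<..<e::real} (snd d \<circ> \<gamma>)" "((snd d \<circ> \<gamma>) has_vector_derivative snd (mk_tvec A c x w) d) (at 0)"
    unfolding sub_tspace_def by auto
  then have xd: "x \<in> fst d" by (auto simp: image_subset_iff)
  have "dd (coord_rep id d c) (snd (mk_tvec A c x w) d) (snd d x) = w"
    using coord_rep_comp[OF atlas_holo_id[OF A] atlas_holo_id[OF A] c(1) d(1) c(1) c(2), of w] dd_coord_rep_id[OF A c, of w] c xd
    by (simp add: snd_mk_tvec_other[OF d(1) xd])
  then show ?R
    using curve_image[OF atlas_holo_id[OF A] d(1) xd c(1) _ d(3-6,2), of S] c(2) by simp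
next
  assume ?R then show "mk_tvec A c x w \<in> sub_tspace A S x"
    unfolding sub_tspace_def using mk_tvec_in[OF c] c(1) snd_mk_tvec[OF A c] by (intro CollectI conjI bexI[of _ c]) auto
qed

lemma sub_tspace_subset: "sub_tspace A S x \<subseteq> tspace A x"
  unfolding sub_tspace_def by auto

lemma pushforward_sub_tspace:
  assumes f: "atlas_holo I A I' B f" and x: "x \<in> carrier_of A" and v: "v \<in> sub_tspace A S x" and ST: "f ` S \<subseteq> T"
  shows "pushforward A B f v \<in> sub_tspace B T (f x)"
proof -
  note A = atlas_holoD(1)[OF f] and B = atlas_holoD(2)[OF f]
  note c = chart_at[OF x] and d = chart_at[OF atlas_holoD(3)[OF f x]]
  obtain w where w: "v = mk_tvec A (chart_at A x) x w"
    using tspaceE[OF A c] v sub_tspace_subset[of A S x] by blast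
  obtain \<gamma> e where g: "e > 0" "\<gamma> ` {-e<..<e} \<subseteq> S \<inter> fst (chart_at A x)" "\<gamma> 0 = x"
    "smooth_on {-e<..<e::real} (snd (chart_at A x) \<circ> \<gamma>)" "((snd (chart_at A x) \<circ> \<gamma>) has_vector_derivative w) (at 0)"
    using v unfolding w sub_tspace_chart[OF A c] by blast
  show ?thesis
    unfolding w pushforward_mk_tvec[OF f c d] sub_tspace_chart[OF B d]
    by (rule curve_image[OF f c d g(2-5,1) ST])
qed

text \<open>Chart domains are open in the atlas topology, so continuity yields the open chart
  preimages that \<open>atlas_holo\<close> asks for.\<close>

lemma holomorphic_map_atlas_holo:
  assumes A: "linear_atlas I_vec A" and B: "linear_atlas I_vec B" and f: "holomorphic_map A B f"
  shows "atlas_holo I_vec A I_vec B f"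
proof -
  have cont: "continuous_map (atlas_topology A) (atlas_topology B) f"
    using f unfolding holomorphic_map_def by blast
  have "open (snd c ` (fst c \<inter> f -` fst c'))" if c: "c \<in> A" "c' \<in> B" for c c'
  proof -
    have "openin (atlas_topology A) {x \<in> carrier_of A. f x \<in> fst c'}"
      using openin_continuous_map_preimage[OF cont openin_chart_domain[OF B c(2)]]
      unfolding topspace_atlas_topology[OF A] .
    then have "open (snd c ` ({x \<in> carrier_of A. f x \<in> fst c'} \<inter> fst c))"
      unfolding openin_atlas_topology[OF A] using c(1) by blast
    moreover have "{x \<in> carrier_of A. f x \<in> fst c'} \<inter> fst c = fst c \<inter> f -` fst c'"
      using c(1) by (auto simp: carrier_of_def)
    ultimately show ?thesis by simp
  qed
  moreover have "f ` carrier_of A \<subseteq> carrier_of B"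
    using continuous_map_image_subset_topspace[OF cont] topspace_atlas_topology A B by metis
  ultimately show ?thesis
    using A B f unfolding atlas_holo_def holomorphic_map_def coord_rep_def by simp
qed

section \<open>Hermitian forms and orthonormalisation of curves of frames\<close>

text \<open>Linear in \<open>w\<close> and antilinear in \<open>z\<close>: the row index belongs to
  the conjugated argument, so the form pairs \<open>M *v w\<close> with the conjugate of
  \<open>z\<close>. In this shape the horizontality conditions become linear systems with matrix
  \<open>M\<close>.\<close>

definition hform :: "complex^'n^'n \<Rightarrow> complex^'n \<Rightarrow> complex^'n \<Rightarrow> complex" where
  "hform M w z = (\<Sum>i\<in>UNIV. \<Sum>j\<in>UNIV. M $ i $ j * w $ j * cnj (z $ i))"

lemma hform_add_left: "hform M (w + w') z = hform M w z + hform M w' z"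
  by (simp add: hform_def sum.distrib algebra_simps)

lemma hform_diff_left: "hform M (w - w') z = hform M w z - hform M w' z"
  by (simp add: hform_def sum_subtractf algebra_simps)

lemma hform_scale_left: "hform M (c *s w) z = c * hform M w z"
  and hform_scale_right: "hform M w (c *s z) = cnj c * hform M w z"
  by (simp_all add: hform_def sum_distrib_left algebra_simps)

lemma hform_scaleR_left: "hform M (r *\<^sub>R w) z = r *\<^sub>R hform M w z"
  and hform_scaleR_right: "hform M w (r *\<^sub>R z) = r *\<^sub>R hform M w z"
  and hform_scaleR_mat: "hform (r *\<^sub>R M) w z = r *\<^sub>R hform M w z"
  by (simp_all add: hform_def scaleR_sum_right)

lemma hform_zero_left [simp]: "hform M 0 z = 0"
  and hform_zero_right [simp]: "hform M w 0 = 0"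
  by (simp_all add: hform_def)

lemma hform_sum_left: "hform M (\<Sum>a\<in>S. f a) z = (\<Sum>a\<in>S. hform M (f a) z)"
  by (induction S rule: infinite_finite_induct) (auto simp: hform_add_left)

lemma hform_matrix_vector: "hform M w z = (\<Sum>i\<in>UNIV. (M *v w) $ i * cnj (z $ i))"
  by (simp add: hform_def matrix_vector_mult_def sum_distrib_right)

definition hermitian_matrix :: "complex^'n^'n \<Rightarrow> bool" where
  "hermitian_matrix M \<longleftrightarrow> (\<forall>i j. cnj (M $ i $ j) = M $ j $ i)"

lemma cnj_hform:
  assumes "hermitian_matrix M"
  shows "cnj (hform M w z) = hform M z w"
proof -
  have "cnj (hform M w z) = (\<Sum>i\<in>UNIV. \<Sum>j\<in>UNIV. M $ j $ i * z $ i * cnj (w $ j))"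
    using assms by (simp add: hform_def hermitian_matrix_def mult.commute mult.left_commute)
  also have "\<dots> = hform M z w" unfolding hform_def by (rule sum.swap)
  finally show ?thesis .
qed

lemma bounded_bilinear_complex_vec_scale:
  "bounded_bilinear ((*s) :: complex \<Rightarrow> complex^'n \<Rightarrow> complex^'n)"
  unfolding bilinear_conv_bounded_bilinear[symmetric] bilinear_def
  by (auto intro!: linearI simp: vec_eq_iff algebra_simps)

lemma has_derivative_hform:
  assumes M: "(M has_derivative M') (at t)" and w: "(w has_derivative w') (at t)" and z: "(z has_derivative z') (at t)"
  shows "((\<lambda>t. hform (M t) (w t) (z t)) has_derivative
    (\<lambda>h. hform (M' h) (w t) (z t) + hform (M t) (w' h) (z t) + hform (M t) (w t) (z' h))) (at t)"
proof -
  have M': "((\<lambda>t. M t $ i $ j) has_derivative (\<lambda>h. M' h $ i $ j)) (at t)" for i j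
    by (intro bounded_linear.has_derivative[OF bounded_linear_vec_nth] M)
  have w': "((\<lambda>t. w t $ j) has_derivative (\<lambda>h. w' h $ j)) (at t)" for j
    by (intro bounded_linear.has_derivative[OF bounded_linear_vec_nth] w)
  have z': "((\<lambda>t. cnj (z t $ j)) has_derivative (\<lambda>h. cnj (z' h $ j))) (at t)" for j
    by (intro bounded_linear.has_derivative[OF bounded_linear_cnj] bounded_linear.has_derivative[OF bounded_linear_vec_nth] z)
  have "((\<lambda>t. hform (M t) (w t) (z t)) has_derivative
    (\<lambda>h. \<Sum>i\<in>UNIV. \<Sum>j\<in>UNIV. M t $ i $ j * w t $ j * cnj (z' h $ i) +
      (M t $ i $ j * w' h $ j + M' h $ i $ j * w t $ j) * cnj (z t $ i))) (at t)"
    unfolding hform_def by (intro has_derivative_sum has_derivative_mult M' w' z')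
  moreover have "(\<Sum>i\<in>UNIV. \<Sum>j\<in>UNIV. M t $ i $ j * w t $ j * cnj (z' h $ i) +
      (M t $ i $ j * w' h $ j + M' h $ i $ j * w t $ j) * cnj (z t $ i)) =
      hform (M' h) (w t) (z t) + hform (M t) (w' h) (z t) + hform (M t) (w t) (z' h)" for h
    unfolding hform_def by (simp add: sum.distrib algebra_simps)
  ultimately show ?thesis by simp
qed

lemma has_vector_derivative_hform:
  assumes "(M has_vector_derivative M') (at t)" "(w has_vector_derivative w') (at t)" "(z has_vector_derivative z') (at t)"
  shows "((\<lambda>t. hform (M t) (w t) (z t)) has_vector_derivative
    (hform M' (w t) (z t) + hform (M t) w' (z t) + hform (M t) (w t) z')) (at t)"
  using has_derivative_hform[OF assms[unfolded has_vector_derivative_def]]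
  unfolding has_vector_derivative_def
  by (simp add: hform_scaleR_left hform_scaleR_right hform_scaleR_mat scaleR_add_right)

lemma has_vector_derivative_vec_componentwise:
  fixes D :: "real \<Rightarrow> 'f::euclidean_space ^ 'n"
  assumes "\<And>k. ((\<lambda>t. D t $ k) has_vector_derivative D' $ k) (at t)"
  shows "(D has_vector_derivative D') (at t)"
proof -
  have "((\<lambda>t. \<Sum>k\<in>UNIV. \<chi> i. if i = k then D t $ k else 0) has_vector_derivative
      (\<Sum>k\<in>UNIV. \<chi> i. if i = k then D' $ k else 0)) (at t)"
    by (intro has_vector_derivative_sum bounded_linear.has_vector_derivative[OF bounded_linear_vec_axis] assms)
  moreover have "(\<Sum>k\<in>UNIV. \<chi> i. if i = k then v $ k else 0) = v" for v :: "'f ^ 'n"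
    by (simp add: vec_eq_iff)
  ultimately show ?thesis by simp
qed

lemma smooth_on_hform:
  assumes S: "open S" and M: "smooth_on S M" and w: "smooth_on S w" and z: "smooth_on S z"
  shows "smooth_on S (\<lambda>t. hform (M t) (w t) (z t))"
  unfolding hform_def
  by (intro smooth_on_sum smooth_on_mult smooth_on_vec_nth smooth_on_compose_linear[OF bounded_linear_cnj] assms)

section \<open>Determinants and orthonormal frames\<close>

lemma det_nonzero_iff_ker: "det (M :: complex^'n^'n) \<noteq> 0 \<longleftrightarrow> (\<forall>x. M *v x = 0 \<longrightarrow> x = 0)"
  unfolding invertible_det_nz[symmetric] invertible_left_inverse matrix_left_invertible_ker ..

text \<open>The vectors of a frame are stored as the rows \<open>B $ j\<close>, so the frame, as a
  linear map, is multiplication by the transpose.\<close>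

lemma transpose_mult_eq_sum: "transpose B *v z = (\<Sum>j\<in>UNIV. z $ j *s B $ j)"
  for B :: "complex^'n^'n"
  unfolding vec_eq_iff matrix_vector_mult_def transpose_def by (simp add: mult.commute)

text \<open>Pairing a linear relation among the rows with \<open>B $ k\<close> isolates its
  coefficient at \<open>k\<close>, which must then vanish.\<close>

lemma hform_orthonormal_det:
  assumes "\<And>j k. hform M (B $ j) (B $ k) = (if j = k then 1 else 0)"
  shows "det (B :: complex^'n^'n) \<noteq> 0"
proof -
  have "z = 0" if "transpose B *v z = 0" for z
  proof -
    have "(\<Sum>j\<in>UNIV. z $ j *s B $ j) = 0"
      using that by (simp add: vec_eq_iff matrix_vector_mult_def transpose_def mult.commute)
    then have "(\<Sum>j\<in>UNIV. z $ j * hform M (B $ j) (B $ k)) = 0" for k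
      using hform_sum_left[of M "\<lambda>j. z $ j *s B $ j" UNIV "B $ k"] by (simp add: hform_scale_left)
    then show "z = 0" by (simp add: assms vec_eq_iff if_distrib cong: if_cong)
  qed
  then have "det (transpose B) \<noteq> 0" unfolding det_nonzero_iff_ker by blast
  then show ?thesis by simp
qed

lemma row_nonzero_of_det:
  assumes "det (B :: complex^'n^'n) \<noteq> 0"
  shows "B $ k \<noteq> 0"
proof
  assume "B $ k = 0"
  then have "row k B = 0" by (simp add: row_def vec_eq_iff)
  then show False using det_zero_row(1)[of k B] assms by simp
qed

lemma spanning_of_det:
  assumes "det (B :: complex^'n^'n) \<noteq> 0"
  obtains z where "w = (\<Sum>j\<in>UNIV. z $ j *s B $ j)"
proof -
  have "det (transpose B) \<noteq> 0" using assms by simp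
  then obtain C where "transpose B ** C = mat 1" 
    unfolding invertible_det_nz[symmetric] invertible_def by blast
  then have "transpose B *v (C *v w) = w" by (simp add: matrix_vector_mul_assoc)
  moreover have "transpose B *v z = (\<Sum>j\<in>UNIV. z $ j *s B $ j)" for z
    unfolding vec_eq_iff matrix_vector_mult_def transpose_def by (simp add: mult.commute)
  ultimately have "w = (\<Sum>j\<in>UNIV. (C *v w) $ j *s B $ j)" by metis
  then show ?thesis using that by blast
qed

text \<open>One step of the Gram-Schmidt process.  If the Gram matrix is stationary at \<open>0\<close>, the corrections
  vanish to first order there, so the velocity of the curve of frames does not change.\<close>

lemma gram_schmidt_step:
  fixes M :: "real \<Rightarrow> complex^'n^'n" and C :: "real \<Rightarrow> complex^'n^'n"
  assumes e: "e > 0" and M: "smooth_on {-e<..<e} M" "\<And>t. t \<in> {-e<..<e} \<Longrightarrow> hermitian_matrix (M t)"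
      "(M has_vector_derivative M') (at 0)"
    and C: "smooth_on {-e<..<e} C" "C 0 = B" "(C has_vector_derivative \<beta>) (at 0)"
    and B: "\<And>j k. hform (M 0) (B $ j) (B $ k) = (if j = k then 1 else 0)"
    and stat: "\<And>j k. hform M' (B $ j) (B $ k) + hform (M 0) (\<beta> $ j) (B $ k) + hform (M 0) (B $ j) (\<beta> $ k) = 0"
    and ortho: "\<And>t j k. t \<in> {-e<..<e} \<Longrightarrow> j \<in> S \<Longrightarrow> k \<in> S \<Longrightarrow> hform (M t) (C t $ j) (C t $ k) = (if j = k then 1 else 0)"
    and l: "l \<notin> S"
  shows "\<exists>d D. 0 < d \<and> d \<le> e \<and> smooth_on {-d<..<d} D \<and> D 0 = B \<and> (D has_vector_derivative \<beta>) (at 0) \<and>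
    (\<forall>t\<in>{-d<..<d}. \<forall>j\<in>insert l S. \<forall>k\<in>insert l S. hform (M t) (D t $ j) (D t $ k) = (if j = k then 1 else 0)) \<and>
    (\<forall>t. \<forall>k. k \<noteq> l \<longrightarrow> D t $ k = C t $ k) \<and>
    (S = {} \<longrightarrow> (\<forall>t\<in>{-d<..<d}. \<exists>r>0. D t $ l = r *\<^sub>R C t $ l))"
proof -
  define g where "g k t = hform (M t) (C t $ l) (C t $ k)" for k t
  define w where "w t = C t $ l - (\<Sum>k\<in>S. g k t *s C t $ k)" for t
  \<comment> \<open>The real part makes the squared length available to the real square root;
    Hermitian symmetry shows below that nothing is lost.\<close>
  define N where "N t = Re (hform (M t) (w t) (w t))" for t
  define D where "D t = (\<chi> k. if k = l then inverse (sqrt (N t)) *\<^sub>R w t else C t $ k)" for t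
  have Cv: "((\<lambda>t. C t $ k) has_vector_derivative \<beta> $ k) (at 0)" for k
    by (rule bounded_linear.has_vector_derivative[OF bounded_linear_vec_nth C(3)])
  have g0: "g k 0 = (if l = k then 1 else 0)" for k
    unfolding g_def C(2) by (rule B)
  have gv: "(g k has_vector_derivative 0) (at 0)" for k
    using has_vector_derivative_hform[OF M(3) Cv Cv, of l k] stat unfolding g_def[abs_def] C(2) by simp
  have w0: "w 0 = B $ l"
    using l unfolding w_def C(2) g0 by (auto intro!: sum.neutral)
  have "((\<lambda>t. g k t *s C t $ k) has_vector_derivative g k 0 *s \<beta> $ k + 0 *s C 0 $ k) (at 0)" for k
    by (rule bounded_bilinear.has_vector_derivative[OF bounded_bilinear_complex_vec_scale gv Cv])
  then have "((\<lambda>t. \<Sum>k\<in>S. g k t *s C t $ k) has_vector_derivative (\<Sum>k\<in>S. g k 0 *s \<beta> $ k + 0 *s C 0 $ k)) (at 0)"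
    by (intro has_vector_derivative_sum) 
  \<comment> \<open>As \<open>l\<close> lies outside \<open>S\<close>, each coefficient vanishes at
    0 together with its derivative, so the subtracted projection has velocity 0.\<close>
  moreover have "(\<Sum>k\<in>S. g k 0 *s \<beta> $ k + 0 *s C 0 $ k) = 0"
    using l unfolding g0 by (auto intro!: sum.neutral)
  ultimately have wv: "(w has_vector_derivative \<beta> $ l) (at 0)"
    using has_vector_derivative_diff[OF Cv, of "\<lambda>t. \<Sum>k\<in>S. g k t *s C t $ k" 0 l] unfolding w_def[abs_def] by simp
  have N0: "N 0 = 1" unfolding N_def w0 by (simp add: B)
  have Nv: "(N has_vector_derivative 0) (at 0)"
    using bounded_linear.has_vector_derivative[OF bounded_linear_Re has_vector_derivative_hform[OF M(3) wv wv]] stat[of l l]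
    unfolding N_def[abs_def] w0 by simp
  have op: "open {-e<..<e}" by simp
  have gs: "smooth_on {-e<..<e} (g k)" for k
    unfolding g_def[abs_def] by (intro smooth_on_hform M smooth_on_vec_nth C op)
  have ws: "smooth_on {-e<..<e} w"
    unfolding w_def[abs_def]
    by (intro smooth_on_diff smooth_on_vec_nth C smooth_on_sum smooth_on_bilinear[OF bounded_bilinear_complex_vec_scale] gs op)
  have Ns: "smooth_on {-e<..<e} N"
    unfolding N_def[abs_def] by (intro smooth_on_compose_linear[OF bounded_linear_Re] smooth_on_hform M ws op)
  \<comment> \<open>The squared length is 1 at 0, hence positive nearby. The normalisation is the
    reason why the interval shrinks.\<close>
  have "open (N -` {0<..} \<inter> {-e<..<e})"
    using smooth_on_imp_continuous_on[OF Ns] continuous_on_open_vimage[OF op] by (metis open_greaterThan)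
  moreover have "0 \<in> N -` {0<..} \<inter> {-e<..<e}" using N0 e by simp
  ultimately obtain d where d: "d > 0" "ball 0 d \<subseteq> N -` {0<..} \<inter> {-e<..<e}" by (meson openE)
  have sub: "t \<in> {-e<..<e}" "N t > 0" if "t \<in> {-d<..<d}" for t
    using d(2) that by (auto simp: subset_iff dist_real_def abs_less_iff)
  have de: "d \<le> e"
  proof (rule ccontr)
    assume "\<not> d \<le> e" then have "e \<in> {-d<..<d}" using e by auto
    from sub(1)[OF this] show False by simp
  qed
  have sub': "{-d<..<d} \<subseteq> {-e<..<e}" using de by auto
  have op': "open {-d<..<d}" by simp
  have ns: "smooth_on {-d<..<d} (\<lambda>t. inverse (sqrt (N t)))"
    by (intro smooth_on_inverse smooth_on_sqrt smooth_on_subset[OF Ns sub'] op' sub(2)) (use sub(2) in force)+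
  have iw: "smooth_on {-d<..<d} (\<lambda>t. inverse (sqrt (N t)) *\<^sub>R w t)"
    by (intro smooth_on_scaleR smooth_on_subset[OF ws sub'] op' ns)
  have "smooth_on {-d<..<d} (\<lambda>t. if k = l then inverse (sqrt (N t)) *\<^sub>R w t else C t $ k)" for k
    using iw smooth_on_vec_nth[OF op' smooth_on_subset[OF C(1) sub']] by (cases "k = l") auto
  then have Ds: "smooth_on {-d<..<d} D"
    unfolding D_def[abs_def] by (intro smooth_on_vec_lambda op')
  have D0: "D 0 = B" unfolding D_def w0 N0 C(2) by (simp add: vec_eq_iff)
  have Nd: "(N has_real_derivative 0) (at 0)"
    using Nv unfolding has_real_derivative_iff_has_vector_derivative .
  have "((\<lambda>t. inverse (sqrt (N t))) has_real_derivative 0) (at 0)"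
    using N0 by (auto intro!: derivative_eq_intros Nd)
  then have "((\<lambda>t. inverse (sqrt (N t)) *\<^sub>R w t) has_vector_derivative inverse (sqrt (N 0)) *\<^sub>R \<beta> $ l + 0 *\<^sub>R w 0) (at 0)"
    by (intro has_vector_derivative_scaleR wv)
  then have iwv: "((\<lambda>t. inverse (sqrt (N t)) *\<^sub>R w t) has_vector_derivative \<beta> $ l) (at 0)"
    by (simp add: N0)
  have "((\<lambda>t. D t $ k) has_vector_derivative \<beta> $ k) (at 0)" for k
    using iwv Cv[of k] by (cases "k = l") (simp_all add: D_def)
  then have Dv: "(D has_vector_derivative \<beta>) (at 0)"
    by (rule has_vector_derivative_vec_componentwise)
  have wk: "hform (M t) (w t) (C t $ k) = 0" if t: "t \<in> {-d<..<d}" and k: "k \<in> S" for t k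
  proof -
    have "(\<Sum>j\<in>S. g j t * hform (M t) (C t $ j) (C t $ k)) = (\<Sum>j\<in>S. if j = k then g k t else 0)"
      using ortho[OF sub(1)[OF t] _ k] by (intro sum.cong) auto
    also have "\<dots> = g k t" using k by (simp add: finite_subset[OF subset_UNIV])
    finally show ?thesis
      unfolding w_def by (simp add: hform_diff_left hform_sum_left hform_scale_left g_def)
  qed
  have kw: "hform (M t) (C t $ k) (w t) = 0" if t: "t \<in> {-d<..<d}" and k: "k \<in> S" for t k
    using cnj_hform[OF M(2)[OF sub(1)[OF t]], of "w t" "C t $ k"] wk[OF that] by simp
  have ww: "hform (M t) (D t $ l) (D t $ l) = 1" if t: "t \<in> {-d<..<d}" for t
  proof -
    have "cnj (hform (M t) (w t) (w t)) = hform (M t) (w t) (w t)"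
      by (rule cnj_hform[OF M(2)[OF sub(1)[OF t]]])
    then have "hform (M t) (w t) (w t) = of_real (N t)"
      unfolding N_def by (metis Reals_cnj_iff of_real_Re)
    moreover have "hform (M t) (D t $ l) (D t $ l) =
        inverse (sqrt (N t)) *\<^sub>R (inverse (sqrt (N t)) *\<^sub>R hform (M t) (w t) (w t))"
      by (simp add: D_def hform_scaleR_left hform_scaleR_right)
    ultimately have "hform (M t) (D t $ l) (D t $ l) = of_real (inverse (sqrt (N t)) * (inverse (sqrt (N t)) * N t))"
      by (simp only: scaleR_conv_of_real of_real_mult)
    moreover have "inverse (sqrt (N t)) * (inverse (sqrt (N t)) * N t) = 1"
      using sub(2)[OF t] by (simp add: field_simps)
    ultimately show ?thesis by (metis of_real_1)
  qed
  have "hform (M t) (D t $ j) (D t $ k) = (if j = k then 1 else 0)"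
    if t: "t \<in> {-d<..<d}" and jk: "j \<in> insert l S" "k \<in> insert l S" for t j k
  proof -
    consider "j = l" "k = l" | "j = l" "k \<in> S" "k \<noteq> l" | "k = l" "j \<in> S" "j \<noteq> l" | "j \<in> S" "k \<in> S" "j \<noteq> l" "k \<noteq> l"
      using jk l by blast
    then show ?thesis
    proof cases
      case 1 then show ?thesis using ww[OF t] by simp
    next
      case 2 then show ?thesis using wk[OF t] by (simp add: D_def hform_scaleR_left)
    next
      case 3 then show ?thesis using kw[OF t] by (simp add: D_def hform_scaleR_right)
    next
      case 4 then show ?thesis using ortho[OF sub(1)[OF t]] by (simp add: D_def)
    qed
  qed
  \<comment> \<open>With \<open>S\<close> empty there is nothing to project off: the vector treated
    first is only rescaled by a positive real number.\<close>
  moreover have "\<exists>r>0. D t $ l = r *\<^sub>R C t $ l" if "S = {}" "t \<in> {-d<..<d}" for t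
    using that sub(2)[OF that(2)] by (intro exI[of _ "inverse (sqrt (N t))"]) (auto simp: D_def w_def)
  moreover have "D t $ k = C t $ k" if "k \<noteq> l" for t k using that by (simp add: D_def)
  ultimately show ?thesis using d(1) de Ds D0 Dv by blast
qed

text \<open>The induction starts with \<open>k0\<close>, so this vector is merely rescaled, and the
  later steps do not touch it. This matters because in the application the form depends on the
  direction of that vector.\<close>

lemma gram_schmidt_curve:
  fixes M :: "real \<Rightarrow> complex^'n^'n" and C :: "real \<Rightarrow> complex^'n^'n"
  assumes e: "e > 0" and M: "smooth_on {-e<..<e} M" "\<And>t. t \<in> {-e<..<e} \<Longrightarrow> hermitian_matrix (M t)"
      "(M has_vector_derivative M') (at 0)"
    and C: "smooth_on {-e<..<e} C" "C 0 = B" "(C has_vector_derivative \<beta>) (at 0)"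
    and B: "\<And>j k. hform (M 0) (B $ j) (B $ k) = (if j = k then 1 else 0)"
    and stat: "\<And>j k. hform M' (B $ j) (B $ k) + hform (M 0) (\<beta> $ j) (B $ k) + hform (M 0) (B $ j) (\<beta> $ k) = 0"
  shows "\<exists>d D. 0 < d \<and> d \<le> e \<and> smooth_on {-d<..<d} D \<and> D 0 = B \<and> (D has_vector_derivative \<beta>) (at 0) \<and>
    (\<forall>t\<in>{-d<..<d}. \<forall>j k. hform (M t) (D t $ j) (D t $ k) = (if j = k then 1 else 0)) \<and>
    (\<forall>t\<in>{-d<..<d}. \<exists>r>0. D t $ k0 = r *\<^sub>R C t $ k0)"
proof -
  have "\<exists>d D. 0 < d \<and> d \<le> e \<and> smooth_on {-d<..<d} D \<and> D 0 = B \<and> (D has_vector_derivative \<beta>) (at 0) \<and>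
    (\<forall>t\<in>{-d<..<d}. \<forall>j\<in>insert k0 S. \<forall>k\<in>insert k0 S. hform (M t) (D t $ j) (D t $ k) = (if j = k then 1 else 0)) \<and>
    (\<forall>t\<in>{-d<..<d}. \<exists>r>0. D t $ k0 = r *\<^sub>R C t $ k0)" if "finite S" "k0 \<notin> S" for S
    using that
  proof (induction S)
    case empty
    then show ?case
      using gram_schmidt_step[OF e M C B stat, of "{}" k0] by (simp only: simp_thms empty_iff ball_simps) blast
  next
    case (insert l S)
    then obtain d D where D: "0 < d" "d \<le> e" "smooth_on {-d<..<d} D" "D 0 = B" "(D has_vector_derivative \<beta>) (at 0)"
      "\<And>t j k. t \<in> {-d<..<d} \<Longrightarrow> j \<in> insert k0 S \<Longrightarrow> k \<in> insert k0 S \<Longrightarrow> hform (M t) (D t $ j) (D t $ k) = (if j = k then 1 else 0)"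
      "\<And>t. t \<in> {-d<..<d} \<Longrightarrow> \<exists>r>0. D t $ k0 = r *\<^sub>R C t $ k0" by (metis insertCI)
    have sub: "{-d<..<d} \<subseteq> {-e<..<e}" using D(2) by auto
    have "l \<notin> insert k0 S" using insert.hyps insert.prems by auto
    from gram_schmidt_step[OF D(1) smooth_on_subset[OF M(1) sub] M(2)[OF subsetD[OF sub]] M(3) D(3-5) B stat D(6) this]
    obtain d' D' where D': "0 < d'" "d' \<le> d" "smooth_on {-d'<..<d'} D'" "D' 0 = B" "(D' has_vector_derivative \<beta>) (at 0)"
      "\<forall>t\<in>{-d'<..<d'}. \<forall>j\<in>insert l (insert k0 S). \<forall>k\<in>insert l (insert k0 S). hform (M t) (D' t $ j) (D' t $ k) = (if j = k then 1 else 0)"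
      "\<forall>t. \<forall>k. k \<noteq> l \<longrightarrow> D' t $ k = D t $ k" by blast
    have "\<forall>t\<in>{-d'<..<d'}. \<exists>r>0. D' t $ k0 = r *\<^sub>R C t $ k0"
      using D(7) D'(2,7) insert.prems by auto
    then show ?case
      using D' D(2) by (intro exI[of _ d'] exI[of _ D']) (simp add: insert_commute)
  qed
  moreover have "insert k0 (- {k0}) = UNIV" by auto
  ultimately show ?thesis by (metis (no_types, lifting) ComplD UNIV_I finite singletonI)
qed

text \<open>Cramer's rule expresses the solution of a linear system as a quotient of polynomials in
  its data, which makes the smooth dependence visible.\<close>

lemma smooth_on_cramer:
  fixes M :: "'e::euclidean_space \<Rightarrow> complex^'n^'n"
  assumes "open S" "smooth_on S M" "smooth_on S r" "\<And>x. x \<in> S \<Longrightarrow> det (M x) \<noteq> 0"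
  shows "smooth_on S (\<lambda>x. \<chi> k. det (\<chi> i j. if j = k then r x $ i else M x $ i $ j) / det (M x))"
proof -
  have *: "smooth_on S (\<lambda>x. if j = k then r x $ i else M x $ i $ j)" for k i j
    by (cases "j = k") (simp_all add: smooth_on_vec_nth assms(1-3))
  show ?thesis
    by (intro smooth_on_vec_lambda smooth_on_divide smooth_on_det assms)
      (simp_all add: * smooth_on_vec_nth assms)
qed

section \<open>The local model of the unitary frame bundle\<close>

text \<open>The complex linear part of the real differential with respect to \<open>I\<close>, that
  is, the derivative of type (1,0).\<close>

definition dz :: "('e \<Rightarrow> 'e) \<Rightarrow> ('e::euclidean_space \<Rightarrow> complex) \<Rightarrow> 'e \<Rightarrow> 'e \<Rightarrow> complex" where
  "dz I f w x = (dd f w x - \<i> * dd f (I w) x) / 2"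

definition I_pair :: "(complex^'n) \<times> (complex^'n) \<Rightarrow> (complex^'n) \<times> (complex^'n)" where
  "I_pair = (\<lambda>(x, v). (\<i> *s x, \<i> *s v))"

text \<open>\<open>Hm (x, v)\<close> is the matrix of the Levi form of the squared metric at the tangent vector with
  coordinates \<open>(x, v)\<close>.  The last assumption is the symmetry \<open>G\<^sub>\<alpha>\<^sub>\<gamma>\<^sub>\<beta> v\<^sup>\<alpha> = 0\<close> (with \<open>\<beta>\<close>
  conjugated), which expresses that \<open>Hm\<close> has degree \<open>0\<close> in \<open>v\<close>.\<close>

locale levi_matrix =
  fixes Om :: "(complex^'n) set" and Hm :: "(complex^'n) \<times> (complex^'n) \<Rightarrow> complex^'n^'n" and k0 :: 'n
  assumes open_Om: "open Om"
    and smooth_Hm: "smooth_on (Om \<times> (- {0})) Hm"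
    and herm: "x \<in> Om \<Longrightarrow> v \<noteq> 0 \<Longrightarrow> hermitian_matrix (Hm (x, v))"
    and pos: "x \<in> Om \<Longrightarrow> v \<noteq> 0 \<Longrightarrow> w \<noteq> 0 \<Longrightarrow> 0 < Re (hform (Hm (x, v)) w w)"
    and homogeneous: "x \<in> Om \<Longrightarrow> v \<noteq> 0 \<Longrightarrow> r > 0 \<Longrightarrow> Hm (x, r *\<^sub>R v) = Hm (x, v)"
    and radial: "x \<in> Om \<Longrightarrow> v \<noteq> 0 \<Longrightarrow> (\<Sum>j\<in>UNIV. dz I_pair (\<lambda>p. Hm p $ i $ j) (0, b) (x, v) * v $ j) = 0"
begin

definition Psi :: "'n \<Rightarrow> 'n \<Rightarrow> (complex^'n) \<times> ((complex^'n)^'n) \<Rightarrow> complex" where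
  "Psi j k q = hform (Hm (fst q, snd q $ k0)) (snd q $ j) (snd q $ k)"

definition del :: "(complex^'n) \<times> (complex^'n) \<Rightarrow> (complex^'n) \<times> (complex^'n) \<Rightarrow> complex^'n^'n" where
  "del W p = (\<chi> i j. dz I_pair (\<lambda>p. Hm p $ i $ j) W p)"

definition orthonormal :: "(complex^'n) \<times> ((complex^'n)^'n) \<Rightarrow> bool" where
  "orthonormal q \<longleftrightarrow> fst q \<in> Om \<and> (\<forall>j k. Psi j k q = (if j = k then 1 else 0))"

definition dom :: "((complex^'n) \<times> ((complex^'n)^'n)) set" where
  "dom = {q. fst q \<in> Om \<and> snd q $ k0 \<noteq> 0}"

lemma open_pairs: "open (Om \<times> (- {0 :: complex^'n}))"
  by (intro open_Times open_Om) auto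

lemma open_dom: "open dom"
proof -
  have "dom = (\<lambda>q. (fst q, snd q $ k0)) -` (Om \<times> (- {0}))" unfolding dom_def by auto
  then show ?thesis
    by (simp only:) (intro open_vimage open_pairs continuous_intros)
qed

lemma dom_pair: "q \<in> dom \<Longrightarrow> (fst q, snd q $ k0) \<in> Om \<times> (- {0})"
  unfolding dom_def by auto

lemma orthonormal_dom: "orthonormal q \<Longrightarrow> q \<in> dom"
proof -
  assume q: "orthonormal q"
  then have "Psi k0 k0 q = 1" unfolding orthonormal_def by simp
  then have "snd q $ k0 \<noteq> 0" unfolding Psi_def by auto
  then show ?thesis using q unfolding dom_def orthonormal_def by simp
qed

lemma orthonormal_det: "orthonormal q \<Longrightarrow> det (snd q) \<noteq> 0"
  unfolding orthonormal_def Psi_def by (rule hform_orthonormal_det) blast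

lemma smooth_base_pair: "open S \<Longrightarrow> smooth_on S (\<lambda>q :: (complex^'n) \<times> ((complex^'n)^'n). (fst q, snd q $ k0))"
  by (intro smooth_on_Pair smooth_on_fst smooth_on_snd smooth_on_vec_nth smooth_on_id)

lemma smooth_Hm_dom: "smooth_on dom (\<lambda>q. Hm (fst q, snd q $ k0))"
  by (rule smooth_on_compose[OF open_dom open_pairs smooth_Hm smooth_base_pair[OF open_dom]]) (use dom_pair in blast)

lemma smooth_Psi: "smooth_on dom (Psi j k)"
  unfolding Psi_def[abs_def]
  by (intro smooth_on_hform open_dom smooth_Hm_dom smooth_on_vec_nth smooth_on_snd smooth_on_id)

lemma dd_Psi:
  assumes q: "q \<in> dom"
  shows "dd (Psi j k) X q = hform (dd Hm (fst X, snd X $ k0) (fst q, snd q $ k0)) (snd q $ j) (snd q $ k) +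
    hform (Hm (fst q, snd q $ k0)) (snd X $ j) (snd q $ k) + hform (Hm (fst q, snd q $ k0)) (snd q $ j) (snd X $ k)"
proof -
  have p: "((\<lambda>q. (fst q, snd q $ k0)) has_derivative (\<lambda>X. (fst X, snd X $ k0))) (at q)"
    by (intro has_derivative_Pair has_derivative_fst bounded_linear.has_derivative[OF bounded_linear_vec_nth]
        has_derivative_snd has_derivative_ident)
  have H: "((\<lambda>q. Hm (fst q, snd q $ k0)) has_derivative (\<lambda>X. dd Hm (fst X, snd X $ k0) (fst q, snd q $ k0))) (at q)"
    by (rule has_derivative_compose[OF p smooth_on_has_derivative[OF smooth_Hm open_pairs dom_pair[OF q]]])
  have n: "((\<lambda>q. snd q $ j) has_derivative (\<lambda>X. snd X $ j)) (at q)" for j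
    by (intro bounded_linear.has_derivative[OF bounded_linear_vec_nth] has_derivative_snd has_derivative_ident)
  have "(Psi j k has_derivative (\<lambda>X. hform (dd Hm (fst X, snd X $ k0) (fst q, snd q $ k0)) (snd q $ j) (snd q $ k) +
    hform (Hm (fst q, snd q $ k0)) (snd X $ j) (snd q $ k) + hform (Hm (fst q, snd q $ k0)) (snd q $ j) (snd X $ k))) (at q)"
    unfolding Psi_def[abs_def] by (rule has_derivative_hform[OF H n n])
  from dd_eqI[OF this] show ?thesis .
qed

lemma del_eq:
  assumes "p \<in> Om \<times> (- {0})"
  shows "hform (del W p) w z = (hform (dd Hm W p) w z - \<i> * hform (dd Hm (I_pair W) p) w z) / 2"
proof -
  have "dd (\<lambda>p. Hm p $ i $ j) V p = dd Hm V p $ i $ j" for i j V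
    using bounded_linear.has_derivative[OF bounded_linear_vec_nth bounded_linear.has_derivative[OF bounded_linear_vec_nth
        smooth_on_has_derivative[OF smooth_Hm open_pairs assms]]] by (rule dd_eqI)
  then have *: "del W p $ i $ j = (dd Hm W p $ i $ j - \<i> * dd Hm (I_pair W) p $ i $ j) / 2" for i j
    by (simp add: del_def dz_def)
  show ?thesis
    unfolding hform_def sum_distrib_left sum_subtractf[symmetric] sum_divide_distrib
    by (intro sum.cong refl) (simp only: *, simp add: algebra_simps diff_divide_distrib)
qed

text \<open>The summand in which \<open>X\<close> enters through the conjugated argument of the form
  is antilinear in \<open>X\<close>, so it cancels from the complex linear part.\<close>

lemma dz_Psi:
  assumes q: "q \<in> dom"
  shows "dz I_frame (Psi j k) X q = hform (del (fst X, snd X $ k0) (fst q, snd q $ k0)) (snd q $ j) (snd q $ k) +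
    hform (Hm (fst q, snd q $ k0)) (snd X $ j) (snd q $ k)"
proof -
  have I: "fst (I_frame X) = \<i> *s fst X" "snd (I_frame X) $ i = \<i> *s (snd X $ i)" for i
    by (simp_all add: I_frame_def split_beta)
  have "I_pair (fst X, snd X $ k0) = (\<i> *s fst X, \<i> *s (snd X $ k0))" by (simp add: I_pair_def)
  then show ?thesis
    unfolding dz_def dd_Psi[OF q] I del_eq[OF dom_pair[OF q]] hform_scale_left hform_scale_right
    by (simp add: field_simps)
qed

lemma cnj_Psi: "q \<in> dom \<Longrightarrow> cnj (Psi j k q) = Psi k j q"
  unfolding Psi_def dom_def by (rule cnj_hform) (auto intro: herm)

text \<open>Since \<open>Psi k j\<close> is the conjugate of \<open>Psi j k\<close>, the complex
  linear part of the differential of one is the conjugate of the antilinear part of the other. If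
  all complex linear parts vanish, the whole differentials do.\<close>

lemma kernel_eq_holomorphic_kernel:
  assumes q: "q \<in> dom"
  shows "(\<forall>j k. dd (Psi j k) X q = 0 \<and> dd (Psi j k) (I_frame X) q = 0) \<longleftrightarrow> (\<forall>j k. dz I_frame (Psi j k) X q = 0)"
proof
  assume z: "\<forall>j k. dz I_frame (Psi j k) X q = 0"
  have c: "dd (Psi k j) Y q = cnj (dd (Psi j k) Y q)" for j k Y
  proof -
    have "((\<lambda>q. cnj (Psi j k q)) has_derivative (\<lambda>Y. cnj (dd (Psi j k) Y q))) (at q)"
      by (rule bounded_linear.has_derivative[OF bounded_linear_cnj smooth_on_has_derivative[OF smooth_Psi open_dom q]])
    then have "(Psi k j has_derivative (\<lambda>Y. cnj (dd (Psi j k) Y q))) (at q)"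
      by (rule has_derivative_transform_within_open[OF _ open_dom q cnj_Psi])
    then show ?thesis by (rule dd_eqI)
  qed
  show "\<forall>j k. dd (Psi j k) X q = 0 \<and> dd (Psi j k) (I_frame X) q = 0"
  proof (intro allI)
    fix j k
    \<comment> \<open>Write a and b for the derivatives of \<open>Psi j k\<close> along
      \<open>X\<close> and \<open>I_frame X\<close>. The entry (j, k) gives a = i b and the entry
      (k, j), after conjugation, a = - i b; hence both are 0.\<close>
    have "dd (Psi j k) X q = \<i> * dd (Psi j k) (I_frame X) q" using z by (simp add: dz_def)
    moreover have "dd (Psi k j) X q = \<i> * dd (Psi k j) (I_frame X) q" using z by (simp add: dz_def)
    then have "cnj (dd (Psi j k) X q) = \<i> * cnj (dd (Psi j k) (I_frame X) q)"
      unfolding c[of k j] .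
    ultimately show "dd (Psi j k) X q = 0 \<and> dd (Psi j k) (I_frame X) q = 0"
      by (auto simp: complex_eq_iff)
  qed
qed (simp add: dz_def)

lemma det_Hm: "p \<in> Om \<times> (- {0}) \<Longrightarrow> det (Hm p) \<noteq> 0"
proof -
  assume p: "p \<in> Om \<times> (- {0})"
  have "x = 0" if "Hm p *v x = 0" for x
  proof (rule ccontr)
    assume "x \<noteq> 0"
    then have "0 < Re (hform (Hm p) x x)" using pos[of "fst p" "snd p" x] p by (simp add: mem_Times_iff)
    then show False unfolding hform_matrix_vector that by simp
  qed
  then show ?thesis by (simp add: det_nonzero_iff_ker)
qed

section \<open>The horizontality equations and their solution\<close>

definition solve :: "complex^'n^'n \<Rightarrow> complex^'n \<Rightarrow> complex^'n" where
  "solve M r = (\<chi> k. det (\<chi> i j. if j = k then r $ i else M $ i $ j) / det M)"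

text \<open>The direction \<open>(\<xi>, 0)\<close> stands for \<open>(\<xi>, b)\<close> with any
  \<open>b\<close>: by \<open>del_radial\<close> the vertical part contributes nothing on the
  distinguished vector. This breaks the circularity of an equation whose unknown also occurs in the
  direction of differentiation.\<close>

definition Lam0 :: "(complex^'n) \<times> ((complex^'n)^'n) \<Rightarrow> complex^'n \<Rightarrow> complex^'n" where
  "Lam0 q \<xi> = solve (Hm (fst q, snd q $ k0)) (- (del (\<xi>, 0) (fst q, snd q $ k0) *v (snd q $ k0)))"

definition Lam :: "(complex^'n) \<times> ((complex^'n)^'n) \<Rightarrow> complex^'n \<Rightarrow> (complex^'n)^'n" where
  "Lam q \<xi> = (\<chi> j. solve (Hm (fst q, snd q $ k0)) (- (del (\<xi>, Lam0 q \<xi>) (fst q, snd q $ k0) *v (snd q $ j))))"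

lemma solve_iff: "p \<in> Om \<times> (- {0}) \<Longrightarrow> Hm p *v x = r \<longleftrightarrow> x = solve (Hm p) r"
  unfolding solve_def by (rule cramer[OF det_Hm])

lemma del_radial: "p \<in> Om \<times> (- {0}) \<Longrightarrow> del (0, b) p *v snd p = 0"
  using radial[of "fst p" "snd p"] by (auto simp: vec_eq_iff matrix_vector_mult_def del_def)

lemma del_add:
  assumes p: "p \<in> Om \<times> (- {0})"
  shows "del (V + W) p = del V p + del W p"
proof -
  have "smooth_on (Om \<times> (- {0})) (\<lambda>p. Hm p $ i $ j)" for i j
    by (intro smooth_on_vec_nth smooth_Hm open_pairs)
  from linear_add[OF dd_linear[OF this open_pairs p]]
  have a: "dd (\<lambda>p. Hm p $ i $ j) (V + W) p = dd (\<lambda>p. Hm p $ i $ j) V p + dd (\<lambda>p. Hm p $ i $ j) W p" for i j V W .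
  have "I_pair (V + W) = I_pair V + I_pair W"
    by (simp add: I_pair_def split_beta vector_add_ldistrib)
  then show ?thesis by (simp add: vec_eq_iff del_def dz_def a algebra_simps add_divide_distrib diff_divide_distrib)
qed

text \<open>For fixed \<open>j\<close> the equations say that one vector \<open>u j\<close> is
  orthogonal, in the standard Hermitian product, to all vectors of the frame. These span, so
  \<open>u j = 0\<close>, which is a linear system with the invertible matrix \<open>Hm\<close> for
  the row \<open>snd X $ j\<close>.\<close>

lemma horizontal_iff:
  assumes q: "q \<in> dom" and det: "det (snd q) \<noteq> 0"
  shows "(\<forall>j k. dz I_frame (Psi j k) X q = 0) \<longleftrightarrow> snd X = Lam q (fst X)"
proof -
  let ?p = "(fst q, snd q $ k0)" and ?W = "(fst X, snd X $ k0)"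
  note p = dom_pair[OF q]
  define u where "u j = del ?W ?p *v (snd q $ j) + Hm ?p *v (snd X $ j)" for j
  have dz: "dz I_frame (Psi j k) X q = (\<Sum>i\<in>UNIV. u j $ i * cnj (snd q $ k $ i))" for j k
    unfolding dz_Psi[OF q] hform_matrix_vector u_def by (simp add: sum.distrib algebra_simps)
  have "u j = 0" if z: "\<forall>k. dz I_frame (Psi j k) X q = 0" for j
  proof -
    obtain z where zu: "u j = (\<Sum>k\<in>UNIV. z $ k *s snd q $ k)" using spanning_of_det[OF det] .
    \<comment> \<open>Expanding only the conjugated factor in the frame writes the squared norm of
      \<open>u j\<close> as a combination of the vanishing derivatives.\<close>
    have "(\<Sum>i\<in>UNIV. u j $ i * cnj (u j $ i)) = (\<Sum>i\<in>UNIV. \<Sum>k\<in>UNIV. cnj (z $ k) * (u j $ i * cnj (snd q $ k $ i)))"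
      by (subst (2) zu) (simp add: sum_distrib_left mult.left_commute)
    also have "\<dots> = (\<Sum>k\<in>UNIV. cnj (z $ k) * dz I_frame (Psi j k) X q)"
      unfolding dz sum_distrib_left by (rule sum.swap)
    also have "\<dots> = 0" using z by simp
    finally have "(\<Sum>i\<in>UNIV. complex_of_real ((cmod (u j $ i))\<^sup>2)) = 0"
      by (simp add: complex_norm_square[symmetric])
    then have "(\<Sum>i\<in>UNIV. (cmod (u j $ i))\<^sup>2) = 0" by (metis of_real_eq_0_iff of_real_sum)
    then show ?thesis by (simp add: sum_nonneg_eq_0_iff vec_eq_iff)
  qed
  then have "(\<forall>j k. dz I_frame (Psi j k) X q = 0) \<longleftrightarrow> (\<forall>j. u j = 0)"
    by (auto simp: dz)
  also have "\<dots> \<longleftrightarrow> (\<forall>j. Hm ?p *v (snd X $ j) = - (del ?W ?p *v (snd q $ j)))"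
    unfolding u_def by (metis add.commute add.right_inverse eq_neg_iff_add_eq_0)
  also have "\<dots> \<longleftrightarrow> (\<forall>j. snd X $ j = solve (Hm ?p) (- (del ?W ?p *v (snd q $ j))))"
    unfolding solve_iff[OF p] ..
  also have "\<dots> \<longleftrightarrow> snd X = Lam q (fst X)"
  proof -
    have "del (\<xi>, b) ?p *v (snd q $ k0) = del (\<xi>, 0) ?p *v (snd q $ k0)" for \<xi> b
      using del_add[OF p, of "(\<xi>, 0)" "(0, b)"] del_radial[OF p, of b] by (simp add: matrix_vector_mult_add_rdistrib)
    then have "solve (Hm ?p) (- (del (\<xi>, b) ?p *v (snd q $ k0))) = Lam0 q \<xi>" for \<xi> b
      unfolding Lam0_def by metis
    note k0 = this
    show ?thesis
    proof
      assume X: "\<forall>j. snd X $ j = solve (Hm ?p) (- (del ?W ?p *v (snd q $ j)))"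
      then have "snd X $ k0 = Lam0 q (fst X)" using k0 by metis
      from X[unfolded this] show "snd X = Lam q (fst X)" by (simp add: Lam_def vec_eq_iff)
    next
      assume X: "snd X = Lam q (fst X)"
      then have "snd X $ k0 = Lam0 q (fst X)" unfolding Lam_def by (simp only: vec_lambda_beta k0)
      then show "\<forall>j. snd X $ j = solve (Hm ?p) (- (del ?W ?p *v (snd q $ j)))"
        using X by (simp add: Lam_def)
    qed
  qed
  finally show ?thesis .
qed

lemma smooth_del:
  assumes S: "open S" "S \<subseteq> dom" and w: "smooth_on S w"
  shows "smooth_on S (\<lambda>q. del (w q) (fst q, snd q $ k0))"
proof -
  have H: "smooth_on (Om \<times> (- {0})) (\<lambda>p. Hm p $ i $ j)" for i j
    by (intro smooth_on_vec_nth smooth_Hm open_pairs)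
  have sub: "(\<lambda>q. (fst q, snd q $ k0)) ` S \<subseteq> Om \<times> (- {0})" using dom_pair S(2) by blast
  have "bounded_linear (I_pair :: (complex^'n) \<times> (complex^'n) \<Rightarrow> _)"
    unfolding linear_conv_bounded_linear[symmetric]
    by (rule linearI) (auto simp: I_pair_def split_beta vector_add_ldistrib vec_eq_iff)
  then have Iw: "smooth_on S (\<lambda>q. I_pair (w q))" by (rule smooth_on_compose_linear[OF _ S(1) w])
  show ?thesis
    unfolding del_def dz_def divide_inverse
    by (intro smooth_on_vec_lambda smooth_on_mult smooth_on_diff smooth_on_const S(1)
        smooth_on_dd_apply[OF S(1) open_pairs H smooth_base_pair[OF S(1)] sub] w Iw)
qed

lemma smooth_solve:
  assumes S: "open S" "S \<subseteq> dom" and r: "smooth_on S r"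
  shows "smooth_on S (\<lambda>q. solve (Hm (fst q, snd q $ k0)) (r q))"
  unfolding solve_def
  by (rule smooth_on_cramer[OF S(1) smooth_on_subset[OF smooth_Hm_dom S(2)] r det_Hm[OF dom_pair]]) (use S(2) in auto)

lemma smooth_on_matrix_vector:
  fixes M :: "'e::euclidean_space \<Rightarrow> complex^'n^'m"
  assumes "open S" "smooth_on S M" "smooth_on S v"
  shows "smooth_on S (\<lambda>x. M x *v v x)"
  unfolding matrix_vector_mult_def
  by (intro smooth_on_vec_lambda smooth_on_sum smooth_on_mult smooth_on_vec_nth assms)

lemma smooth_Lam:
  assumes S: "open S" "S \<subseteq> dom"
  shows "smooth_on S (\<lambda>q. Lam q \<xi>)"
proof -
  have n: "smooth_on S (\<lambda>q :: (complex^'n) \<times> ((complex^'n)^'n). snd q $ j)" for j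
    by (intro smooth_on_vec_nth smooth_on_snd smooth_on_id S(1))
  have L0: "smooth_on S (\<lambda>q. Lam0 q \<xi>)"
    unfolding Lam0_def by (intro smooth_solve S smooth_on_minus smooth_on_matrix_vector smooth_del smooth_on_const n)
  show ?thesis
    unfolding Lam_def
    by (intro smooth_on_vec_lambda smooth_solve S smooth_on_minus smooth_on_matrix_vector smooth_del
        smooth_on_Pair smooth_on_const n L0)
qed

text \<open>Linearity is read off from \<open>horizontal_iff\<close>: the graph of
  \<open>Lam q\<close> is the solution set of real linear equations. The formula through
  determinants is not inspected.\<close>

lemma linear_Lam:
  assumes q: "q \<in> dom" and det: "det (snd q) \<noteq> 0"
  shows "linear (Lam q)"
proof -
  have l: "linear (\<lambda>X. dd (Psi j k) X q)" for j k
    by (rule dd_linear[OF smooth_Psi open_dom q])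
  have I: "I_frame (X + Y) = I_frame X + I_frame Y" "I_frame (r *\<^sub>R X) = r *\<^sub>R I_frame X"
    for X Y :: "(complex^'n) \<times> ((complex^'n)^'n)" and r
    by (simp_all add: I_frame_def split_beta vec_eq_iff algebra_simps)
  have h: "\<forall>j k. dz I_frame (Psi j k) (\<xi>, Lam q \<xi>) q = 0" for \<xi>
    using horizontal_iff[OF assms, of "(\<xi>, Lam q \<xi>)"] by simp
  have a: "dz I_frame (Psi j k) (X + Y) q = dz I_frame (Psi j k) X q + dz I_frame (Psi j k) Y q"
    and s: "dz I_frame (Psi j k) (r *\<^sub>R X) q = r *\<^sub>R dz I_frame (Psi j k) X q" for j k X Y r
    using linear_add[OF l] linear_scale[OF l] by (simp_all add: dz_def I scaleR_conv_of_real field_simps)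
  show ?thesis
  proof (rule linearI)
    fix \<xi> \<eta> show "Lam q (\<xi> + \<eta>) = Lam q \<xi> + Lam q \<eta>"
    proof -
      have "\<forall>j k. dz I_frame (Psi j k) ((\<xi>, Lam q \<xi>) + (\<eta>, Lam q \<eta>)) q = 0" unfolding a using h by simp
      then show ?thesis unfolding horizontal_iff[OF assms] by simp
    qed
  next
    fix r \<xi> show "Lam q (r *\<^sub>R \<xi>) = r *\<^sub>R Lam q \<xi>"
    proof -
      have "\<forall>j k. dz I_frame (Psi j k) (r *\<^sub>R (\<xi>, Lam q \<xi>)) q = 0" unfolding s using h by simp
      then show ?thesis unfolding horizontal_iff[OF assms] by simp
    qed
  qed
qed

text \<open>Every vector annihilated by the differential of the Gram matrix is the velocity of a curve of
  orthonormal frames: orthonormalise the straight line.  Since \<open>Hm\<close> has degree \<open>0\<close>, rescaling the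
  vector with index \<open>k0\<close> does not affect the Hermitian form.\<close>

lemma kernel_curve:
  assumes q: "orthonormal q" and X: "\<And>j k. dd (Psi j k) X q = 0"
  shows "\<exists>e>0. \<exists>c. smooth_on {-e<..<e::real} c \<and> c 0 = q \<and> (c has_vector_derivative X) (at 0) \<and>
    (\<forall>t\<in>{-e<..<e}. orthonormal (c t))"
proof -
  note qd = orthonormal_dom[OF q]
  define a where "a t = q + t *\<^sub>R X" for t
  have as: "smooth_on S a" if "open S" for S
    unfolding a_def[abs_def] by (intro smooth_on_add smooth_on_const smooth_on_scaleR smooth_on_id that)
  have a0: "a 0 = q" by (simp add: a_def)
  have av: "(a has_vector_derivative X) (at 0)"
    unfolding a_def[abs_def] by (auto intro!: derivative_eq_intros)
  have "open (a -` dom)"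
    using continuous_on_open_vimage[OF open_UNIV, of a] smooth_on_imp_continuous_on[OF as[OF open_UNIV]] open_dom by auto
  moreover have "0 \<in> a -` dom" using a0 qd by simp
  ultimately obtain e where e: "e > 0" "ball 0 e \<subseteq> a -` dom" by (meson openE)
  have ad: "a t \<in> dom" if "t \<in> {-e<..<e}" for t
    using e(2) that by (auto simp: subset_iff dist_real_def abs_less_iff)
  \<comment> \<open>The form is taken along the uncorrected line, so that it does not change while
    the frame is being orthonormalised.\<close>
  define M where "M t = Hm (fst (a t), snd (a t) $ k0)" for t
  have Ms: "smooth_on {-e<..<e} M"
    unfolding M_def[abs_def] by (rule smooth_on_compose[OF _ open_dom smooth_Hm_dom as]) (use ad in auto)
  have Mh: "hermitian_matrix (M t)" if "t \<in> {-e<..<e}" for t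
    unfolding M_def using ad[OF that] by (intro herm) (auto simp: dom_def)
  have "((\<lambda>t. (fst (a t), snd (a t) $ k0)) has_vector_derivative (fst X, snd X $ k0)) (at 0)"
    by (intro has_vector_derivative_Pair bounded_linear.has_vector_derivative[OF bounded_linear_vec_nth]
        bounded_linear.has_vector_derivative[OF bounded_linear_fst] bounded_linear.has_vector_derivative[OF bounded_linear_snd] av)
  from has_vector_derivative_dd[OF smooth_Hm open_pairs _ this]
  have Mv: "(M has_vector_derivative dd Hm (fst X, snd X $ k0) (fst q, snd q $ k0)) (at 0)"
    unfolding M_def[abs_def] a0 using dom_pair[OF qd] by simp
  have C: "smooth_on {-e<..<e} (\<lambda>t. snd (a t))" "snd (a 0) = snd q" "((\<lambda>t. snd (a t)) has_vector_derivative snd X) (at 0)"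
    using bounded_linear.has_vector_derivative[OF bounded_linear_snd av] a0
    by (auto intro!: smooth_on_snd as)
  have B: "hform (M 0) (snd q $ j) (snd q $ k) = (if j = k then 1 else 0)" for j k
    using q unfolding orthonormal_def Psi_def M_def a0 by blast
  have stat: "hform (dd Hm (fst X, snd X $ k0) (fst q, snd q $ k0)) (snd q $ j) (snd q $ k) +
     hform (M 0) (snd X $ j) (snd q $ k) + hform (M 0) (snd q $ j) (snd X $ k) = 0" for j k
    using X[of j k] unfolding dd_Psi[OF qd] M_def a0 .
  obtain d D where D: "0 < d" "d \<le> e" "smooth_on {-d<..<d} D" "D 0 = snd q" "(D has_vector_derivative snd X) (at 0)"
    "\<forall>t\<in>{-d<..<d}. \<forall>j k. hform (M t) (D t $ j) (D t $ k) = (if j = k then 1 else 0)"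
    "\<forall>t\<in>{-d<..<d}. \<exists>r>0. D t $ k0 = r *\<^sub>R snd (a t) $ k0"
    using gram_schmidt_curve[OF e(1) Ms Mh Mv C B stat, of k0] by blast
  have "orthonormal (fst (a t), D t)" if t: "t \<in> {-d<..<d}" for t
  proof -
    have te: "t \<in> {-e<..<e}" using t D(2) by auto
    obtain r where "r > 0" "D t $ k0 = r *\<^sub>R snd (a t) $ k0" using D(7) t by blast
    then have "Hm (fst (a t), D t $ k0) = M t"
      unfolding M_def using homogeneous ad[OF te] by (simp add: dom_def)
    then show ?thesis
      using D(6) t ad[OF te] unfolding orthonormal_def Psi_def by (simp add: dom_def)
  qed
  moreover have "smooth_on {-d<..<d} (\<lambda>t. (fst (a t), D t))"
    by (intro smooth_on_Pair smooth_on_fst as D(3)) auto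
  moreover have "((\<lambda>t. (fst (a t), D t)) has_vector_derivative X) (at 0)"
    using has_vector_derivative_Pair[OF bounded_linear.has_vector_derivative[OF bounded_linear_fst av] D(5)] by simp
  ultimately show ?thesis
    using D(1,4) a0 by (intro exI[of _ d] conjI exI[of _ "\<lambda>t. (fst (a t), D t)"]) auto
qed

lemma orthonormal_curve_velocity:
  assumes e: "e > 0" and c: "c 0 = q" "(c has_vector_derivative X) (at 0)" "\<And>t. t \<in> {-e<..<e::real} \<Longrightarrow> orthonormal (c t)"
  shows "dd (Psi j k) X q = 0"
proof -
  have q: "q \<in> dom" using orthonormal_dom[OF c(3)[of 0]] e c(1) by simp
  have "((\<lambda>t. Psi j k (c t)) has_vector_derivative dd (Psi j k) X q) (at 0)"
    using has_vector_derivative_dd[OF smooth_Psi open_dom, of c 0] q c by simp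
  moreover have "((\<lambda>t. Psi j k (c t)) has_vector_derivative 0) (at 0)"
    by (rule has_vector_derivative_transform_within_open[where S = "{-e<..<e}" and f = "\<lambda>_. if j = k then 1 else 0"])
      (use c(3) e in \<open>auto simp: orthonormal_def\<close>)
  ultimately show ?thesis by (rule vector_derivative_unique_at)
qed

end

section \<open>The Levi form of a Finsler metric in coordinates\<close>

lemma vec_scale_complex: "c *s (w :: complex^'n) = Re c *\<^sub>R w + Im c *\<^sub>R (\<i> *s w)"
  by (simp add: vec_eq_iff complex_eq_iff)

lemma i_scale [simp]:
  "\<i> *s (\<i> *s (w :: complex^'n)) = - w" "\<i> *s (- w) = - (\<i> *s w)" "\<i> *s (r *\<^sub>R w) = r *\<^sub>R (\<i> *s w)"
  "\<i> *s w = 0 \<longleftrightarrow> w = 0"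
  by (auto simp: vec_eq_iff)

text \<open>A product rule: the direction depends linearly on the point. It serves to differentiate
  Euler's identities, where the direction is the position itself, and the Jacobian applied to a
  frame vector.\<close>

lemma dd_dd_apply:
  assumes f: "smooth_on S f" "open S" and x: "x \<in> S" and L: "bounded_linear L"
  shows "dd (\<lambda>q. dd f (L q) q) W x = dd (dd f (L x)) W x + dd f (L W) x"
proof -
  interpret L: bounded_linear L by (rule L)
  have e: "dd f w q = (\<Sum>b\<in>Basis. (w \<bullet> b) *\<^sub>R dd f b q)" if "q \<in> S" for w q
  proof -
    interpret l: linear "\<lambda>v. dd f v q" by (rule dd_linear[OF f that])
    show ?thesis by (subst euclidean_representation[of w, symmetric]) (simp add: l.sum l.scaleR)
  qed
  have d: "((\<lambda>q. \<Sum>b\<in>Basis. (g q \<bullet> b) *\<^sub>R dd f b q) has_derivative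
      (\<lambda>W. \<Sum>b\<in>Basis. (g x \<bullet> b) *\<^sub>R dd (dd f b) W x + (g' W \<bullet> b) *\<^sub>R dd f b x)) (at x)"
    if "(g has_derivative g') (at x)" for g g'
    by (intro has_derivative_sum has_derivative_scaleR has_derivative_inner_left that
        smooth_on_has_derivative[OF smooth_on_dd[OF f(1)] f(2) x])
  have eq: "(\<Sum>b\<in>Basis. (g q \<bullet> b) *\<^sub>R dd f b q) = dd f (g q) q" if "q \<in> S" for q g
    using e[OF that, of "g q"] by simp
  \<comment> \<open>Used twice, for the constant \<open>L x\<close> and for \<open>L\<close>: the
    first instance identifies the sum over the basis that occurs in the second.\<close>
  have v: "dd (\<lambda>q. dd f (g q) q) W x = (\<Sum>b\<in>Basis. (g x \<bullet> b) *\<^sub>R dd (dd f b) W x) + dd f (g' W) x"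
    if "(g has_derivative g') (at x)" for g g'
    using dd_eqI[OF has_derivative_transform_within_open[OF d[OF that] f(2) x eq[where g = g]], of W] e[OF x, of "g' W"]
    by (simp add: sum.distrib)
  have "dd f 0 x = 0" by (rule linear_0[OF dd_linear[OF f x]])
  then show ?thesis
    using v[OF has_derivative_const[of "L x"]] v[OF L.has_derivative[OF has_derivative_ident]] by simp
qed

locale finsler_chart_pre =
  fixes Om :: "(complex^'n) set" and f :: "(complex^'n) \<times> (complex^'n) \<Rightarrow> real"
  assumes open_Om: "open Om"
    and smooth_f: "smooth_on (Om \<times> (- {0})) f"
    and f_pos: "x \<in> Om \<Longrightarrow> v \<noteq> 0 \<Longrightarrow> f (x, v) > 0"
    and f_scale: "x \<in> Om \<Longrightarrow> f (x, z *s v) = cmod z * f (x, v)"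
begin

abbreviation "Dom \<equiv> Om \<times> (- {0 :: complex^'n})"

definition G :: "(complex^'n) \<times> (complex^'n) \<Rightarrow> real" where
  "G p = (f p)\<^sup>2"

definition D2 :: "(complex^'n) \<times> (complex^'n) \<Rightarrow> complex^'n \<Rightarrow> complex^'n \<Rightarrow> real" where
  "D2 p a b = dd (dd G (0, b)) (0, a) p"

text \<open>The complex bilinear extension of \<open>D2\<close> evaluated at (a - i Ja)/2 and (b + i
  Jb)/2, split into real and imaginary part; the two halves produce the factor 1/4.\<close>

definition levi :: "(complex^'n) \<times> (complex^'n) \<Rightarrow> complex^'n \<Rightarrow> complex^'n \<Rightarrow> complex" where
  "levi p a b = Complex ((D2 p a b + D2 p (\<i> *s a) (\<i> *s b)) / 4) ((D2 p a (\<i> *s b) - D2 p (\<i> *s a) b) / 4)"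

definition Hm :: "(complex^'n) \<times> (complex^'n) \<Rightarrow> complex^'n^'n" where
  "Hm p = (\<chi> i j. levi p (axis j 1) (axis i 1))"

section \<open>Algebra of the fibre Hessian and of the Levi form\<close>

lemma open_Dom: "open Dom"
  by (intro open_Times open_Om) auto

lemma f_scaleR: "x \<in> Om \<Longrightarrow> r \<ge> 0 \<Longrightarrow> f (x, r *\<^sub>R v) = r * f (x, v)"
  using f_scale[of x "of_real r" v] by (simp add: vec_scale_complex[of "of_real r"])

lemma f_zero: "x \<in> Om \<Longrightarrow> f (x, 0) = 0"
  using f_scaleR[of x 0 0] by simp

lemma smooth_G: "smooth_on Dom G"
  unfolding G_def[abs_def] power2_eq_square by (intro smooth_on_mult open_Dom smooth_f)

lemma dd_G: "p \<in> Dom \<Longrightarrow> dd G W p = 2 * f p * dd f W p"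
proof -
  assume "p \<in> Dom"
  from smooth_on_has_derivative[OF smooth_f open_Dom this]
  have "(G has_derivative (\<lambda>W. 2 * f p * dd f W p)) (at p)"
    unfolding G_def[abs_def] by (auto intro!: derivative_eq_intros)
  then show ?thesis by (rule dd_eqI)
qed

lemma D2_commute: "p \<in> Dom \<Longrightarrow> D2 p a b = D2 p b a"
  unfolding D2_def by (rule dd_commute[OF smooth_G open_Dom])

lemma D2_add: "p \<in> Dom \<Longrightarrow> D2 p (a + a') b = D2 p a b + D2 p a' b"
  unfolding D2_def using linear_add[OF dd_linear[OF smooth_on_dd[OF smooth_G] open_Dom], of p "(0, b)" "(0, a)" "(0, a')"] by simp

lemma D2_scaleR: "p \<in> Dom \<Longrightarrow> D2 p (r *\<^sub>R a) b = r * D2 p a b"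
  unfolding D2_def using linear_scale[OF dd_linear[OF smooth_on_dd[OF smooth_G] open_Dom], of p "(0, b)" r "(0, a)"] by simp

lemma D2_uminus: "p \<in> Dom \<Longrightarrow> D2 p (- a) b = - D2 p a b"
  using D2_scaleR[of p "-1" a b] by simp

lemma D2_scaleR_right: "p \<in> Dom \<Longrightarrow> D2 p a (r *\<^sub>R b) = r * D2 p a b"
  and D2_uminus_right: "p \<in> Dom \<Longrightarrow> D2 p a (- b) = - D2 p a b"
  by (simp_all add: D2_commute[of p a] D2_scaleR D2_uminus)

lemma cnj_levi: "p \<in> Dom \<Longrightarrow> cnj (levi p a b) = levi p b a"
  by (simp add: levi_def complex_eq_iff D2_commute[of p b] D2_commute[of p "\<i> *s b"] field_simps)

lemma levi_add: "p \<in> Dom \<Longrightarrow> levi p (a + a') b = levi p a b + levi p a' b"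
  by (simp add: levi_def complex_eq_iff D2_add vector_add_ldistrib field_simps)

lemma levi_scaleR: "p \<in> Dom \<Longrightarrow> levi p (r *\<^sub>R a) b = r *\<^sub>R levi p a b"
  by (simp add: levi_def complex_eq_iff D2_scaleR field_simps)

lemma levi_i: "p \<in> Dom \<Longrightarrow> levi p (\<i> *s a) b = \<i> * levi p a b"
  by (simp add: levi_def complex_eq_iff D2_uminus field_simps)

lemma levi_scale: "p \<in> Dom \<Longrightarrow> levi p (c *s a) b = c * levi p a b"
  by (subst vec_scale_complex) (simp add: levi_add levi_scaleR levi_i complex_eq_iff)

lemma levi_sum: "p \<in> Dom \<Longrightarrow> levi p (\<Sum>i\<in>S. g i) b = (\<Sum>i\<in>S. levi p (g i) b)"
proof -
  assume p: "p \<in> Dom"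
  have "levi p 0 b = 0" using levi_scaleR[OF p, of 0 0 b] by simp
  then show ?thesis by (induction S rule: infinite_finite_induct) (auto simp: levi_add[OF p])
qed

lemma levi_hform:
  assumes p: "p \<in> Dom"
  shows "levi p a b = hform (Hm p) a b"
proof -
  have e: "levi p a b = (\<Sum>j\<in>UNIV. a $ j * levi p (axis j 1) b)" for a b
    by (subst basis_expansion[of a, symmetric]) (simp add: levi_sum[OF p] levi_scale[OF p])
  have "levi p c b = (\<Sum>i\<in>UNIV. cnj (b $ i) * levi p c (axis i 1))" for c
    using arg_cong[OF e[of b c], of cnj] by (simp add: cnj_levi[OF p])
  then have "levi p a b = (\<Sum>j\<in>UNIV. \<Sum>i\<in>UNIV. Hm p $ i $ j * a $ j * cnj (b $ i))"
    unfolding e[of a b] by (simp add: Hm_def sum_distrib_left mult_ac)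
  then show ?thesis unfolding hform_def by (subst sum.swap) 
qed

lemma hermitian_Hm: "p \<in> Dom \<Longrightarrow> hermitian_matrix (Hm p)"
  by (simp add: hermitian_matrix_def Hm_def cnj_levi)

lemma smooth_D2: "smooth_on Dom (\<lambda>p. D2 p a b)"
  unfolding D2_def by (intro smooth_on_dd smooth_G)

lemma smooth_levi: "smooth_on Dom (\<lambda>p. levi p a b)"
proof -
  have "smooth_on Dom (\<lambda>p. of_real ((D2 p a b + D2 p (\<i> *s a) (\<i> *s b)) * (1/4)) +
      \<i> * of_real ((D2 p a (\<i> *s b) - D2 p (\<i> *s a) b) * (1/4)))"
    by (intro smooth_on_add smooth_on_mult smooth_on_diff smooth_on_const smooth_D2
        smooth_on_compose_linear[OF bounded_linear_of_real] open_Dom)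
  moreover have "levi p a b = of_real ((D2 p a b + D2 p (\<i> *s a) (\<i> *s b)) * (1/4)) +
      \<i> * of_real ((D2 p a (\<i> *s b) - D2 p (\<i> *s a) b) * (1/4))" for p
    by (simp add: levi_def complex_eq_iff)
  ultimately show ?thesis by simp
qed

lemma smooth_Hm: "smooth_on Dom Hm"
  unfolding Hm_def[abs_def] by (intro smooth_on_vec_lambda smooth_levi open_Dom)

text \<open>\<open>G\<close> has degree 2 in the fibre variable, and two differentiations in fibre
  directions lower the degree to 0.\<close>

lemma Hm_scaleR:
  assumes x: "x \<in> Om" "v \<noteq> 0" and r: "r > 0"
  shows "Hm (x, r *\<^sub>R v) = Hm (x, v)"
proof -
  define S where "S p = (fst p, r *\<^sub>R snd p)" for p :: "(complex^'n) \<times> (complex^'n)"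
  have Sd: "(S has_derivative S) (at p)" for p
    unfolding S_def[abs_def] by (auto intro!: derivative_eq_intros)
  have SD: "S p \<in> Dom" if "p \<in> Dom" for p using that r by (auto simp: S_def)
  have step: "dd g (S W) (S p) = c * dd h W p"
    if gh: "smooth_on Dom g" "smooth_on Dom h" and eq: "\<And>q. q \<in> Dom \<Longrightarrow> g (S q) = c * h q" and p: "p \<in> Dom"
    for g h :: "_ \<Rightarrow> real" and c W p
  proof -
    have "((\<lambda>q. g (S q)) has_derivative (\<lambda>W. dd g (S W) (S p))) (at p)"
      by (rule has_derivative_compose[OF Sd smooth_on_has_derivative[OF gh(1) open_Dom SD[OF p]]])
    moreover have "((\<lambda>q. g (S q)) has_derivative (\<lambda>W. c * dd h W p)) (at p)"
      by (rule has_derivative_transform_within_open[OF has_derivative_mult_right[OF smooth_on_has_derivative[OF gh(2) open_Dom p]] open_Dom p])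
        (simp add: eq)
    ultimately show ?thesis by (metis has_derivative_unique)
  qed
  have "G (S q) = r\<^sup>2 * G q" if "q \<in> Dom" for q
    using that r by (auto simp: S_def G_def f_scaleR power_mult_distrib)
  note 1 = this
  have 2: "dd G (S W) (S q) = r\<^sup>2 * dd G W q" if q: "q \<in> Dom" for q W
    by (rule step[OF smooth_G smooth_G _ q]) (rule 1)
  \<comment> \<open>The directions are scaled along with the point, so the factor
    \<open>r\<^sup>2\<close> survives both differentiations; bilinearity of the Hessian cancels it
    afterwards.\<close>
  have "dd (dd G (S (0, b))) (S (0, a)) (S p) = r\<^sup>2 * dd (dd G (0, b)) (0, a) p" if p: "p \<in> Dom" for p a b
    by (rule step[OF smooth_on_dd[OF smooth_G] smooth_on_dd[OF smooth_G] _ p]) (rule 2)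
  then have "D2 (S p) (r *\<^sub>R a) (r *\<^sub>R b) = r\<^sup>2 * D2 p a b" if "p \<in> Dom" for p a b
    using that by (simp add: D2_def S_def)
  moreover have "D2 (S p) (r *\<^sub>R a) (r *\<^sub>R b) = r\<^sup>2 * D2 (S p) a b" if "p \<in> Dom" for p a b
    using SD[OF that] by (simp add: D2_scaleR D2_scaleR_right power2_eq_square)
  ultimately have "r\<^sup>2 * D2 (S p) a b = r\<^sup>2 * D2 p a b" if "p \<in> Dom" for p a b
    using that by metis
  then have "D2 (S p) a b = D2 p a b" if "p \<in> Dom" for p a b
    using that r by (metis mult_left_cancel power_not_zero less_irrefl)
  from this[of "(x, v)"] x show ?thesis by (simp add: Hm_def levi_def S_def)
qed

section \<open>Euler's identities and their derivatives\<close>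

lemma euler:
  assumes p: "(x, v) \<in> Dom"
  shows "dd G (0, v) (x, v) = 2 * G (x, v)" "dd G (0, \<i> *s v) (x, v) = 0"
proof -
  have c: "((\<lambda>t. G (x, v + t *\<^sub>R w)) has_vector_derivative dd G (0, w) (x, v)) (at 0)" for w
  proof -
    have "((\<lambda>t. (x, v + t *\<^sub>R w)) has_vector_derivative (0, w)) (at 0)"
      by (intro has_vector_derivative_Pair) (auto intro!: derivative_eq_intros)
    then show ?thesis
      using has_vector_derivative_dd[OF smooth_G open_Dom, of "\<lambda>t. (x, v + t *\<^sub>R w)" 0 "(0, w)"] p by simp
  qed
  have x: "x \<in> Om" using p by simp
  \<comment> \<open>Real dilation gives the first identity, since the squared modulus of 1 + t has
    derivative 2 at 0.\<close>
  have "f (x, v + t *\<^sub>R v) = cmod (1 + of_real t) * f (x, v)" for t :: real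
  proof -
    have "(1 + of_real t) *s v = v + t *\<^sub>R v" by (simp add: vec_eq_iff complex_eq_iff algebra_simps)
    then show ?thesis using f_scale[OF x, of "1 + of_real t" v] by simp
  qed
  then have "G (x, v + t *\<^sub>R v) = (1 + t)\<^sup>2 * G (x, v)" for t :: real
    by (simp add: G_def power_mult_distrib cmod_power2)
  moreover have "((\<lambda>t. (1 + t)\<^sup>2 * G (x, v)) has_vector_derivative 2 * G (x, v)) (at 0)"
    unfolding has_real_derivative_iff_has_vector_derivative[symmetric] by (auto intro!: derivative_eq_intros)
  ultimately show "dd G (0, v) (x, v) = 2 * G (x, v)" using vector_derivative_unique_at[OF c[of v]] by simp
  \<comment> \<open>Multiplication by 1 + i t has squared modulus 1 + t^2, which is stationary at 0;
    this replaces the circle action.\<close>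
  have "f (x, v + t *\<^sub>R (\<i> *s v)) = cmod (1 + of_real t * \<i>) * f (x, v)" for t :: real
  proof -
    have "(1 + of_real t * \<i>) *s v = v + t *\<^sub>R (\<i> *s v)" by (simp add: vec_eq_iff complex_eq_iff algebra_simps)
    then show ?thesis using f_scale[OF x, of "1 + of_real t * \<i>" v] by simp
  qed
  then have "G (x, v + t *\<^sub>R (\<i> *s v)) = (1 + t\<^sup>2) * G (x, v)" for t :: real
    by (simp add: G_def power_mult_distrib cmod_power2)
  moreover have "((\<lambda>t. (1 + t\<^sup>2) * G (x, v)) has_vector_derivative 0) (at 0)"
    unfolding has_real_derivative_iff_has_vector_derivative[symmetric] by (auto intro!: derivative_eq_intros)
  ultimately show "dd G (0, \<i> *s v) (x, v) = 0" using vector_derivative_unique_at[OF c[of "\<i> *s v"]] by simp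
qed

text \<open>Euler's identities are differentiated once more in the direction \<open>(0, w)\<close>.
  Their direction moves with the point, and this yields the additional first-order term.\<close>

lemma D2_radial:
  assumes p: "(x, v) \<in> Dom"
  shows "D2 (x, v) w v = dd G (0, w) (x, v)" "D2 (x, v) w (\<i> *s v) = - dd G (0, \<i> *s w) (x, v)"
proof -
  let ?p = "(x, v)"
  have L1: "bounded_linear (\<lambda>q :: (complex^'n) \<times> (complex^'n). (0 :: complex^'n, snd q))"
    by (intro bounded_linear_Pair bounded_linear_zero bounded_linear_snd)
  have L2: "bounded_linear (\<lambda>q :: (complex^'n) \<times> (complex^'n). (0 :: complex^'n, \<i> *s snd q))"
    unfolding linear_conv_bounded_linear[symmetric]
    by (rule linearI) (simp_all add: vector_add_ldistrib)
  have "dd (\<lambda>q. dd G (0, snd q) q) (0, w) ?p = 2 * dd G (0, w) ?p"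
  proof (rule dd_eqI[OF has_derivative_transform_within_open[OF _ open_Dom p]])
    show "((\<lambda>q. 2 * G q) has_derivative (\<lambda>W. 2 * dd G W ?p)) (at ?p)"
      by (intro has_derivative_mult_right smooth_on_has_derivative[OF smooth_G open_Dom p])
    show "2 * G q = dd G (0, snd q) q" if "q \<in> Dom" for q using euler(1)[of "fst q" "snd q"] that by simp
  qed
  then show "D2 ?p w v = dd G (0, w) ?p"
    unfolding dd_dd_apply[OF smooth_G open_Dom p L1] by (simp add: D2_def)
  have "dd (\<lambda>q. dd G (0, \<i> *s snd q) q) (0, w) ?p = 0"
  proof (rule dd_eqI[OF has_derivative_transform_within_open[OF has_derivative_const open_Dom p]])
    show "0 = dd G (0, \<i> *s snd q) q" if "q \<in> Dom" for q using euler(2)[of "fst q" "snd q"] that by simp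
  qed
  then show "D2 ?p w (\<i> *s v) = - dd G (0, \<i> *s w) ?p"
    unfolding dd_dd_apply[OF smooth_G open_Dom p L2] by (simp add: D2_def)
qed

text \<open>Up to normalisation this is the holomorphic derivative of \<open>G\<close> along
  \<open>w\<close>. Orthogonality to \<open>v\<close> therefore means that the differential of
  \<open>G\<close> vanishes on both \<open>w\<close> and \<open>\<i> *s w\<close>.\<close>

lemma levi_radial:
  assumes p: "(x, v) \<in> Dom"
  shows "levi (x, v) w v = Complex (dd G (0, w) (x, v) / 2) (- dd G (0, \<i> *s w) (x, v) / 2)"
proof -
  have "dd G (0, - w) (x, v) = - dd G (0, w) (x, v)"
    using linear_neg[OF dd_linear[OF smooth_G open_Dom p], of "(0, w)"] by simp
  then show ?thesis by (simp add: levi_def D2_radial[OF p])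
qed

lemma levi_self: "(x, v) \<in> Dom \<Longrightarrow> levi (x, v) v v = of_real (G (x, v))"
  unfolding levi_radial by (simp add: levi_radial euler complex_eq_iff)

lemma levi_radial_left:
  assumes p: "(x, v) \<in> Dom"
  shows "levi (x, v) v w = of_real (dd G (0, w) (x, v) / 2) + \<i> * of_real (dd G (0, \<i> *s w) (x, v) / 2)"
  using levi_radial[OF p, of w] cnj_levi[OF p, of w v] by (simp add: complex_eq_iff)

text \<open>Differentiate \<open>\<Sum>\<^sub>j H\<^sub>i\<^sub>j v\<^sub>j = \<partial>G / \<partial>v\<^sub>i\<close> (a conjugate derivative) in the direction \<open>b\<close> and compare
  with the definition of \<open>H\<close>.\<close>

lemma Hm_radial:
  assumes p: "(x, v) \<in> Dom"
  shows "(\<Sum>j\<in>UNIV. dz I_pair (\<lambda>p. Hm p $ i $ j) (0, b) (x, v) * v $ j) = 0"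
proof -
  let ?p = "(x, v)" and ?e = "axis i 1 :: complex^'n"
  define R where "R w = (\<Sum>j\<in>UNIV. dd (\<lambda>p. Hm p $ i $ j) (0, w) ?p * v $ j)" for w
  have R: "R w = of_real (D2 ?p w ?e / 2) + \<i> * of_real (D2 ?p w (\<i> *s ?e) / 2) - levi ?p w ?e" for w
  proof -
    have Hd: "((\<lambda>p. Hm p $ i $ j) has_derivative (\<lambda>W. dd (\<lambda>p. Hm p $ i $ j) W ?p)) (at ?p)" for j
      by (rule smooth_on_has_derivative[OF _ open_Dom p]) (intro smooth_on_vec_nth smooth_Hm open_Dom)
    have nd: "((\<lambda>p. snd p $ j) has_derivative (\<lambda>W. snd W $ j)) (at ?p)" for j
      by (intro bounded_linear.has_derivative[OF bounded_linear_vec_nth] has_derivative_snd has_derivative_ident)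
    have "((\<lambda>p. \<Sum>j\<in>UNIV. Hm p $ i $ j * snd p $ j) has_derivative
        (\<lambda>W. \<Sum>j\<in>UNIV. Hm ?p $ i $ j * snd W $ j + dd (\<lambda>p. Hm p $ i $ j) W ?p * snd ?p $ j)) (at ?p)"
      by (intro has_derivative_sum has_derivative_mult Hd nd)
    from dd_eqI[OF this, of "(0, w)"]
    have 1: "dd (\<lambda>p. \<Sum>j\<in>UNIV. Hm p $ i $ j * snd p $ j) (0, w) ?p = levi ?p w ?e + R w"
      by (simp add: sum.distrib R_def levi_hform[OF p] hform_matrix_vector axis_def matrix_vector_mult_def if_distrib cong: if_cong)
    have G': "(dd G a has_derivative (\<lambda>W. dd (dd G a) W ?p)) (at ?p)" for a
      by (rule smooth_on_has_derivative[OF smooth_on_dd[OF smooth_G] open_Dom p])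
    have "((\<lambda>p. of_real (dd G (0, ?e) p / 2) + \<i> * of_real (dd G (0, \<i> *s ?e) p / 2)) has_derivative
       (\<lambda>W. of_real (dd (dd G (0, ?e)) W ?p / 2) + \<i> * of_real (dd (dd G (0, \<i> *s ?e)) W ?p / 2))) (at ?p)"
      by (intro has_derivative_add has_derivative_mult_right bounded_linear.has_derivative[OF bounded_linear_of_real]
          bounded_linear.has_derivative[OF bounded_linear_divide] G')
    moreover have "of_real (dd G (0, ?e) q / 2) + \<i> * of_real (dd G (0, \<i> *s ?e) q / 2) = (\<Sum>j\<in>UNIV. Hm q $ i $ j * snd q $ j)"
      if "q \<in> Dom" for q
    proof -
      have q: "(fst q, snd q) \<in> Dom" using that by simp
      have "(\<Sum>j\<in>UNIV. Hm q $ i $ j * snd q $ j) = levi q (snd q) ?e"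
        by (simp add: levi_hform[OF that] hform_matrix_vector axis_def matrix_vector_mult_def if_distrib cong: if_cong)
      then show ?thesis using levi_radial_left[OF q, of ?e] by simp
    qed
    ultimately have "((\<lambda>p. \<Sum>j\<in>UNIV. Hm p $ i $ j * snd p $ j) has_derivative
       (\<lambda>W. of_real (dd (dd G (0, ?e)) W ?p / 2) + \<i> * of_real (dd (dd G (0, \<i> *s ?e)) W ?p / 2))) (at ?p)"
      by (rule has_derivative_transform_within_open[OF _ open_Dom p])
    from dd_eqI[OF this, of "(0, w)"] 1 show ?thesis by (simp add: D2_def algebra_simps)
  qed
  have "(\<Sum>j\<in>UNIV. dz I_pair (\<lambda>p. Hm p $ i $ j) (0, b) (x, v) * v $ j) = (R b - \<i> * R (\<i> *s b)) / 2"
    by (simp add: dz_def I_pair_def R_def sum_divide_distrib[symmetric] sum_subtractf sum_distrib_left algebra_simps)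
  \<comment> \<open>In the formula for \<open>R\<close>, \<open>levi\<close> is the complex linear
    part in \<open>w\<close> of the two terms before it. What remains is antilinear, so
    \<open>R (\<i> *s b)\<close> is \<open>- \<i> * R b\<close> and the two summands cancel.\<close>
  also have "\<dots> = 0"
    unfolding R levi_i[OF p] by (simp add: levi_def complex_eq_iff field_simps)
  finally show ?thesis .
qed

end

section \<open>Strong pseudoconvexity in coordinates\<close>

locale finsler_chart = finsler_chart_pre Om f
  for Om :: "(complex^'n) set" and f +
  assumes pseudoconvex: "x \<in> Om \<Longrightarrow> f (x, v) = 1 \<Longrightarrow> dd f (0, a) (x, v) = 0 \<Longrightarrow> dd f (0, \<i> *s a) (x, v) = 0 \<Longrightarrow> a \<noteq> 0 \<Longrightarrow>
    0 < Re (levi (x, v) a a)"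
begin

text \<open>Pseudoconvexity concerns the complex tangent space of the indicatrix only. By Euler's
  identities \<open>v\<close> has length 1 and is orthogonal to exactly that space, so the splitting
  of \<open>w\<close> into a multiple of \<open>v\<close> and a complex tangent vector is
  orthogonal.\<close>

lemma levi_pos_unit:
  assumes x: "x \<in> Om" and v: "f (x, v) = 1" and w: "w \<noteq> 0"
  shows "0 < Re (levi (x, v) w w)"
proof -
  have v0: "v \<noteq> 0" using f_zero[OF x] v by auto
  then have p: "(x, v) \<in> Dom" using x by simp
  note sc = levi_add[OF p] levi_scale[OF p]
  \<comment> \<open>As \<open>v\<close> has length 1, this is the coefficient of the orthogonal
    projection onto \<open>v\<close>.\<close>
  define c where "c = levi (x, v) w v"
  define a where "a = w - c *s v"
  have w_eq: "w = a + c *s v" by (simp add: a_def)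
  have vv: "levi (x, v) v v = 1" using levi_self[OF p] v by (simp add: G_def)
  have "c = levi (x, v) a v + c" unfolding c_def by (subst (1) w_eq) (simp add: sc vv c_def)
  then have av: "levi (x, v) a v = 0" by simp
  then have va: "levi (x, v) v a = 0" using cnj_levi[OF p, of a v] by simp
  have "dd G (0, a) (x, v) = 0" "dd G (0, \<i> *s a) (x, v) = 0"
    using av unfolding levi_radial[OF p] by (simp_all add: complex_eq_iff)
  then have da: "dd f (0, a) (x, v) = 0" "dd f (0, \<i> *s a) (x, v) = 0"
    using v by (simp_all add: dd_G[OF p])
  have right: "levi (x, v) b (a + c *s v) = levi (x, v) b a + cnj c * levi (x, v) b v" for b
  proof -
    have "cnj (levi (x, v) (a + c *s v) b) = cnj (levi (x, v) a b + c * levi (x, v) v b)" by (simp only: sc)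
    then show ?thesis by (simp add: cnj_levi[OF p])
  qed
  have "levi (x, v) w w = levi (x, v) a a + c * cnj c"
    unfolding w_eq right by (simp add: sc av va vv)
  then have "Re (levi (x, v) w w) = Re (levi (x, v) a a) + (cmod c)\<^sup>2"
    by (simp add: complex_mult_cnj cmod_power2)
  moreover have "0 < Re (levi (x, v) a a)" if "a \<noteq> 0" using pseudoconvex[OF x v da that] .
  moreover have "Re (levi (x, v) a a) + (cmod c)\<^sup>2 > 0" if "a = 0"
  proof -
    have "c \<noteq> 0" using w w_eq that by auto
    then show ?thesis using that levi_scaleR[OF p, of 0 0 0] by simp
  qed
  ultimately show ?thesis by (cases "a = 0") (auto intro: add_pos_nonneg)
qed

lemma levi_matrix: "levi_matrix Om Hm"
proof
  show "open Om" by (rule open_Om)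
  show "smooth_on (Om \<times> (- {0})) Hm" by (rule smooth_Hm)
next
  fix x v assume "x \<in> Om" "v \<noteq> (0 :: complex^'n)"
  then have p: "(x, v) \<in> Dom" by simp
  show "hermitian_matrix (Hm (x, v))" by (rule hermitian_Hm[OF p])
  show "(\<Sum>j\<in>UNIV. dz I_pair (\<lambda>p. Hm p $ i $ j) (0, b) (x, v) * v $ j) = 0" for i b by (rule Hm_radial[OF p])
next
  fix x v and r :: real assume "x \<in> Om" "v \<noteq> (0 :: complex^'n)" "r > 0"
  then show "Hm (x, r *\<^sub>R v) = Hm (x, v)" by (rule Hm_scaleR)
next
  fix x v w assume x: "x \<in> Om" "v \<noteq> (0 :: complex^'n)" "w \<noteq> (0 :: complex^'n)"
  \<comment> \<open>Positivity is known on the indicatrix; \<open>Hm\<close> is unchanged when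
    \<open>v\<close> is scaled onto it.\<close>
  let ?r = "inverse (f (x, v))"
  have r: "?r > 0" using f_pos[OF x(1,2)] by simp
  then have "f (x, ?r *\<^sub>R v) = 1" using f_scaleR[OF x(1), of ?r v] f_pos[OF x(1,2)] by simp
  then have "0 < Re (levi (x, ?r *\<^sub>R v) w w)" using levi_pos_unit[OF x(1) _ x(3)] by simp
  moreover have "(x, ?r *\<^sub>R v) \<in> Dom" using x r by simp
  ultimately show "0 < Re (hform (Hm (x, v)) w w)"
    using Hm_scaleR[OF x(1,2) r] levi_hform by simp
qed

end

section \<open>Unitary frames as orthonormal frames\<close>

context finsler_chart
begin

text \<open>The unit condition is the diagonal Gram entry at \<open>k0\<close>, by
  \<open>levi_self\<close>. By \<open>levi_radial\<close> the complex tangent space is the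
  orthogonal complement of \<open>B $ k0\<close>, so the span condition is the remainder of row and
  column \<open>k0\<close>. For the inclusion of that complement in the span, a vector is expanded
  in the frame and its coefficient at \<open>k0\<close> vanishes.\<close>

lemma orthonormal_frame_iff:
  assumes x: "x \<in> Om" and det: "det B \<noteq> 0"
  shows "(\<forall>j k. levi (x, B $ k0) (B $ j) (B $ k) = (if j = k then 1 else 0)) \<longleftrightarrow>
    f (x, B $ k0) = 1 \<and>
    span ((\<lambda>l. B $ l) ` (- {k0}) \<union> (\<lambda>l. \<i> *s B $ l) ` (- {k0})) =
      {w. dd f (0, w) (x, B $ k0) = 0 \<and> dd f (0, \<i> *s w) (x, B $ k0) = 0} \<and>
    (\<forall>l m. l \<noteq> k0 \<longrightarrow> m \<noteq> k0 \<longrightarrow> levi (x, B $ k0) (B $ l) (B $ m) = (if l = m then 1 else 0))"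
    (is "?L \<longleftrightarrow> ?f \<and> span ?S = ?D \<and> ?h")
proof -
  let ?v = "B $ k0"
  have v0: "?v \<noteq> 0" by (rule row_nonzero_of_det[OF det])
  then have p: "(x, ?v) \<in> Dom" using x by simp
  have vv: "levi (x, ?v) ?v ?v = of_real ((f (x, ?v))\<^sup>2)" using levi_self[OF p] by (simp add: G_def)
  have lin: "linear (\<lambda>W. dd f W (x, ?v))" by (rule dd_linear[OF smooth_f open_Dom p])
  have neg: "dd f (0, - w) (x, ?v) = - dd f (0, w) (x, ?v)" for w
    using linear_neg[OF lin, of "(0, w)"] by simp
  have D: "w \<in> ?D \<longleftrightarrow> levi (x, ?v) w ?v = 0" for w
    using f_pos[OF x v0] by (auto simp: levi_radial[OF p] dd_G[OF p] complex_eq_iff)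
  have sub: "subspace ?D"
    unfolding subspace_def mem_Collect_eq D[unfolded mem_Collect_eq]
    using levi_scaleR[OF p, of 0 0 ?v] by (auto simp: levi_add[OF p] levi_scaleR[OF p])
  have iD: "\<i> *s w \<in> ?D" if "w \<in> ?D" for w using that by (simp add: neg)
  show ?thesis
  proof
    assume L: ?L
    have "(f (x, ?v))\<^sup>2 = 1" using L vv by (metis of_real_eq_1_iff)
    then have f1: ?f using f_pos[OF x v0] by (simp add: power2_eq_1_iff)
    have "?S \<subseteq> ?D" using L iD by (auto simp: D[unfolded mem_Collect_eq] levi_i[OF p])
    then have "span ?S \<subseteq> ?D" using sub span_minimal by blast
    moreover have "?D \<subseteq> span ?S"
    proof
      fix w assume "w \<in> ?D"
      then have w: "levi (x, ?v) w ?v = 0" using D by blast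
      obtain z where z: "w = (\<Sum>j\<in>UNIV. z $ j *s B $ j)" using spanning_of_det[OF det] .
      have "levi (x, ?v) w ?v = (\<Sum>j\<in>UNIV. z $ j * levi (x, ?v) (B $ j) ?v)"
        unfolding z by (simp add: levi_sum[OF p] levi_scale[OF p])
      also have "\<dots> = (\<Sum>j\<in>UNIV. if j = k0 then z $ j else 0)" using L by (intro sum.cong) auto
      also have "\<dots> = z $ k0" by simp
      finally have "z $ k0 = 0" using w by simp
      \<comment> \<open>The span is real; a complex multiple of a frame vector is a real combination
        of the vector and its product with the imaginary unit.\<close>
      then have "z $ j *s B $ j \<in> span ?S" for j
      proof (cases "j = k0")
        case False
        then have "B $ j \<in> span ?S" "\<i> *s B $ j \<in> span ?S" by (auto intro!: span_base)
        then show ?thesis unfolding vec_scale_complex[of "z $ j"] by (intro span_add span_scale)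
      qed (auto intro: span_zero)
      then show "w \<in> span ?S" unfolding z by (intro span_sum)
    qed
    ultimately show "?f \<and> span ?S = ?D \<and> ?h" using f1 L by blast
  next
    assume R: "?f \<and> span ?S = ?D \<and> ?h"
    then have vv1: "levi (x, ?v) ?v ?v = 1" using vv by simp
    have l0: "levi (x, ?v) (B $ l) ?v = 0" if "l \<noteq> k0" for l
    proof -
      have "B $ l \<in> span ?S" using that by (intro span_base) auto
      then show ?thesis using R D by blast
    qed
    have l0': "levi (x, ?v) ?v (B $ l) = 0" if "l \<noteq> k0" for l
      using cnj_levi[OF p, of "B $ l" ?v] l0[OF that] by simp
    show ?L
    proof (intro allI)
      fix j k show "levi (x, ?v) (B $ j) (B $ k) = (if j = k then 1 else 0)"
        using vv1 l0 l0' R by (cases "j = k0"; cases "k = k0") auto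
    qed
  qed
qed

end

section \<open>Finsler metrics on manifolds in charts\<close>

lemma bounded_linear_I_vec: "bounded_linear (I_vec :: complex^'n \<Rightarrow> complex^'n)"
  unfolding linear_conv_bounded_linear[symmetric]
  by (rule linearI) (simp_all add: I_vec_def vector_add_ldistrib)

lemma complex_manifold_linear_atlas: "complex_manifold A \<Longrightarrow> linear_atlas I_vec A"
  unfolding complex_manifold_def linear_atlas_def using bounded_linear_I_vec by blast

lemma tv_cscale_mk_tvec:
  assumes A: "linear_atlas I_vec A" and c: "c \<in> A" "x \<in> fst c"
  shows "tv_cscale z (mk_tvec A c x v) = mk_tvec A c x (z *s v)"
  unfolding tv_cscale_def tv_J_mk_tvec[OF assms] tv_scale_mk_tvec[OF assms] tv_add_mk_tvec[OF assms]
  by (simp add: I_vec_def vec_scale_complex[of z v])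

lemma snd_tvec_change:
  assumes A: "linear_atlas I A" and c: "c \<in> A" "d \<in> A" "x \<in> fst c" "x \<in> fst d" and v: "v \<in> tspace A x"
  shows "snd v c = dd (coord_rep id d c) (snd v d) (snd d x)"
  using snd_mk_tvec_other[OF c(1,3), of d "snd v d"] mk_tvec_snd[OF A c(2,4) v] by simp

locale finsler_manifold =
  fixes A :: "('a, complex^'n) chart set" and F :: "('a, complex^'n) tvec \<Rightarrow> real" and k0 :: 'n
  assumes manifold: "complex_manifold A" and finsler: "complex_finsler A F"
    and pseudoconvex: "strongly_pseudoconvex A F"
begin

lemma atlas: "linear_atlas I_vec A"
  by (rule complex_manifold_linear_atlas[OF manifold])

section \<open>The metric and its Levi form in a chart\<close>

definition F_rep :: "('a, complex^'n) chart \<Rightarrow> (complex^'n) \<times> (complex^'n) \<Rightarrow> real" where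
  "F_rep c p = F (mk_tvec A c (chart_inv c (fst p)) (snd p))"

lemma F_rep_coord: "c \<in> A \<Longrightarrow> x \<in> fst c \<Longrightarrow> F_rep c (snd c x, v) = F (mk_tvec A c x v)"
  by (simp add: F_rep_def chart_inv_coord[OF atlas])

lemma mk_tvec_tbundle: "c \<in> A \<Longrightarrow> x \<in> fst c \<Longrightarrow> mk_tvec A c x v \<in> tbundle A"
  unfolding tbundle_def by (rule UN_I[where a = x]) (rule carrierI mk_tvec_in; assumption)+

lemma tbundleD: "v \<in> tbundle A \<Longrightarrow> v \<in> tspace A (fst v) \<and> fst v \<in> carrier_of A"
  unfolding tbundle_def by (auto dest: fst_tspace)

lemma mk_tvec_zero_iff: "c \<in> A \<Longrightarrow> x \<in> fst c \<Longrightarrow> mk_tvec A c x v = tv_zero x \<longleftrightarrow> v = 0"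
  using mk_tvec_eq_iff[OF atlas, of c x v 0] tv_zero_mk_tvec[OF atlas, of c x] by simp

text \<open>Smoothness is given in the charts of the tangent bundle. The one induced by
  \<open>c\<close> sends \<open>mk_tvec A c x v\<close> to \<open>(snd c x, v)\<close>, and the zero
  section corresponds to \<open>v = 0\<close>.\<close>

lemma smooth_F_rep:
  assumes c: "c \<in> A"
  shows "smooth_on (snd c ` fst c \<times> (- {0})) (F_rep c)"
proof -
  define C where "C = ({v \<in> tbundle A. fst v \<in> fst c}, \<lambda>v :: ('a, complex^'n) tvec. (snd c (fst v), snd v c))"
  define W where "W = {v \<in> tbundle A. v \<noteq> tv_zero (fst v)}"
  have CA: "C \<in> tangent_atlas A" using c unfolding tangent_atlas_def C_def by blast
  have sm: "smooth_on (snd C ` (W \<inter> fst C)) (F \<circ> chart_inv C)"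
    using finsler CA unfolding complex_finsler_def smooth_fun_def W_def by blast
  have coord: "snd C (mk_tvec A c x v) = (snd c x, v)" if "x \<in> fst c" for x v
    using snd_mk_tvec[OF atlas c that] by (simp add: C_def)
  have repr: "\<exists>x v. x \<in> fst c \<and> u = mk_tvec A c x v" if "u \<in> fst C" for u
    using that tbundleD[of u] mk_tvec_snd[OF atlas c, of "fst u" u] unfolding C_def by (metis (no_types, lifting) fst_conv mem_Collect_eq)
  have inj: "inj_on (snd C) (fst C)"
  proof (rule inj_onI)
    fix u w assume "u \<in> fst C" "w \<in> fst C" and e: "snd C u = snd C w"
    then obtain x v y z where "x \<in> fst c" "u = mk_tvec A c x v" "y \<in> fst c" "w = mk_tvec A c y z"
      using repr by meson
    then show "u = w" using e coord coord_inj[OF atlas c] by (auto dest: inj_onD)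
  qed
  have eq: "(F \<circ> chart_inv C) q = F_rep c q" if q: "q \<in> snd c ` fst c \<times> (- {0})" for q
  proof -
    obtain x where x: "x \<in> fst c" "q = (snd c x, snd q)" using q by (cases q) auto
    have "mk_tvec A c x (snd q) \<in> fst C" using x(1) mk_tvec_tbundle[OF c x(1)] by (simp add: C_def)
    then have "chart_inv C (snd c x, snd q) = mk_tvec A c x (snd q)"
      unfolding chart_inv_def by (rule inv_into_f_eq[OF inj]) (rule coord[OF x(1)])
    then show ?thesis using x F_rep_coord[OF c x(1)] by (metis comp_apply)
  qed
  have "snd C ` (W \<inter> fst C) = snd c ` fst c \<times> (- {0})"
  proof (intro set_eqI iffI)
    fix q assume "q \<in> snd C ` (W \<inter> fst C)"
    then obtain x v where "x \<in> fst c" "q = snd C (mk_tvec A c x v)" "mk_tvec A c x v \<in> W" using repr by blast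
    then show "q \<in> snd c ` fst c \<times> (- {0})" using mk_tvec_zero_iff[OF c, of x v] coord by (auto simp: W_def)
  next
    fix q assume "q \<in> snd c ` fst c \<times> (- {0 :: complex^'n})"
    then obtain x v where xv: "x \<in> fst c" "v \<noteq> 0" "q = (snd c x, v)" by auto
    then have "mk_tvec A c x v \<in> W \<inter> fst C"
      using mk_tvec_tbundle[OF c xv(1)] mk_tvec_zero_iff[OF c xv(1), of v] by (auto simp: W_def C_def)
    then show "q \<in> snd C ` (W \<inter> fst C)" using coord[OF xv(1)] xv(3) by (metis imageI)
  qed
  moreover have "open (snd c ` fst c \<times> (- {0 :: complex^'n}))"
    by (intro open_Times open_coord_image[OF atlas c]) auto
  ultimately show ?thesis using sm smooth_on_cong[of "snd c ` fst c \<times> (- {0})" "F \<circ> chart_inv C" "F_rep c"] eq by simp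
qed

lemma finsler_chart_pre:
  assumes c: "c \<in> A"
  shows "finsler_chart_pre (snd c ` fst c) (F_rep c)"
proof
  show "open (snd c ` fst c)" by (rule open_coord_image[OF atlas c])
  show "smooth_on (snd c ` fst c \<times> (- {0})) (F_rep c)" by (rule smooth_F_rep[OF c])
next
  fix q v assume q: "q \<in> snd c ` fst c" and v: "v \<noteq> (0 :: complex^'n)"
  then obtain x where x: "x \<in> fst c" "q = snd c x" by auto
  have "mk_tvec A c x v \<noteq> tv_zero (fst (mk_tvec A c x v))" using mk_tvec_zero_iff[OF c x(1)] v by simp
  then have "0 < F (mk_tvec A c x v)"
    using finsler mk_tvec_tbundle[OF c x(1), of v] unfolding complex_finsler_def by blast
  then show "0 < F_rep c (q, v)" using F_rep_coord[OF c x(1)] x(2) by simp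
next
  fix q v z assume q: "q \<in> snd c ` fst c"
  then obtain x where x: "x \<in> fst c" "q = snd c x" by auto
  have "F (tv_cscale z (mk_tvec A c x v)) = cmod z * F (mk_tvec A c x v)"
    using finsler mk_tvec_tbundle[OF c x(1), of v] unfolding complex_finsler_def by blast
  then show "F_rep c (q, z *s v) = cmod z * F_rep c (q, v)"
    unfolding tv_cscale_mk_tvec[OF atlas c x(1)] x(2) F_rep_coord[OF c x(1)] .
qed

abbreviation "D2_rep c \<equiv> finsler_chart_pre.D2 (F_rep c)"

text \<open>The form is complex bilinear in the complexified vectors, and the pairs stand for a1 + i
  a2 and b1 + i b2; hence the sign pattern of a product of complex numbers.\<close>

lemma finsler_h_mk_tvec:
  assumes c: "c \<in> A" "x \<in> fst c" and v: "v \<noteq> 0"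
  shows "finsler_h F (mk_tvec A c x v) (mk_tvec A c x a1, mk_tvec A c x a2) (mk_tvec A c x b1, mk_tvec A c x b2) =
    Complex (D2_rep c (snd c x, v) a1 b1 - D2_rep c (snd c x, v) a2 b2)
      (D2_rep c (snd c x, v) a1 b2 + D2_rep c (snd c x, v) a2 b1)"
proof -
  interpret f: finsler_chart_pre "snd c ` fst c" "F_rep c" by (rule finsler_chart_pre[OF c(1)])
  have in_Dom: "(snd c x, w) \<in> f.Dom" if "w \<noteq> 0" for w using c that by auto
  have line: "tv_add (mk_tvec A c x w) (tv_scale t (mk_tvec A c x a)) = mk_tvec A c x (w + t *\<^sub>R a)" for w a t
    by (simp add: tv_scale_mk_tvec[OF atlas c] tv_add_mk_tvec[OF atlas c])
  \<comment> \<open>Needed for both differentiations: first for the squared metric, with imaginary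
    part 0, then for its derivative along a complex field. Real and imaginary part are kept apart
    because the calculus is applied to real functions.\<close>
  have dir: "dir_deriv g (mk_tvec A c x a) (mk_tvec A c x w) = \<i> * of_real (dd g2 (0, a) (snd c x, w)) + of_real (dd g1 (0, a) (snd c x, w))"
    if w: "w \<noteq> 0" and g: "\<And>w. w \<noteq> 0 \<Longrightarrow> g (mk_tvec A c x w) = \<i> * of_real (g2 (snd c x, w)) + of_real (g1 (snd c x, w))"
      and sm: "smooth_on f.Dom g1" "smooth_on f.Dom g2" for g g1 g2 a w
  proof -
    have l: "((\<lambda>t. (snd c x, w + t *\<^sub>R a)) has_vector_derivative (0, a)) (at 0)"
      by (intro has_vector_derivative_Pair) (auto intro!: derivative_eq_intros)
    have d: "((\<lambda>t. h (snd c x, w + t *\<^sub>R a)) has_vector_derivative dd h (0, a) (snd c x, w)) (at 0)" if "smooth_on f.Dom h" for h :: "_ \<Rightarrow> real"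
      using has_vector_derivative_dd[OF that f.open_Dom, of "\<lambda>t. (snd c x, w + t *\<^sub>R a)" 0 "(0, a)"] in_Dom[OF w] l by simp
    have "((\<lambda>t. \<i> * of_real (g2 (snd c x, w + t *\<^sub>R a)) + of_real (g1 (snd c x, w + t *\<^sub>R a))) has_vector_derivative
        \<i> * of_real (dd g2 (0, a) (snd c x, w)) + of_real (dd g1 (0, a) (snd c x, w))) (at 0)"
      by (intro has_vector_derivative_add has_vector_derivative_mult_right
          bounded_linear.has_vector_derivative[OF bounded_linear_of_real] d sm)
    moreover have "open ((\<lambda>t. w + t *\<^sub>R a) -` (- {0}))"
      by (intro open_vimage continuous_intros)
    ultimately have "((\<lambda>t. g (mk_tvec A c x (w + t *\<^sub>R a))) has_vector_derivative
        \<i> * of_real (dd g2 (0, a) (snd c x, w)) + of_real (dd g1 (0, a) (snd c x, w))) (at 0)"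
      by (rule has_vector_derivative_transform_within_open) (use w g in auto)
    then show ?thesis unfolding dir_deriv_def line by (rule vector_derivative_at)
  qed
  let ?z = "(mk_tvec A c x b1, mk_tvec A c x b2)" and ?g = "\<lambda>v'. complex_of_real ((F v')\<^sup>2)"
  have g: "?g (mk_tvec A c x w) = \<i> * of_real ((\<lambda>_. 0) (snd c x, w)) + of_real (f.G (snd c x, w))" for w
    by (simp add: f.G_def F_rep_coord[OF c])
  have "dir_deriv ?g (mk_tvec A c x a) (mk_tvec A c x w) = of_real (dd f.G (0, a) (snd c x, w))" if "w \<noteq> 0" for a w
    using dir[where g = ?g and ?g1.0 = f.G and ?g2.0 = "\<lambda>_. 0", OF that g f.smooth_G smooth_on_const[OF f.open_Dom]] by simp
  then have 1: "const_field ?z ?g (mk_tvec A c x w) =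
      \<i> * of_real (dd f.G (0, b2) (snd c x, w)) + of_real (dd f.G (0, b1) (snd c x, w))" if "w \<noteq> 0" for w
    using that by (simp add: const_field_def)
  have "dir_deriv (const_field ?z ?g) (mk_tvec A c x a) (mk_tvec A c x v) =
      \<i> * of_real (f.D2 (snd c x, v) a b2) + of_real (f.D2 (snd c x, v) a b1)" for a
    unfolding f.D2_def by (rule dir[OF v 1 smooth_on_dd[OF f.smooth_G] smooth_on_dd[OF f.smooth_G]])
  then show ?thesis
    unfolding finsler_h_def by (simp add: const_field_def[of "(mk_tvec A c x a1, mk_tvec A c x a2)"] complex_eq_iff)
qed

section \<open>The indicatrix and its complex tangent spaces\<close>

lemma indicatrix_tspace_iff:
  assumes c: "c \<in> A" "x \<in> fst c" and v: "F (mk_tvec A c x v) = 1"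
  shows "mk_tvec A c x w \<in> indicatrix_tspace A F (mk_tvec A c x v) \<longleftrightarrow> dd (F_rep c) (0, w) (snd c x, v) = 0"
proof -
  interpret f: finsler_chart_pre "snd c ` fst c" "F_rep c" by (rule finsler_chart_pre[OF c(1)])
  have xO: "snd c x \<in> snd c ` fst c" using c by simp
  have v1: "F_rep c (snd c x, v) = 1" using v F_rep_coord[OF c] by simp
  then have v0: "v \<noteq> 0" using f.f_zero[OF xO] by auto
  then have p: "(snd c x, v) \<in> f.Dom" using xO by simp
  show ?thesis
  proof
    assume "mk_tvec A c x w \<in> indicatrix_tspace A F (mk_tvec A c x v)"
    then obtain d \<gamma> e where d: "d \<in> A" "x \<in> fst d" and e: "e > 0"
      and g: "\<gamma> ` {-e<..<e} \<subseteq> indicatrix A F x" "\<gamma> 0 = mk_tvec A c x v"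
        "((\<lambda>t. snd (\<gamma> t) d) has_vector_derivative snd (mk_tvec A c x w) d) (at 0)"
      unfolding indicatrix_tspace_def by auto
    have ts: "\<gamma> t \<in> tspace A x" "F (\<gamma> t) = 1" if "t \<in> {-e<..<e}" for t
    proof -
      have "\<gamma> t \<in> indicatrix A F x" using g(1) that by blast
      then show "\<gamma> t \<in> tspace A x" "F (\<gamma> t) = 1" unfolding indicatrix_def by auto
    qed
    have "bounded_linear (\<lambda>w. dd (coord_rep id d c) w (snd d x))"
      unfolding linear_conv_bounded_linear[symmetric]
      using dd_coord_rep_linear[OF atlas_holo_id[OF atlas] d(1) c(1) d(2)] c(2) by simp
    from bounded_linear.has_vector_derivative[OF this g(3)]
    have "((\<lambda>t. dd (coord_rep id d c) (snd (\<gamma> t) d) (snd d x)) has_vector_derivative w) (at 0)"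
      using snd_tvec_change[OF atlas c(1) d(1) c(2) d(2) mk_tvec_in[OF c], of w] by (simp add: snd_mk_tvec[OF atlas c])
    then have "((\<lambda>t. snd (\<gamma> t) c) has_vector_derivative w) (at 0)"
    proof (rule has_vector_derivative_transform_within_open[where S = "{-e<..<e}"])
      show "dd (coord_rep id d c) (snd (\<gamma> t) d) (snd d x) = snd (\<gamma> t) c" if "t \<in> {-e<..<e}" for t
        using snd_tvec_change[OF atlas c(1) d(1) c(2) d(2) ts(1)[OF that]] by simp
    qed (use e in auto)
    then have "((\<lambda>t. (snd c x, snd (\<gamma> t) c)) has_vector_derivative (0, w)) (at 0)"
      by (intro has_vector_derivative_Pair has_vector_derivative_const)
    from has_vector_derivative_dd[OF f.smooth_f f.open_Dom _ this]
    have "((\<lambda>t. F_rep c (snd c x, snd (\<gamma> t) c)) has_vector_derivative dd (F_rep c) (0, w) (snd c x, v)) (at 0)"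
      using p unfolding g(2) snd_mk_tvec[OF atlas c] by simp
    moreover have "((\<lambda>t. F_rep c (snd c x, snd (\<gamma> t) c)) has_vector_derivative 0) (at 0)"
    proof (rule has_vector_derivative_transform_within_open[where S = "{-e<..<e}"])
      show "((\<lambda>t. 1) has_vector_derivative 0) (at (0::real))" by simp
      show "1 = F_rep c (snd c x, snd (\<gamma> t) c)" if "t \<in> {-e<..<e}" for t
        using ts[OF that] mk_tvec_snd[OF atlas c ts(1)[OF that]] F_rep_coord[OF c] by simp
    qed (use e in auto)
    ultimately show "dd (F_rep c) (0, w) (snd c x, v) = 0" by (rule vector_derivative_unique_at)
  next
    assume w: "dd (F_rep c) (0, w) (snd c x, v) = 0"
    define b where "b t = v + t *\<^sub>R w" for t
    have bs: "smooth_on S b" if "open S" for S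
      unfolding b_def[abs_def] by (intro smooth_on_add smooth_on_const smooth_on_scaleR smooth_on_id that)
    have bv: "(b has_vector_derivative w) (at 0)"
      unfolding b_def[abs_def] by (auto intro!: derivative_eq_intros)
    have "open (b -` (- {0}))" unfolding b_def[abs_def] by (intro open_vimage continuous_intros)
    moreover have "0 \<in> b -` (- {0})" using v0 by (simp add: b_def)
    ultimately obtain e where e: "e > 0" "ball 0 e \<subseteq> b -` (- {0})" by (meson openE)
    have bne: "b t \<noteq> 0" if "t \<in> {-e<..<e}" for t
      using e(2) that by (auto simp: subset_iff dist_real_def abs_less_iff)
    define \<phi> where "\<phi> t = F_rep c (snd c x, b t)" for t
    have \<phi>pos: "\<phi> t > 0" if "t \<in> {-e<..<e}" for t
      unfolding \<phi>_def by (rule f.f_pos[OF xO bne[OF that]])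
    have \<phi>s: "smooth_on {-e<..<e} \<phi>"
      unfolding \<phi>_def[abs_def]
      by (rule smooth_on_compose[OF _ f.open_Dom f.smooth_f smooth_on_Pair[OF _ smooth_on_const bs]]) (use xO bne in auto)
    \<comment> \<open>Dividing by the metric puts the straight line on the indicatrix. Since
      \<open>\<phi>\<close> has value 1 and derivative 0 at 0, the velocity is still
      \<open>w\<close>.\<close>
    define \<gamma> where "\<gamma> t = mk_tvec A c x (inverse (\<phi> t) *\<^sub>R b t)" for t
    have "((\<lambda>t. (snd c x, b t)) has_vector_derivative (0, w)) (at 0)"
      by (intro has_vector_derivative_Pair has_vector_derivative_const bv)
    from has_vector_derivative_dd[OF f.smooth_f f.open_Dom _ this]
    have "(\<phi> has_vector_derivative 0) (at 0)"
      using p w unfolding \<phi>_def[abs_def] by (simp add: b_def)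
    then have \<phi>v: "(\<phi> has_real_derivative 0) (at 0)" unfolding has_real_derivative_iff_has_vector_derivative .
    have \<phi>0: "\<phi> 0 = 1" using v1 by (simp add: \<phi>_def b_def)
    have "((\<lambda>t. inverse (\<phi> t)) has_real_derivative 0) (at 0)"
      using \<phi>0 by (auto intro!: derivative_eq_intros \<phi>v)
    then have "((\<lambda>t. inverse (\<phi> t) *\<^sub>R b t) has_vector_derivative inverse (\<phi> 0) *\<^sub>R w + 0 *\<^sub>R b 0) (at 0)"
      by (intro has_vector_derivative_scaleR bv)
    then have gd: "((\<lambda>t. snd (\<gamma> t) c) has_vector_derivative snd (mk_tvec A c x w) c) (at 0)"
      by (simp add: \<gamma>_def snd_mk_tvec[OF atlas c] \<phi>0)
    have gs: "smooth_on {-e<..<e} (\<lambda>t. snd (\<gamma> t) c)"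
      unfolding \<gamma>_def snd_mk_tvec[OF atlas c]
      by (intro smooth_on_scaleR smooth_on_inverse \<phi>s bs) (use \<phi>pos in force)+
    have "F (\<gamma> t) = 1" if "t \<in> {-e<..<e}" for t
      using f.f_scaleR[OF xO, of "inverse (\<phi> t)" "b t"] \<phi>pos[OF that] F_rep_coord[OF c]
      by (simp add: \<gamma>_def \<phi>_def)
    then have "\<gamma> ` {-e<..<e} \<subseteq> indicatrix A F x"
      unfolding indicatrix_def using mk_tvec_in[OF c] by (auto simp: \<gamma>_def)
    moreover have "\<gamma> 0 = mk_tvec A c x v" by (simp add: \<gamma>_def \<phi>0 b_def)
    ultimately show "mk_tvec A c x w \<in> indicatrix_tspace A F (mk_tvec A c x v)"
      unfolding indicatrix_tspace_def using mk_tvec_in[OF c] e(1) gs gd c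
      by (intro CollectI conjI bexI[of _ c] exI[of _ \<gamma>] exI[of _ e]) auto
  qed
qed

text \<open>A complex subspace of the kernel of the differential consists of vectors that lie there
  together with their products with the imaginary unit. All such vectors form a complex subspace, so
  the union over all complex subspaces is attained.\<close>

lemma D_space_mk_tvec:
  assumes c: "c \<in> A" "x \<in> fst c" and v: "F (mk_tvec A c x v) = 1"
  shows "D_space A F (mk_tvec A c x v) = mk_tvec A c x ` 
    {w. dd (F_rep c) (0, w) (snd c x, v) = 0 \<and> dd (F_rep c) (0, \<i> *s w) (snd c x, v) = 0}" (is "?L = mk_tvec A c x ` ?D")
proof -
  interpret f: finsler_chart_pre "snd c ` fst c" "F_rep c" by (rule finsler_chart_pre[OF c(1)])
  have xO: "snd c x \<in> snd c ` fst c" using c by simp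
  have "v \<noteq> 0" using f.f_zero[OF xO] v F_rep_coord[OF c, of v] by auto
  then have p: "(snd c x, v) \<in> f.Dom" using xO by simp
  note l = dd_linear[OF f.smooth_f f.open_Dom p]
  have a: "dd (F_rep c) (0, w + z) (snd c x, v) = dd (F_rep c) (0, w) (snd c x, v) + dd (F_rep c) (0, z) (snd c x, v)"
    and s: "dd (F_rep c) (0, r *\<^sub>R w) (snd c x, v) = r * dd (F_rep c) (0, w) (snd c x, v)"
    and n: "dd (F_rep c) (0, - w) (snd c x, v) = - dd (F_rep c) (0, w) (snd c x, v)" for w z r
    using linear_add[OF l, of "(0, w)" "(0, z)"] linear_scale[OF l, of r "(0, w)"] linear_neg[OF l, of "(0, w)"] by simp_all
  have "dd (F_rep c) (0, 0) (snd c x, v) = 0" using linear_0[OF l] by (simp add: zero_prod_def)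
  then have sub: "subspace ?D" unfolding subspace_def by (simp add: a s vector_add_ldistrib)
  show ?thesis
  proof
    show "?L \<subseteq> mk_tvec A c x ` ?D"
    proof
      fix u assume "u \<in> ?L"
      then obtain W where W: "tsubspace A x W" "W \<subseteq> indicatrix_tspace A F (mk_tvec A c x v)"
        "\<forall>w\<in>W. tv_J I_vec w \<in> W" "u \<in> W" unfolding D_space_def by auto
      then have "u \<in> tspace A x" unfolding tsubspace_def by auto
      then obtain w where w: "u = mk_tvec A c x w" using tspaceE[OF atlas c] by metis
      have "mk_tvec A c x (I_vec w) \<in> W" using W(3,4) unfolding w by (simp add: tv_J_mk_tvec[OF atlas c, symmetric])
      then show "u \<in> mk_tvec A c x ` ?D"
        using W(2,4) indicatrix_tspace_iff[OF c v] unfolding w by (auto simp: I_vec_def)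
    qed
    have "tsubspace A x (mk_tvec A c x ` ?D)" using sub tsubspace_mk_tvec[OF atlas c] by blast
    moreover have "mk_tvec A c x ` ?D \<subseteq> indicatrix_tspace A F (mk_tvec A c x v)"
      using indicatrix_tspace_iff[OF c v] by auto
    moreover have "\<forall>w\<in>mk_tvec A c x ` ?D. tv_J I_vec w \<in> mk_tvec A c x ` ?D"
      by (auto simp: tv_J_mk_tvec[OF atlas c] I_vec_def n)
    ultimately show "mk_tvec A c x ` ?D \<subseteq> ?L" unfolding D_space_def by auto
  qed
qed

lemma finsler_chart:
  assumes c: "c \<in> A"
  shows "finsler_chart (snd c ` fst c) (F_rep c)"
proof -
  interpret f: finsler_chart_pre "snd c ` fst c" "F_rep c" by (rule finsler_chart_pre[OF c])
  show ?thesis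
  proof
    fix q v a assume q: "q \<in> snd c ` fst c" and v: "F_rep c (q, v) = 1" and d: "dd (F_rep c) (0, a) (q, v) = 0"
      "dd (F_rep c) (0, \<i> *s a) (q, v) = 0" and a: "a \<noteq> 0"
    obtain x where x: "x \<in> fst c" "q = snd c x" using q by auto
    note cx = c x(1)
    have v1: "F (mk_tvec A c x v) = 1" using v F_rep_coord[OF cx] x(2) by simp
    have v0: "v \<noteq> 0" using f.f_zero[OF q] v by auto
    then have p: "(q, v) \<in> f.Dom" using q by simp
    have n: "dd (F_rep c) (0, - w) (q, v) = - dd (F_rep c) (0, w) (q, v)" for w
      using linear_neg[OF dd_linear[OF f.smooth_f f.open_Dom p], of "(0, w)"] by simp
    \<comment> \<open>The pair stands for a - i Ja, a vector of type (1,0) over \<open>a\<close>.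
      Its value under the form is \<open>D2\<close> on \<open>a\<close> plus \<open>D2\<close> on
      \<open>\<i> *s a\<close>, four times the real part of \<open>levi\<close>.\<close>
    let ?X = "(mk_tvec A c x a, mk_tvec A c x (- (\<i> *s a)))"
    have X: "?X \<in> D10_space A F (mk_tvec A c x v)"
      unfolding D10_space_def D_space_mk_tvec[OF cx v1] using d
      by (simp add: mk_tvec_image_iff[OF atlas cx] tv_J_mk_tvec[OF atlas cx] tv_scale_mk_tvec[OF atlas cx]
          I_vec_def n x(2)[symmetric])
    have "?X \<noteq> (tv_zero x, tv_zero x)" using a mk_tvec_zero_iff[OF cx] by simp
    moreover have "mk_tvec A c x v \<in> indicatrix A F x" using v1 mk_tvec_in[OF cx] by (simp add: indicatrix_def)
    ultimately have "0 < Re (finsler_h F (mk_tvec A c x v) ?X (ct_cnj ?X))"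
      using pseudoconvex X carrierI[OF cx] unfolding strongly_pseudoconvex_def by blast
    then have "0 < f.D2 (q, v) a a + f.D2 (q, v) (\<i> *s a) (\<i> *s a)"
      using f.D2_uminus[OF p] by (simp add: ct_cnj_def tv_scale_mk_tvec[OF atlas cx] finsler_h_mk_tvec[OF cx v0] x(2)[symmetric])
    then show "0 < Re (f.levi (q, v) a a)" by (simp add: f.levi_def)
  qed
qed

section \<open>Complex linear frames in charts\<close>

text \<open>The inverse of the coordinate map of the frame bundle: the rows of \<open>B\<close> are
  the components in \<open>c\<close> of the images of the standard basis.\<close>

definition frame_of :: "('a, complex^'n) chart \<Rightarrow> 'a \<Rightarrow> (complex^'n)^'n \<Rightarrow> ('a, 'n) frame" where
  "frame_of c x B = (\<lambda>z. mk_tvec A c x (\<Sum>j\<in>UNIV. z $ j *s B $ j))"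

lemma frame_of_axis: "frame_of c x B (axis j k) = mk_tvec A c x (k *s B $ j)"
proof -
  have "(\<Sum>i\<in>UNIV. axis j k $ i *s B $ i) = (\<Sum>i\<in>UNIV. if i = j then k *s B $ j else 0)"
    by (intro sum.cong) (auto simp: axis_def)
  then show ?thesis by (simp add: frame_of_def)
qed

lemma frame_base_frame_of [simp]: "frame_base (frame_of c x B) = x"
  by (simp add: frame_base_def frame_of_def)

lemma frame_of_in:
  assumes c: "c \<in> A" "x \<in> fst c" and det: "det B \<noteq> 0"
  shows "frame_of c x B \<in> frame_bundle A"
proof -
  let ?L = "\<lambda>z. \<Sum>j\<in>UNIV. z $ j *s B $ j"
  have L: "?L z = transpose B *v z" for z
    unfolding transpose_mult_eq_sum ..
  have "det (transpose B) \<noteq> 0" using det by simp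
  then have "inj ?L" unfolding L det_nonzero_iff_ker
    by (metis (no_types, lifting) eq_iff_diff_eq_0 injI matrix_vector_mult_diff_distrib)
  moreover have "surj ?L" unfolding surj_def using spanning_of_det[OF det] by metis
  ultimately have "bij ?L" by (rule bijI)
  moreover have "bij_betw (mk_tvec A c x) UNIV (tspace A x)"
    unfolding bij_betw_def using inj_mk_tvec[OF atlas c] tspace_eq_range[OF atlas c] by auto
  ultimately have "bij_betw (mk_tvec A c x \<circ> ?L) UNIV (tspace A x)" by (rule bij_betw_trans)
  moreover have "mk_tvec A c x \<circ> ?L = frame_of c x B" by (auto simp: frame_of_def)
  ultimately have "bij_betw (frame_of c x B) UNIV (tspace A x)" by simp
  moreover have "frame_of c x B (z + w) = tv_add (frame_of c x B z) (frame_of c x B w)" for z w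
    by (simp add: frame_of_def tv_add_mk_tvec[OF atlas c] sum.distrib vector_sadd_rdistrib)
  moreover have "frame_of c x B (k *s z) = tv_cscale k (frame_of c x B z)" for k z
  proof -
    have "(\<Sum>j\<in>UNIV. (k * z $ j) *s B $ j) = k *s (\<Sum>j\<in>UNIV. z $ j *s B $ j)"
      by (simp add: vec_eq_iff sum_distrib_left mult.assoc)
    then show ?thesis by (simp add: frame_of_def tv_cscale_mk_tvec[OF atlas c])
  qed
  ultimately show ?thesis unfolding frame_bundle_def using carrierI[OF c] by blast
qed

lemma frame_base_in: "u \<in> frame_bundle A \<Longrightarrow> frame_base u \<in> carrier_of A"
  and frame_in_tspace: "u \<in> frame_bundle A \<Longrightarrow> u z \<in> tspace A (frame_base u)"
proof -
  assume "u \<in> frame_bundle A"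
  then obtain x where x: "x \<in> carrier_of A" "bij_betw u UNIV (tspace A x)" unfolding frame_bundle_def by blast
  then have "u z \<in> tspace A x" for z unfolding bij_betw_def by auto
  then show "frame_base u \<in> carrier_of A" "u z \<in> tspace A (frame_base u)"
    using x fst_tspace[of "u 0" A x] unfolding frame_base_def by auto
qed

lemma frame_eq_frame_of:
  assumes u: "u \<in> frame_bundle A" and c: "c \<in> A" "frame_base u \<in> fst c"
  shows "u = frame_of c (frame_base u) (\<chi> j. snd (u (axis j 1)) c)" "det ((\<chi> j. snd (u (axis j 1)) c) :: (complex^'n)^'n) \<noteq> 0"
proof -
  let ?x = "frame_base u" and ?B = "(\<chi> j. snd (u (axis j 1)) c) :: (complex^'n)^'n"
  have add: "u (z + w) = tv_add (u z) (u w)" and scale: "u (k *s z) = tv_cscale k (u z)" for z w k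
    using u unfolding frame_bundle_def by blast+
  define L where "L z = snd (u z) c" for z
  have uL: "u z = mk_tvec A c ?x (L z)" for z
    using mk_tvec_snd[OF atlas c frame_in_tspace[OF u]] by (simp add: L_def)
  have "L (z + w) = L z + L w" for z w
    unfolding L_def add using uL by (simp add: tv_add_def)
  moreover have Ls: "L (k *s z) = k *s L z" for k z
    using scale[of k z] unfolding uL tv_cscale_mk_tvec[OF atlas c] mk_tvec_eq_iff[OF atlas c] .
  moreover have "L 0 = 0" using Ls[of 0 0] by simp
  ultimately have Lsum: "L (\<Sum>j\<in>S. g j) = (\<Sum>j\<in>S. L (g j))" for g :: "'n \<Rightarrow> complex^'n" and S
    by (induction S rule: infinite_finite_induct) auto
  have L: "L z = (\<Sum>j\<in>UNIV. z $ j *s ?B $ j)" for z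
  proof -
    have "L z = L (\<Sum>i\<in>UNIV. z $ i *s axis i 1)" by (simp only: basis_expansion)
    also have "\<dots> = (\<Sum>i\<in>UNIV. z $ i *s L (axis i 1))" by (simp only: Lsum Ls)
    finally show ?thesis by (simp add: L_def)
  qed
  show "u = frame_of c ?x ?B"
  proof
    show "u z = frame_of c ?x ?B z" for z using uL[of z] unfolding L frame_of_def .
  qed
  have "inj u" using u unfolding frame_bundle_def by (auto dest: bij_betw_imp_inj_on)
  have "z = 0" if "transpose ?B *v z = 0" for z
  proof -
    have "L z = transpose ?B *v z"
      unfolding transpose_mult_eq_sum by (rule L)
    then have "u z = u 0" using uL[of z] uL[of 0] that \<open>L 0 = 0\<close> by metis
    with \<open>inj u\<close> show ?thesis by (rule injD)
  qed
  then have "det (transpose ?B) \<noteq> 0" unfolding det_nonzero_iff_ker by blast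
  then show "det ?B \<noteq> 0" by simp
qed

section \<open>The unitary frame bundle in a chart\<close>

abbreviation "unitary \<equiv> unitary_frame_bundle A F k0"

abbreviation "orthonormal_rep c \<equiv> levi_matrix.orthonormal (snd c ` fst c) (finsler_chart_pre.Hm (F_rep c)) k0"

lemma levi_matrix_chart: "c \<in> A \<Longrightarrow> levi_matrix (snd c ` fst c) (finsler_chart_pre.Hm (F_rep c))"
  using finsler_chart.levi_matrix[OF finsler_chart] .

text \<open>The halves in \<open>e_vec\<close> are the halves behind the quarter in
  \<open>levi\<close>, so the entries agree without a further factor.\<close>

lemma finsler_h_frame_of:
  assumes c: "c \<in> A" "x \<in> fst c" and v: "B $ k0 \<noteq> 0"
  shows "finsler_h F (f_even (frame_of c x B) k0) (e_vec (frame_of c x B) l) (ct_cnj (e_vec (frame_of c x B) m)) =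
    finsler_chart_pre.levi (F_rep c) (snd c x, B $ k0) (B $ l) (B $ m)"
proof -
  interpret f: finsler_chart "snd c ` fst c" "F_rep c" by (rule finsler_chart[OF c(1)])
  have p: "(snd c x, B $ k0) \<in> f.Dom" using imageI[OF c(2), of "snd c"] v by simp
  have "e_vec (frame_of c x B) l = (mk_tvec A c x ((1/2) *\<^sub>R B $ l), mk_tvec A c x ((-1/2) *\<^sub>R (\<i> *s B $ l)))" for l
    unfolding e_vec_def f_even_def f_odd_def frame_of_axis tv_scale_mk_tvec[OF atlas c] vector_smult_lid ..
  note ev = this
  show ?thesis
    unfolding ev ct_cnj_def fst_conv snd_conv tv_scale_mk_tvec[OF atlas c] f_even_def frame_of_axis
      vector_smult_lid finsler_h_mk_tvec[OF c v]
    by (simp add: f.levi_def complex_eq_iff f.D2_scaleR[OF p] f.D2_scaleR_right[OF p] f.D2_uminus[OF p] f.D2_uminus_right[OF p])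
qed

lemma frame_of_unitary_iff:
  assumes c: "c \<in> A" "x \<in> fst c" and det: "det B \<noteq> 0"
  shows "frame_of c x B \<in> unitary \<longleftrightarrow> orthonormal_rep c (snd c x, B)"
proof -
  interpret f: finsler_chart "snd c ` fst c" "F_rep c" by (rule finsler_chart[OF c(1)])
  interpret m: levi_matrix "snd c ` fst c" f.Hm k0 by (rule levi_matrix_chart[OF c(1)])
  have xO: "snd c x \<in> snd c ` fst c" using c by simp
  have v: "B $ k0 \<noteq> 0" by (rule row_nonzero_of_det[OF det])
  then have p: "(snd c x, B $ k0) \<in> f.Dom" using xO by simp
  have "f_even (frame_of c x B) ` (- {k0}) \<union> f_odd (frame_of c x B) ` (- {k0}) =
      mk_tvec A c x ` ((\<lambda>l. B $ l) ` (- {k0}) \<union> (\<lambda>l. \<i> *s B $ l) ` (- {k0}))"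
    unfolding image_Un image_image f_even_def f_odd_def frame_of_axis by simp
  then have span: "tspan A x (f_even (frame_of c x B) ` (- {k0}) \<union> f_odd (frame_of c x B) ` (- {k0})) =
      mk_tvec A c x ` span ((\<lambda>l. B $ l) ` (- {k0}) \<union> (\<lambda>l. \<i> *s B $ l) ` (- {k0}))"
    by (simp add: tspan_mk_tvec[OF atlas c])
  have fe: "f_even (frame_of c x B) k0 = mk_tvec A c x (B $ k0)" by (simp add: f_even_def frame_of_axis)
  have "frame_of c x B \<in> unitary \<longleftrightarrow> F_rep c (snd c x, B $ k0) = 1 \<and>
    span ((\<lambda>l. B $ l) ` (- {k0}) \<union> (\<lambda>l. \<i> *s B $ l) ` (- {k0})) =
      {w. dd (F_rep c) (0, w) (snd c x, B $ k0) = 0 \<and> dd (F_rep c) (0, \<i> *s w) (snd c x, B $ k0) = 0} \<and>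
    (\<forall>l m. l \<noteq> k0 \<longrightarrow> m \<noteq> k0 \<longrightarrow> f.levi (snd c x, B $ k0) (B $ l) (B $ m) = (if l = m then 1 else 0))"
    unfolding unitary_frame_bundle_def mem_Collect_eq finsler_h_frame_of[OF c v] frame_base_frame_of span
    using frame_of_in[OF c det] F_rep_coord[OF c, of "B $ k0"] D_space_mk_tvec[OF c, of "B $ k0"]
      inj_image_eq_iff[OF inj_mk_tvec[OF atlas c]] unfolding fe by auto
  also have "\<dots> \<longleftrightarrow> orthonormal_rep c (snd c x, B)"
    unfolding f.orthonormal_frame_iff[OF xO det, of k0, symmetric] m.orthonormal_def m.Psi_def
    using xO by (simp add: f.levi_hform[OF p])
  finally show ?thesis .
qed

end

section \<open>Lifting holomorphic maps to frames\<close>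

lemma holo_on_cong:
  assumes "open S" "\<And>x. x \<in> S \<Longrightarrow> f x = g x" "holo_on I I' S f"
  shows "holo_on I I' S g"
proof -
  have "smooth_on S g" using smooth_on_cong[of S f g] assms unfolding holo_on_def by simp
  moreover have "dd g (I w) p = I' (dd g w p)" if p: "p \<in> S" for p w
  proof -
    have "f differentiable at p"
      using assms(3) p smooth_on_imp_differentiable[OF _ assms(1)] unfolding holo_on_def by blast
    then have "dd f v p = dd g v p" for v
      by (rule dd_cong_open[OF assms(1) p _ assms(2)])
    then show ?thesis using assms(3) p unfolding holo_on_def by metis
  qed
  ultimately show ?thesis unfolding holo_on_def by blast
qed

lemma has_derivative_vec_lambda:
  fixes f :: "'n::finite \<Rightarrow> 'e::euclidean_space \<Rightarrow> 'f::euclidean_space"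
  assumes "\<And>j. (f j has_derivative f' j) (at x)"
  shows "((\<lambda>x. \<chi> j. f j x) has_derivative (\<lambda>h. \<chi> j. f' j h)) (at x)"
proof -
  have "((\<lambda>x. \<Sum>k\<in>UNIV. \<chi> i. if i = k then f k x else 0) has_derivative
      (\<lambda>h. \<Sum>k\<in>UNIV. \<chi> i. if i = k then f' k h else 0)) (at x)"
    by (intro has_derivative_sum bounded_linear.has_derivative[OF bounded_linear_vec_axis] assms)
  moreover have "(\<Sum>k\<in>UNIV. \<chi> i. if i = k then g k else 0) = (\<chi> k. g k)" for g :: "'n \<Rightarrow> 'f"
    by (simp add: vec_eq_iff)
  ultimately show ?thesis by simp
qed

text \<open>By the symmetry of second derivatives, the derivative of a holomorphic map is holomorphic.\<close>

lemma dd_dd_apply_holo: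
  assumes f: "holo_on I I' S f" "open S" and p: "p \<in> S" and I': "bounded_linear I'"
    and L: "bounded_linear L" "\<And>W. L (I W) = I (L W)"
  shows "dd (\<lambda>q. dd f (L q) q) (I W) p = I' (dd (\<lambda>q. dd f (L q) q) W p)"
proof -
  have s: "smooth_on S f" and h: "\<And>p w. p \<in> S \<Longrightarrow> dd f (I w) p = I' (dd f w p)"
    using f(1) unfolding holo_on_def by auto
  have "dd (dd f (L p)) (I W) p = dd (dd f (I W)) (L p) p" by (rule dd_commute[OF s f(2) p])
  also have "\<dots> = dd (\<lambda>q. I' (dd f W q)) (L p) p"
    by (rule dd_cong_open[OF f(2) p smooth_on_imp_differentiable[OF smooth_on_dd[OF s] f(2) p] h])
  also have "\<dots> = I' (dd (dd f W) (L p) p)"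
    by (rule dd_compose_linear[OF I' smooth_on_imp_differentiable[OF smooth_on_dd[OF s] f(2) p]])
  also have "dd (dd f W) (L p) p = dd (dd f (L p)) W p" by (rule dd_commute[OF s f(2) p])
  finally show ?thesis
    unfolding dd_dd_apply[OF s f(2) p L(1)] using h[OF p] L(2) linear_add[OF bounded_linear.linear[OF I']] by simp
qed

text \<open>The lift to frames in coordinates: the Jacobian acts on every vector of the
  frame.\<close>

definition lift_rep :: "(complex^'n \<Rightarrow> complex^'n) \<Rightarrow> (complex^'n) \<times> ((complex^'n)^'n) \<Rightarrow> (complex^'n) \<times> ((complex^'n)^'n)" where
  "lift_rep \<phi> p = (\<phi> (fst p), \<chi> j. dd \<phi> (snd p $ j) (fst p))"

lemma bounded_linear_I_frame: "bounded_linear (I_frame :: (complex^'n) \<times> ((complex^'n)^'n) \<Rightarrow> _)"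
  unfolding linear_conv_bounded_linear[symmetric]
  by (rule linearI) (simp_all add: I_frame_def split_beta vec_eq_iff algebra_simps)

lemma holo_on_lift_rep:
  fixes \<phi> :: "complex^'n \<Rightarrow> complex^'n"
  assumes \<phi>: "holo_on I_vec I_vec S \<phi>" and S: "open S"
  shows "holo_on I_frame I_frame (S \<times> UNIV) (lift_rep \<phi>)"
proof -
  let ?S = "S \<times> (UNIV :: ((complex^'n)^'n) set)"
  have op: "open ?S" by (intro open_Times S open_UNIV)
  have s: "smooth_on S \<phi>" and h: "\<And>p w. p \<in> S \<Longrightarrow> dd \<phi> (I_vec w) p = I_vec (dd \<phi> w p)"
    using \<phi> unfolding holo_on_def by auto
  \<comment> \<open>Pulled back to the product, the map has base point and direction as functions of
    one variable, which is the form that \<open>dd_dd_apply_holo\<close> treats.\<close>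
  define f where "f p = \<phi> (fst p)" for p :: "(complex^'n) \<times> ((complex^'n)^'n)"
  have fs: "smooth_on ?S f"
    unfolding f_def[abs_def] by (rule smooth_on_compose[OF op S s smooth_on_fst[OF op smooth_on_id[OF op]]]) auto
  have fd: "dd f W p = dd \<phi> (fst W) (fst p)" if "p \<in> ?S" for W p
  proof -
    have "(fst has_derivative fst) (at p)" by (intro derivative_eq_intros) auto
    then have "(f has_derivative (\<lambda>W. dd \<phi> (fst W) (fst p))) (at p)"
      unfolding f_def[abs_def] by (rule has_derivative_compose) (use that in \<open>auto intro: smooth_on_has_derivative[OF s S]\<close>)
    then show ?thesis by (rule dd_eqI)
  qed
  have fst_I: "fst (I_frame W) = I_vec (fst W)" and snd_I: "snd (I_frame W) $ j = I_vec (snd W $ j)"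
    for W :: "(complex^'n) \<times> ((complex^'n)^'n)" and j
    by (simp_all add: I_frame_def I_vec_def split_beta)
  have fh: "holo_on I_frame I_vec ?S f"
    unfolding holo_on_def using fs fd h fst_I by auto
  \<comment> \<open>Turns the frame vector with index \<open>j\<close> into a direction along the
    base, linearly and compatibly with the complex structure.\<close>
  define L where "L j p = (snd p $ j, 0 :: (complex^'n)^'n)" for j and p :: "(complex^'n) \<times> ((complex^'n)^'n)"
  have Lb: "bounded_linear (L j)" for j
    unfolding L_def[abs_def] by (intro bounded_linear_Pair bounded_linear_compose[OF bounded_linear_vec_nth] bounded_linear_snd bounded_linear_zero)
  have LI: "L j (I_frame W) = I_frame (L j W)" for j W
    by (simp add: L_def snd_I) (simp add: I_frame_def I_vec_def vec_eq_iff)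
  have hs: "smooth_on ?S (\<lambda>p. dd f (L j p) p)" for j
    by (rule smooth_on_dd_apply[OF op op fs smooth_on_id[OF op] _ smooth_on_linear[OF Lb op]]) auto
  define g where "g p = (f p, \<chi> j. dd f (L j p) p)" for p
  have gs: "smooth_on ?S g"
    unfolding g_def[abs_def] by (intro smooth_on_Pair smooth_on_vec_lambda fs hs op)
  have gd: "dd g W p = (dd f W p, \<chi> j. dd (\<lambda>p. dd f (L j p) p) W p)" if p: "p \<in> ?S" for W p
  proof -
    have "(g has_derivative (\<lambda>W. (dd f W p, \<chi> j. dd (\<lambda>p. dd f (L j p) p) W p))) (at p)"
      unfolding g_def[abs_def]
      by (intro has_derivative_Pair has_derivative_vec_lambda smooth_on_has_derivative[OF fs op p] smooth_on_has_derivative[OF hs op p])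
    then show ?thesis by (rule dd_eqI)
  qed
  have "dd g (I_frame W) p = I_frame (dd g W p)" if p: "p \<in> ?S" for W p
  proof -
    have 1: "dd f (I_frame W) p = I_vec (dd f W p)" unfolding fd[OF p] fst_I by (rule h) (use p in auto)
    have 2: "dd (\<lambda>p. dd f (L j p) p) (I_frame W) p = I_vec (dd (\<lambda>p. dd f (L j p) p) W p)" for j
      by (rule dd_dd_apply_holo[where I = I_frame and I' = I_vec and L = "L j" and f = f,
            OF fh op p bounded_linear_I_vec Lb LI])
    have I: "I_frame (a, b) = (I_vec a, \<chi> j. I_vec (b $ j))" for a :: "complex^'n" and b :: "(complex^'n)^'n"
      by (simp add: I_frame_def I_vec_def)
    show ?thesis unfolding gd[OF p] I by (simp only: 1 2 vec_lambda_beta)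
  qed
  then have gh: "holo_on I_frame I_frame ?S g" unfolding holo_on_def using gs by blast
  have "g p = lift_rep \<phi> p" if "p \<in> ?S" for p
    using fd[OF that] by (simp add: g_def lift_rep_def f_def L_def)
  then show ?thesis by (rule holo_on_cong[OF op _ gh])
qed

lemma holo_on_subset: "holo_on I I' S f \<Longrightarrow> T \<subseteq> S \<Longrightarrow> holo_on I I' T f"
  unfolding holo_on_def using smooth_on_subset by blast

lemma open_det_nonzero: "open {B :: complex^'n^'n. det B \<noteq> 0}"
proof -
  have "{B :: complex^'n^'n. det B \<noteq> 0} = det -` (- {0})" by auto
  moreover have "continuous_on UNIV (det :: complex^'n^'n \<Rightarrow> complex)"
    unfolding det_def by (intro continuous_intros)
  ultimately show ?thesis using open_vimage[of "- {0}" "det :: complex^'n^'n \<Rightarrow> complex", OF open_Compl[OF closed_singleton]] by simp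
qed

context finsler_manifold
begin

section \<open>The atlas of the frame bundle\<close>

definition frame_chart :: "('a, complex^'n) chart \<Rightarrow> (('a, 'n) frame, (complex^'n) \<times> ((complex^'n)^'n)) chart" where
  "frame_chart c = ({u \<in> frame_bundle A. frame_base u \<in> fst c},
     \<lambda>u. (snd c (frame_base u), \<chi> j. snd (u (axis j 1)) c))"

abbreviation "FA \<equiv> frame_atlas A"

lemma frame_atlas_eq: "FA = frame_chart ` A"
  unfolding frame_atlas_def frame_chart_def ..

lemma frame_chart_in: "c \<in> A \<Longrightarrow> frame_chart c \<in> FA"
  unfolding frame_atlas_eq by blast

lemma frame_chart_coord: "c \<in> A \<Longrightarrow> x \<in> fst c \<Longrightarrow> snd (frame_chart c) (frame_of c x B) = (snd c x, B)"
  by (simp add: frame_chart_def frame_of_axis snd_mk_tvec[OF atlas] vec_eq_iff)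

lemma frame_of_in_chart: "c \<in> A \<Longrightarrow> x \<in> fst c \<Longrightarrow> det B \<noteq> 0 \<Longrightarrow> frame_of c x B \<in> fst (frame_chart c)"
  by (simp add: frame_chart_def frame_of_in)

lemma frame_chartE:
  assumes "c \<in> A" "u \<in> fst (frame_chart c)"
  obtains x B where "x \<in> fst c" "det B \<noteq> 0" "u = frame_of c x B"
proof -
  have u: "u \<in> frame_bundle A" "frame_base u \<in> fst c" using assms(2) unfolding frame_chart_def by auto
  show ?thesis
    by (rule that[OF u(2) frame_eq_frame_of(2,1)[OF u(1) assms(1) u(2)]])
qed

lemma carrier_frame_atlas: "carrier_of FA = frame_bundle A"
proof
  show "carrier_of FA \<subseteq> frame_bundle A" unfolding carrier_of_def frame_atlas_eq frame_chart_def by auto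
  show "frame_bundle A \<subseteq> carrier_of FA"
  proof
    fix u assume u: "u \<in> frame_bundle A"
    then have "u \<in> fst (frame_chart (chart_at A (frame_base u)))"
      using chart_at(2)[OF frame_base_in[OF u]] by (simp add: frame_chart_def)
    then show "u \<in> carrier_of FA" by (rule carrierI[OF frame_chart_in[OF chart_at(1)[OF frame_base_in[OF u]]]])
  qed
qed

lemma inj_frame_chart: "c \<in> A \<Longrightarrow> inj_on (snd (frame_chart c)) (fst (frame_chart c))"
proof (rule inj_onI)
  fix u w assume c: "c \<in> A" and u: "u \<in> fst (frame_chart c)" and w: "w \<in> fst (frame_chart c)"
    and e: "snd (frame_chart c) u = snd (frame_chart c) w"
  obtain x B y C where "x \<in> fst c" "u = frame_of c x B" "y \<in> fst c" "w = frame_of c y C"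
    using frame_chartE[OF c u] frame_chartE[OF c w] by metis
  then show "u = w" using e frame_chart_coord[OF c] coord_inj[OF atlas c] by (auto dest: inj_onD)
qed

lemma chart_inv_frame_chart:
  assumes "c \<in> A" "x \<in> fst c" "det B \<noteq> 0"
  shows "chart_inv (frame_chart c) (snd c x, B) = frame_of c x B"
  unfolding chart_inv_def
  by (rule inv_into_f_eq[where f = "snd (frame_chart c)"])
    (rule inj_frame_chart[OF assms(1)] frame_of_in_chart[OF assms] frame_chart_coord[OF assms(1,2)])+

text \<open>The inverse is carried along, so that an isometry, its inverse and the identity fall
  under the same lemmas; the identity accounts for the coordinate changes of the frame
  bundle.\<close>

definition biholo :: "('a \<Rightarrow> 'a) \<Rightarrow> ('a \<Rightarrow> 'a) \<Rightarrow> bool" where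
  "biholo f g \<longleftrightarrow> atlas_holo I_vec A I_vec A f \<and> atlas_holo I_vec A I_vec A g \<and>
     (\<forall>x\<in>carrier_of A. g (f x) = x \<and> f (g x) = x)"

lemma biholo_id: "biholo id id"
  unfolding biholo_def using atlas_holo_id[OF atlas] by simp

lemma biholo_sym: "biholo f g \<Longrightarrow> biholo g f"
  unfolding biholo_def by blast

section \<open>Lifts of biholomorphic maps\<close>

lemma frame_lift_frame_of:
  assumes f: "atlas_holo I_vec A I_vec A f" and c: "c \<in> A" "x \<in> fst c" "c' \<in> A" "f x \<in> fst c'"
  shows "frame_lift A f (frame_of c x B) = frame_of c' (f x) (\<chi> j. dd (coord_rep f c c') (B $ j) (snd c x))"
proof -
  let ?L = "\<lambda>w. dd (coord_rep f c c') w (snd c x)"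
  note lin = dd_coord_rep_linear[OF f c(1,3,2,4)]
  have i: "?L (\<i> *s w) = \<i> *s ?L w" for w
    using atlas_holo_rep(3)[OF f c(1,3), of "snd c x" w] c(2,4) by (auto simp: I_vec_def)
  have "?L (z *s w) = z *s ?L w" for z w
    unfolding vec_scale_complex[of z] linear_add[OF lin] linear_scale[OF lin] i ..
  then have "?L (\<Sum>j\<in>UNIV. z $ j *s B $ j) = (\<Sum>j\<in>UNIV. z $ j *s ?L (B $ j))" for z
    by (simp add: linear_sum[OF lin])
  then show ?thesis
    unfolding frame_lift_def frame_of_def comp_def pushforward_mk_tvec[OF f c] by simp
qed

text \<open>The pushforward along \<open>g\<close> undoes the one along \<open>f\<close>, so the
  differential is injective and takes a basis to linearly independent vectors.\<close>

lemma det_lift: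
  assumes fg: "biholo f g" and c: "c \<in> A" "x \<in> fst c" "c' \<in> A" "f x \<in> fst c'" and B: "det B \<noteq> 0"
  shows "det ((\<chi> j. dd (coord_rep f c c') (B $ j) (snd c x)) :: complex^'n^'n) \<noteq> 0"
proof -
  have f: "atlas_holo I_vec A I_vec A f" and g: "atlas_holo I_vec A I_vec A g" and gf: "\<And>x. x \<in> carrier_of A \<Longrightarrow> g (f x) = x"
    using fg unfolding biholo_def by auto
  let ?C = "(\<chi> j. dd (coord_rep f c c') (B $ j) (snd c x)) :: complex^'n^'n"
  have gx: "g (f x) = x" by (rule gf[OF carrierI[OF c(1,2)]])
  have inj: "mk_tvec A c x v = mk_tvec A c x w" if "pushforward A A f (mk_tvec A c x v) = pushforward A A f (mk_tvec A c x w)" for v w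
  proof -
    have "pushforward A A (g \<circ> f) (mk_tvec A c x v) = pushforward A A (g \<circ> f) (mk_tvec A c x w)"
      using that pushforward_comp[OF f g carrierI[OF c(1,2)] mk_tvec_in[OF c(1,2)]] by metis
    moreover have "pushforward A A (g \<circ> f) u = u" if "u \<in> tspace A x" for u
      using pushforward_cong[OF atlas_holo_id[OF atlas] carrierI[OF c(1,2)] that, of "g \<circ> f"]
        pushforward_id[OF atlas carrierI[OF c(1,2)] that] gf by simp
    ultimately show ?thesis using mk_tvec_in[OF c(1,2)] by metis
  qed
  have "z = 0" if "transpose ?C *v z = 0" for z
  proof -
    have s: "frame_lift A f (frame_of c x B) z = mk_tvec A c' (f x) (transpose ?C *v z)" for z
      using fun_cong[OF frame_lift_frame_of[OF f c, of B], of z] unfolding frame_of_def[of c'] transpose_mult_eq_sum .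
    have "frame_lift A f (frame_of c x B) z = frame_lift A f (frame_of c x B) 0"
      unfolding s that by simp
    then have "frame_of c x B z = frame_of c x B 0"
      unfolding frame_lift_def frame_of_def comp_def by (rule inj)
    then have "transpose B *v z = transpose B *v 0"
      unfolding frame_of_def mk_tvec_eq_iff[OF atlas c(1,2)] transpose_mult_eq_sum .
    moreover have "det (transpose B) \<noteq> 0" using B by simp
    ultimately show "z = 0" unfolding det_nonzero_iff_ker by simp
  qed
  then have "det (transpose ?C) \<noteq> 0" unfolding det_nonzero_iff_ker by blast
  then show ?thesis by simp
qed

lemma frame_lift_in_chart_iff:
  assumes fg: "biholo f g" and c: "c \<in> A" "x \<in> fst c" "c' \<in> A" and B: "det B \<noteq> 0"
  shows "frame_lift A f (frame_of c x B) \<in> fst (frame_chart c') \<longleftrightarrow> f x \<in> fst c'"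
proof -
  have f: "atlas_holo I_vec A I_vec A f" using fg unfolding biholo_def by auto
  note d = chart_at[OF atlas_holoD(3)[OF f carrierI[OF c(1,2)]]]
  have "frame_base (frame_lift A f (frame_of c x B)) = f x"
    unfolding frame_lift_frame_of[OF f c(1,2) d] by simp
  moreover have "frame_lift A f (frame_of c x B) \<in> fst (frame_chart c')" if "f x \<in> fst c'"
    unfolding frame_lift_frame_of[OF f c that] by (rule frame_of_in_chart[OF c(3) that det_lift[OF fg c that B]])
  ultimately show ?thesis unfolding frame_chart_def by auto
qed

lemma frame_lift_image:
  assumes fg: "biholo f g" and c: "c \<in> A" "c' \<in> A"
  shows "snd (frame_chart c) ` (fst (frame_chart c) \<inter> frame_lift A f -` fst (frame_chart c')) =
    snd c ` (fst c \<inter> f -` fst c') \<times> {B. det B \<noteq> 0}" (is "?L = ?R")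
proof (intro set_eqI iffI)
  fix q assume "q \<in> ?L"
  then obtain u where u: "u \<in> fst (frame_chart c)" "frame_lift A f u \<in> fst (frame_chart c')" "q = snd (frame_chart c) u" by auto
  obtain x B where xB: "x \<in> fst c" "det B \<noteq> 0" "u = frame_of c x B" using frame_chartE[OF c(1) u(1)] .
  then show "q \<in> ?R"
    using u frame_lift_in_chart_iff[OF fg c(1) xB(1) c(2) xB(2)] frame_chart_coord[OF c(1) xB(1)] by auto
next
  fix q assume "q \<in> ?R"
  then obtain x B where xB: "x \<in> fst c" "f x \<in> fst c'" "det B \<noteq> 0" "q = (snd c x, B)" by auto
  then have "frame_of c x B \<in> fst (frame_chart c) \<inter> frame_lift A f -` fst (frame_chart c')"
    using frame_of_in_chart[OF c(1)] frame_lift_in_chart_iff[OF fg c(1) xB(1) c(2) xB(3)] by simp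
  then show "q \<in> ?L" using frame_chart_coord[OF c(1) xB(1), of B] xB(4) by (metis imageI)
qed

lemma frame_lift_rep:
  assumes fg: "biholo f g" and c: "c \<in> A" "c' \<in> A" and q: "q \<in> snd c ` (fst c \<inter> f -` fst c') \<times> {B. det B \<noteq> 0}"
  shows "coord_rep (frame_lift A f) (frame_chart c) (frame_chart c') q = lift_rep (coord_rep f c c') q"
proof -
  have f: "atlas_holo I_vec A I_vec A f" using fg unfolding biholo_def by auto
  obtain x B where xB: "x \<in> fst c" "f x \<in> fst c'" "det B \<noteq> 0" "q = (snd c x, B)" using q by auto
  show ?thesis
    unfolding xB(4)
    by (simp add: coord_rep_def[of "frame_lift A f"] chart_inv_frame_chart[OF c(1) xB(1,3)]
      frame_lift_frame_of[OF f c(1) xB(1) c(2) xB(2)] frame_chart_coord[OF c(2) xB(2)] lift_rep_def coord_rep_coord[OF atlas c(1) xB(1)])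
qed

lemma frame_lift_holo_on:
  assumes fg: "biholo f g" and c: "c \<in> A" "c' \<in> A"
  shows "open (snd (frame_chart c) ` (fst (frame_chart c) \<inter> frame_lift A f -` fst (frame_chart c')))"
    and "holo_on I_frame I_frame (snd (frame_chart c) ` (fst (frame_chart c) \<inter> frame_lift A f -` fst (frame_chart c')))
      (coord_rep (frame_lift A f) (frame_chart c) (frame_chart c'))"
proof -
  have f: "atlas_holo I_vec A I_vec A f" using fg unfolding biholo_def by auto
  let ?S = "snd c ` (fst c \<inter> f -` fst c')"
  have S: "open ?S" by (rule atlas_holo_rep(1)[OF f c])
  have h: "holo_on I_vec I_vec ?S (coord_rep f c c')" using f c unfolding atlas_holo_def by blast
  have op: "open (?S \<times> {B :: complex^'n^'n. det B \<noteq> 0})" by (intro open_Times S open_det_nonzero)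
  then show "open (snd (frame_chart c) ` (fst (frame_chart c) \<inter> frame_lift A f -` fst (frame_chart c')))"
    unfolding frame_lift_image[OF fg c] .
  show "holo_on I_frame I_frame (snd (frame_chart c) ` (fst (frame_chart c) \<inter> frame_lift A f -` fst (frame_chart c')))
      (coord_rep (frame_lift A f) (frame_chart c) (frame_chart c'))"
    unfolding frame_lift_image[OF fg c]
    by (rule holo_on_cong[OF op _ holo_on_subset[OF holo_on_lift_rep[OF h S]]]) (auto simp: frame_lift_rep[OF fg c])
qed

lemma frame_lift_comp:
  assumes f: "atlas_holo I_vec A I_vec A f" and fg: "\<And>x. x \<in> carrier_of A \<Longrightarrow> g (f x) = x" and g: "atlas_holo I_vec A I_vec A g"
    and u: "u \<in> frame_bundle A"
  shows "frame_lift A g (frame_lift A f u) = u"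
proof
  fix z
  note x = frame_base_in[OF u] and uz = frame_in_tspace[OF u, of z]
  show "frame_lift A g (frame_lift A f u) z = u z"
    using pushforward_comp[OF f g x uz] pushforward_cong[OF atlas_holo_id[OF atlas] x uz, of "g \<circ> f"]
      pushforward_id[OF atlas x uz] fg by (simp add: frame_lift_def)
qed

lemma frame_lift_id: "u \<in> frame_bundle A \<Longrightarrow> frame_lift A id u = u"
  using pushforward_id[OF atlas frame_base_in frame_in_tspace] by (auto simp: frame_lift_def)

text \<open>The coordinate changes of the frame bundle are the representations of the lift of
  \<open>id\<close>, so the compatibility of its charts is the holomorphy of lifts for this
  map.\<close>

lemma linear_atlas_frame: "linear_atlas I_frame FA"
  unfolding linear_atlas_def complex_atlas_def frame_atlas_eq
proof (intro conjI ballI; (elim imageE)?)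
  fix C c assume "c \<in> A" "C = frame_chart c"
  then show "inj_on (snd C) (fst C)" using inj_frame_chart by simp
next
  fix C C' c c' assume c: "c \<in> A" "c' \<in> A" and C: "C = frame_chart c" "C' = frame_chart c'"
  have eq: "fst (frame_chart c) \<inter> frame_lift A id -` fst (frame_chart c') = fst (frame_chart c) \<inter> fst (frame_chart c')"
    using frame_lift_id by (auto simp: frame_chart_def)
  show op: "open (snd C ` (fst C \<inter> fst C'))"
    using frame_lift_holo_on(1)[OF biholo_id c] unfolding eq C .
  show "holo_on I_frame I_frame (snd C ` (fst C \<inter> fst C')) (snd C' \<circ> chart_inv C)"
  proof (rule holo_on_cong[OF op])
    show "holo_on I_frame I_frame (snd C ` (fst C \<inter> fst C')) (coord_rep (frame_lift A id) C C')"
      using frame_lift_holo_on(2)[OF biholo_id c] unfolding eq C .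
    fix q assume "q \<in> snd C ` (fst C \<inter> fst C')"
    then have "chart_inv C q \<in> fst C" by (auto intro: chart_inv_in)
    then show "coord_rep (frame_lift A id) C C' q = (snd C' \<circ> chart_inv C) q"
      using frame_lift_id[of "chart_inv C q"] by (simp add: coord_rep_def C frame_chart_def)
  qed
qed (rule bounded_linear_I_frame)

lemma frame_lift_in:
  assumes fg: "biholo f g" and u: "u \<in> frame_bundle A"
  shows "frame_lift A f u \<in> frame_bundle A" "frame_base (frame_lift A f u) = f (frame_base u)"
proof -
  have f: "atlas_holo I_vec A I_vec A f" using fg unfolding biholo_def by auto
  note x = frame_base_in[OF u]
  note c = chart_at[OF x] and d = chart_at[OF atlas_holoD(3)[OF f x]]
  note e = frame_eq_frame_of[OF u c]
  show "frame_lift A f u \<in> frame_bundle A" "frame_base (frame_lift A f u) = f (frame_base u)"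
    using frame_lift_in_chart_iff[OF fg c d(1) e(2)] frame_lift_frame_of[OF f c d, of "\<chi> j. snd (u (axis j 1)) (chart_at A (frame_base u))"] d(2)
    unfolding e(1)[symmetric] by (simp_all add: frame_chart_def)
qed

lemma atlas_holo_frame_lift: "biholo f g \<Longrightarrow> atlas_holo I_frame FA I_frame FA (frame_lift A f)"
  unfolding atlas_holo_def carrier_frame_atlas
  using linear_atlas_frame frame_lift_in frame_lift_holo_on by (auto simp: frame_atlas_eq)

section \<open>The projection to the base\<close>

lemma frame_base_image:
  assumes c: "c \<in> A" "c' \<in> A"
  shows "snd (frame_chart c) ` (fst (frame_chart c) \<inter> frame_base -` fst c') = snd c ` (fst c \<inter> fst c') \<times> {B. det B \<noteq> 0}"
    (is "?L = ?R")
proof (intro set_eqI iffI)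
  fix q assume "q \<in> ?L"
  then obtain u where u: "u \<in> fst (frame_chart c)" "frame_base u \<in> fst c'" "q = snd (frame_chart c) u" by auto
  obtain x B where xB: "x \<in> fst c" "det B \<noteq> 0" "u = frame_of c x B" using frame_chartE[OF c(1) u(1)] .
  then show "q \<in> ?R" using u frame_chart_coord[OF c(1) xB(1)] by auto
next
  fix q assume "q \<in> ?R"
  then obtain x B where xB: "x \<in> fst c" "x \<in> fst c'" "det B \<noteq> 0" "q = (snd c x, B)" by auto
  then have "frame_of c x B \<in> fst (frame_chart c) \<inter> frame_base -` fst c'"
    using frame_of_in_chart[OF c(1)] by simp
  then show "q \<in> ?L" using frame_chart_coord[OF c(1) xB(1), of B] xB(4) by (metis imageI)
qed

lemma frame_base_rep:
  assumes c: "c \<in> A" "c' \<in> A" and q: "q \<in> snd c ` (fst c \<inter> fst c') \<times> {B. det B \<noteq> 0}"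
  shows "coord_rep frame_base (frame_chart c) c' q = coord_rep id c c' (fst q)"
proof -
  obtain x B where xB: "x \<in> fst c" "x \<in> fst c'" "det B \<noteq> 0" "q = (snd c x, B)" using q by auto
  show ?thesis
    unfolding xB(4) fst_conv coord_rep_coord[OF atlas c(1) xB(1)]
    by (simp add: coord_rep_def chart_inv_frame_chart[OF c(1) xB(1,3)])
qed

lemma atlas_holo_frame_base: "atlas_holo I_frame FA I_vec A frame_base"
proof -
  have "open (snd C ` (fst C \<inter> frame_base -` fst c')) \<and>
    holo_on I_frame I_vec (snd C ` (fst C \<inter> frame_base -` fst c')) (coord_rep frame_base C c')"
    if C: "C \<in> FA" and c': "c' \<in> A" for C c'
  proof -
    obtain c where c: "c \<in> A" "C = frame_chart c" using C unfolding frame_atlas_eq by auto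
    let ?S = "snd c ` (fst c \<inter> fst c')" and ?T = "snd c ` (fst c \<inter> fst c') \<times> {B :: complex^'n^'n. det B \<noteq> 0}"
    have S: "open ?S" by (rule open_overlap[OF atlas c(1) c'])
    have op: "open ?T" by (intro open_Times S open_det_nonzero)
    have r: "smooth_on ?S (coord_rep id c c')" "\<And>q w. q \<in> ?S \<Longrightarrow> dd (coord_rep id c c') (I_vec w) q = I_vec (dd (coord_rep id c c') w q)"
      using atlas_holo_rep(2,3)[OF atlas_holo_id[OF atlas] c(1) c'] by auto
    let ?f = "\<lambda>p :: (complex^'n) \<times> ((complex^'n)^'n). coord_rep id c c' (fst p)"
    have s: "smooth_on ?T ?f"
      by (rule smooth_on_compose[OF op S r(1) smooth_on_fst[OF op smooth_on_id[OF op]]]) auto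
    have "dd ?f W p = dd (coord_rep id c c') (fst W) (fst p)" if "p \<in> ?T" for W p
    proof -
      have "(fst has_derivative fst) (at p)" by (intro derivative_eq_intros) auto
      then have "(?f has_derivative (\<lambda>W. dd (coord_rep id c c') (fst W) (fst p))) (at p)"
        by (rule has_derivative_compose) (rule smooth_on_has_derivative[OF r(1) S], use that in auto)
      then show ?thesis by (rule dd_eqI)
    qed
    moreover have "fst (I_frame W) = I_vec (fst W)" for W :: "(complex^'n) \<times> ((complex^'n)^'n)"
      by (simp add: I_frame_def I_vec_def split_beta)
    ultimately have "holo_on I_frame I_vec ?T ?f"
      unfolding holo_on_def using s r(2) by (auto simp: mem_Times_iff)
    then have "holo_on I_frame I_vec ?T (coord_rep frame_base (frame_chart c) c')"
      by (rule holo_on_cong[OF op, rotated]) (simp add: frame_base_rep[OF c(1) c'])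
    then show ?thesis using op unfolding c(2) frame_base_image[OF c(1) c'] by blast
  qed
  then show ?thesis
    unfolding atlas_holo_def carrier_frame_atlas using linear_atlas_frame atlas frame_base_in by blast
qed

abbreviation "mk_frame_tvec c u \<equiv> mk_tvec FA (frame_chart c) u"

lemma pushforward_frame_base:
  assumes c: "c \<in> A" "x \<in> fst c" and B: "det B \<noteq> 0"
  shows "pushforward FA A frame_base (mk_frame_tvec c (frame_of c x B) W) = mk_tvec A c x (fst W)"
proof -
  let ?u = "frame_of c x B" and ?T = "snd c ` fst c \<times> {B :: complex^'n^'n. det B \<noteq> 0}"
  have op: "open ?T" by (intro open_Times open_coord_image[OF atlas c(1)] open_det_nonzero)
  have "(fst has_derivative fst) (at (snd c x, B))" by (intro derivative_eq_intros) auto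
  then have "(coord_rep frame_base (frame_chart c) c has_derivative fst) (at (snd c x, B))"
  proof (rule has_derivative_transform_within_open[OF _ op])
    show "(snd c x, B) \<in> ?T" using c B by simp
    show "fst q = coord_rep frame_base (frame_chart c) c q" if "q \<in> ?T" for q
      using frame_base_rep[OF c(1) c(1), of q] that by (auto simp: coord_rep_coord[OF atlas c(1)])
  qed
  from dd_eqI[OF this]
  have "dd (coord_rep frame_base (frame_chart c) c) W (snd (frame_chart c) ?u) = fst W"
    unfolding frame_chart_coord[OF c] .
  then show ?thesis
    using pushforward_mk_tvec[OF atlas_holo_frame_base frame_chart_in[OF c(1)] frame_of_in_chart[OF c B] c(1), of W] c(2)
    by simp
qed

section \<open>Tangent spaces of the unitary frame bundle\<close>

abbreviation "Psi_rep c \<equiv> levi_matrix.Psi (finsler_chart_pre.Hm (F_rep c)) k0"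
abbreviation "Lam_rep c \<equiv> levi_matrix.Lam (finsler_chart_pre.Hm (F_rep c)) k0"

text \<open>Replaces a set of velocities by a system of linear equations; what follows on horizontal
  and vertical spaces is linear algebra with these equations.\<close>

lemma sub_tspace_unitary:
  assumes c: "c \<in> A" "x \<in> fst c" and B: "det B \<noteq> 0" and u: "frame_of c x B \<in> unitary"
  shows "mk_frame_tvec c (frame_of c x B) W \<in> sub_tspace FA unitary (frame_of c x B) \<longleftrightarrow>
    (\<forall>j k. dd (Psi_rep c j k) W (snd c x, B) = 0)"
proof -
  interpret m: levi_matrix "snd c ` fst c" "finsler_chart_pre.Hm (F_rep c)" k0 by (rule levi_matrix_chart[OF c(1)])
  note sub = sub_tspace_chart[OF linear_atlas_frame frame_chart_in[OF c(1)] frame_of_in_chart[OF c B]]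
  show ?thesis
    unfolding sub
  proof (intro iffI; (elim exE conjE)?)
    fix \<gamma> and e :: real assume e: "0 < e" and g: "\<gamma> ` {-e<..<e} \<subseteq> unitary \<inter> fst (frame_chart c)" "\<gamma> 0 = frame_of c x B"
      "(snd (frame_chart c) \<circ> \<gamma> has_vector_derivative W) (at 0)"
    have "m.orthonormal ((snd (frame_chart c) \<circ> \<gamma>) t)" if t: "t \<in> {-e<..<e}" for t
    proof -
      have "\<gamma> t \<in> unitary" "\<gamma> t \<in> fst (frame_chart c)" using g(1) t by auto
      moreover obtain y C where "y \<in> fst c" "det C \<noteq> 0" "\<gamma> t = frame_of c y C"
        using frame_chartE[OF c(1) \<open>\<gamma> t \<in> fst (frame_chart c)\<close>] .
      ultimately show ?thesis
        using frame_of_unitary_iff[OF c(1)] frame_chart_coord[OF c(1)] by simp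
    qed
    then show "\<forall>j k. dd (Psi_rep c j k) W (snd c x, B) = 0"
      using m.orthonormal_curve_velocity[OF e _ g(3)] g(2) frame_chart_coord[OF c] by simp
  next
    assume k: "\<forall>j k. dd (Psi_rep c j k) W (snd c x, B) = 0"
    have "m.orthonormal (snd c x, B)" using u frame_of_unitary_iff[OF c B] by blast
    then obtain e d where e: "e > 0" and d: "smooth_on {-e<..<e::real} d" "d 0 = (snd c x, B)"
        "(d has_vector_derivative W) (at 0)" "\<forall>t\<in>{-e<..<e}. m.orthonormal (d t)"
      using m.kernel_curve[of "(snd c x, B)" W] k by blast
    \<comment> \<open>The coordinate curve is read back as a curve of frames; its matrices are
      invertible because orthonormal rows are independent.\<close>
    define \<gamma> where "\<gamma> t = frame_of c (chart_inv c (fst (d t))) (snd (d t))" for t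
    have in_c: "fst (d t) \<in> snd c ` fst c" "det (snd (d t)) \<noteq> 0" if "t \<in> {-e<..<e}" for t
      using d(4) that m.orthonormal_det unfolding m.orthonormal_def by blast+
    have gc: "snd (frame_chart c) (\<gamma> t) = d t" "\<gamma> t \<in> unitary \<inter> fst (frame_chart c)" if t: "t \<in> {-e<..<e}" for t
    proof -
      note y = chart_inv_in[OF in_c(1)[OF t]] and yc = coord_chart_inv[OF in_c(1)[OF t]]
      show "snd (frame_chart c) (\<gamma> t) = d t"
        unfolding \<gamma>_def using frame_chart_coord[OF c(1) y] yc by simp
      show "\<gamma> t \<in> unitary \<inter> fst (frame_chart c)"
        unfolding \<gamma>_def using frame_of_unitary_iff[OF c(1) y in_c(2)[OF t]] frame_of_in_chart[OF c(1) y in_c(2)[OF t]] yc d(4) t by simp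
    qed
    have "smooth_on {-e<..<e} (snd (frame_chart c) \<circ> \<gamma>)"
      using d(1) smooth_on_cong[of "{-e<..<e}" d "snd (frame_chart c) \<circ> \<gamma>"] gc(1) by simp
    moreover have "((snd (frame_chart c) \<circ> \<gamma>) has_vector_derivative W) (at 0)"
      by (rule has_vector_derivative_transform_within_open[OF d(3), where S = "{-e<..<e}"]) (use e gc(1) in auto)
    moreover have "\<gamma> 0 = frame_of c x B" by (simp add: \<gamma>_def d(2) chart_inv_coord[OF atlas c])
    moreover have "\<gamma> ` {-e<..<e} \<subseteq> unitary \<inter> fst (frame_chart c)" using gc(2) by blast
    ultimately show "\<exists>\<gamma>. \<exists>e>0. \<gamma> ` {-e<..<e} \<subseteq> unitary \<inter> fst (frame_chart c) \<and> \<gamma> 0 = frame_of c x B \<and>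
       smooth_on {-e<..<e} (snd (frame_chart c) \<circ> \<gamma>) \<and> (snd (frame_chart c) \<circ> \<gamma> has_vector_derivative W) (at 0)"
      using e by blast
  qed
qed

lemma unitary_subset: "unitary \<subseteq> frame_bundle A"
  unfolding unitary_frame_bundle_def by blast

lemma unitaryE:
  assumes "u \<in> unitary"
  obtains c x B where "c \<in> A" "x \<in> fst c" "det B \<noteq> 0" "u = frame_of c x B"
proof -
  have u: "u \<in> frame_bundle A" using assms unitary_subset by blast
  note c = chart_at[OF frame_base_in[OF u]]
  show ?thesis using that[OF c frame_eq_frame_of(2)[OF u c] frame_eq_frame_of(1)[OF u c]] .
qed

end

section \<open>The Hermitian connection\<close>

context finsler_manifold
begin

text \<open>The largest part of the tangent space of the bundle that is invariant under
  \<open>frame_J\<close>: the intersection of this space with its image under the complex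
  structure.\<close>

definition horizontal :: "('a, 'n) frame \<Rightarrow> ('a, 'n) frame_tvec set" where
  "horizontal u = {X \<in> sub_tspace FA unitary u. frame_J X \<in> sub_tspace FA unitary u}"

definition connection :: "('a, 'n) frame_tvec set" where
  "connection = (\<Union>u\<in>unitary. horizontal u)"

lemma horizontal_sub_tspace: "X \<in> horizontal u \<Longrightarrow> X \<in> sub_tspace FA unitary u"
  unfolding horizontal_def by simp

lemma horizontal_tspace: "X \<in> horizontal u \<Longrightarrow> X \<in> tspace FA u"
  by (rule subsetD[OF sub_tspace_subset horizontal_sub_tspace])

lemma fst_horizontal: "X \<in> horizontal u \<Longrightarrow> fst X = u"
  by (rule fst_tspace[OF horizontal_tspace])

lemma fibre_connection: "u \<in> unitary \<Longrightarrow> fibre connection u = horizontal u"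
  unfolding fibre_def connection_def using fst_horizontal by auto

lemma mk_frame_tvec_horizontal:
  assumes c: "c \<in> A" "x \<in> fst c" and B: "det B \<noteq> 0" and u: "frame_of c x B \<in> unitary"
  shows "mk_frame_tvec c (frame_of c x B) W \<in> horizontal (frame_of c x B) \<longleftrightarrow> snd W = Lam_rep c (snd c x, B) (fst W)"
proof -
  interpret m: levi_matrix "snd c ` fst c" "finsler_chart_pre.Hm (F_rep c)" k0 by (rule levi_matrix_chart[OF c(1)])
  have q: "(snd c x, B) \<in> m.dom" using m.orthonormal_dom frame_of_unitary_iff[OF c B] u by blast
  have J: "frame_J (mk_frame_tvec c (frame_of c x B) W) = mk_frame_tvec c (frame_of c x B) (I_frame W)"
    unfolding frame_J_def by (rule tv_J_mk_tvec[OF linear_atlas_frame frame_chart_in[OF c(1)] frame_of_in_chart[OF c B]])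
  have "mk_frame_tvec c (frame_of c x B) W \<in> horizontal (frame_of c x B) \<longleftrightarrow>
      (\<forall>j k. dd (m.Psi j k) W (snd c x, B) = 0 \<and> dd (m.Psi j k) (I_frame W) (snd c x, B) = 0)"
    unfolding horizontal_def mem_Collect_eq J sub_tspace_unitary[OF c B u] by blast
  also have "\<dots> \<longleftrightarrow> snd W = m.Lam (snd c x, B) (fst W)"
    unfolding m.kernel_eq_holomorphic_kernel[OF q] using m.horizontal_iff[OF q] B by simp
  finally show ?thesis .
qed

lemma linear_Lam_rep:
  assumes c: "c \<in> A" "x \<in> fst c" and B: "det B \<noteq> 0" and u: "frame_of c x B \<in> unitary"
  shows "linear (Lam_rep c (snd c x, B))"
proof -
  interpret m: levi_matrix "snd c ` fst c" "finsler_chart_pre.Hm (F_rep c)" k0 by (rule levi_matrix_chart[OF c(1)])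
  have "(snd c x, B) \<in> m.dom" using m.orthonormal_dom frame_of_unitary_iff[OF c B] u by blast
  then show ?thesis using m.linear_Lam B by simp
qed

lemma horizontal_eq_image:
  assumes c: "c \<in> A" "x \<in> fst c" and B: "det B \<noteq> 0" and u: "frame_of c x B \<in> unitary"
  shows "horizontal (frame_of c x B) =
    mk_frame_tvec c (frame_of c x B) ` range (\<lambda>\<xi>. (\<xi>, Lam_rep c (snd c x, B) \<xi>))" (is "?L = ?R")
proof (intro set_eqI iffI)
  fix X assume X: "X \<in> ?L"
  then have "X \<in> tspace FA (frame_of c x B)" by (rule horizontal_tspace)
  then obtain W where W: "X = mk_frame_tvec c (frame_of c x B) W"
    using tspaceE[OF linear_atlas_frame frame_chart_in[OF c(1)] frame_of_in_chart[OF c B]] by metis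
  have "W = (fst W, Lam_rep c (snd c x, B) (fst W))"
    using X unfolding W mk_frame_tvec_horizontal[OF assms] by (simp add: prod_eq_iff)
  then show "X \<in> ?R" unfolding W by blast
next
  fix X assume "X \<in> ?R"
  then show "X \<in> ?L" using mk_frame_tvec_horizontal[OF assms] by auto
qed

lemma linear_graph: "linear L \<Longrightarrow> linear (\<lambda>\<xi>. (\<xi>, L \<xi>))"
  by (rule linearI) (simp_all add: linear_add linear_scale)

lemma dim_graph:
  fixes L :: "complex^'n \<Rightarrow> 'e::euclidean_space"
  assumes "linear L"
  shows "dim (range (\<lambda>\<xi>. (\<xi>, L \<xi>))) = 2 * CARD('n)"
proof -
  have "inj_on (\<lambda>\<xi>. (\<xi>, L \<xi>)) (span UNIV)" by (rule inj_onI) simp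
  from dim_image_eq[OF linear_graph[OF assms] this] show ?thesis by simp
qed

lemma subspace_graph: "linear L \<Longrightarrow> subspace (range (\<lambda>\<xi>. (\<xi>, L \<xi>)))"
  by (rule linear_subspace_image[OF linear_graph subspace_UNIV])

text \<open>\<open>distribution\<close> asks for fields on open sets of the ambient frame bundle.
  \<open>Lam_rep\<close> makes sense for all frames over the chart, unitary or not, and so provides
  the extension.\<close>

lemma horizontal_field:
  assumes c: "c \<in> A"
  shows "smooth_field FA (fst (frame_chart c))
    (\<lambda>p. mk_tvec FA (frame_chart c) p (b, Lam_rep c (snd (frame_chart c) p) b))"
  unfolding smooth_field_def
proof (intro conjI ballI)
  fix p assume "p \<in> fst (frame_chart c)"
  then show "mk_tvec FA (frame_chart c) p (b, Lam_rep c (snd (frame_chart c) p) b) \<in> tspace FA p"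
    by (rule mk_tvec_in[OF frame_chart_in[OF c]])
next
  fix C assume C: "C \<in> FA"
  interpret m: levi_matrix "snd c ` fst c" "finsler_chart_pre.Hm (F_rep c)" k0 by (rule levi_matrix_chart[OF c])
  note FAl = linear_atlas_frame and cF = frame_chart_in[OF c] and Cid = atlas_holo_id[OF linear_atlas_frame]
  let ?c = "frame_chart c"
  let ?S = "snd C ` (fst ?c \<inter> fst C)" and ?T = "snd ?c ` (fst ?c \<inter> fst C)"
  \<comment> \<open>Smoothness is required in every chart \<open>C\<close>: \<open>?\<tau>\<close>
    carries the point to the coordinates in which the field is explicit, and the Jacobian of
    \<open>?\<sigma>\<close> carries the value back.\<close>
  let ?\<tau> = "coord_rep id C ?c" and ?\<sigma> = "coord_rep id ?c C"
  have S: "open ?S" using open_overlap[OF FAl C cF] by (simp add: Int_commute)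
  have T: "open ?T" by (rule open_overlap[OF FAl cF C])
  have \<tau>: "smooth_on ?S ?\<tau>" using atlas_holo_rep(2)[OF Cid C cF] by (simp add: Int_commute)
  have \<sigma>: "smooth_on ?T ?\<sigma>" using atlas_holo_rep(2)[OF Cid cF C] by simp
  have \<tau>S: "?\<tau> ` ?S \<subseteq> ?T"
  proof
    fix p assume "p \<in> ?\<tau> ` ?S"
    then obtain u where u: "u \<in> fst ?c" "u \<in> fst C" "p = ?\<tau> (snd C u)" by blast
    then have "p = snd ?c u" using coord_rep_coord[OF FAl C, of u id ?c] by simp
    then show "p \<in> ?T" using u by blast
  qed
  have "?T \<subseteq> m.dom"
  proof
    fix q assume "q \<in> ?T"
    then obtain u where u: "u \<in> fst ?c" "q = snd ?c u" by auto
    obtain x B where x: "x \<in> fst c" "det B \<noteq> 0" "u = frame_of c x B" using frame_chartE[OF c u(1)] .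
    have "B $ k0 \<noteq> 0" by (rule row_nonzero_of_det[OF x(2)])
    then show "q \<in> m.dom" unfolding u(2) x(3) frame_chart_coord[OF c x(1)] m.dom_def using x(1) by simp
  qed
  from m.smooth_Lam[OF T this, of b]
  have Lam: "smooth_on ?S (\<lambda>q. m.Lam (?\<tau> q) b)"
    by (rule smooth_on_compose[OF S T _ \<tau> \<tau>S])
  have "smooth_on ?S (\<lambda>q. dd ?\<sigma> (b, m.Lam (?\<tau> q) b) (?\<tau> q))"
    by (rule smooth_on_dd_apply[OF S T \<sigma> \<tau> \<tau>S smooth_on_Pair[OF S smooth_on_const[OF S] Lam]])
  moreover have "dd ?\<sigma> (b, m.Lam (?\<tau> q) b) (?\<tau> q) =
      snd (mk_tvec FA ?c (chart_inv C q) (b, m.Lam (snd ?c (chart_inv C q)) b)) C" if q: "q \<in> ?S" for q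
  proof -
    have "chart_inv C q \<in> fst C" using q by (intro chart_inv_in) auto
    then show ?thesis by (simp add: snd_mk_tvec_other[OF C] coord_rep_def[of id C])
  qed
  ultimately show "smooth_on ?S (\<lambda>q. snd (mk_tvec FA ?c (chart_inv C q) (b, m.Lam (snd ?c (chart_inv C q)) b)) C)"
    using smooth_on_cong[OF S, of "\<lambda>q. dd ?\<sigma> (b, m.Lam (?\<tau> q) b) (?\<tau> q)"
      "\<lambda>q. snd (mk_tvec FA ?c (chart_inv C q) (b, m.Lam (snd ?c (chart_inv C q)) b)) C"] by blast
qed

section \<open>Existence of the connection\<close>

lemma distribution_connection: "distribution FA unitary (2 * CARD('n)) connection"
  unfolding distribution_def
proof (intro conjI ballI)
  show "connection \<subseteq> (\<Union>x\<in>unitary. sub_tspace FA unitary x)"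
    unfolding connection_def horizontal_def by blast
next
  fix u assume uU: "u \<in> unitary"
  obtain c x B where c: "c \<in> A" "x \<in> fst c" and B: "det B \<noteq> 0" and u: "u = frame_of c x B" using unitaryE[OF uU] .
  note F = linear_atlas_frame frame_chart_in[OF c(1)] frame_of_in_chart[OF c B]
  note lin = linear_Lam_rep[OF c B uU[unfolded u]] and im = horizontal_eq_image[OF c B uU[unfolded u]]
  show "tsubspace FA u (fibre connection u)"
    unfolding fibre_connection[OF uU] unfolding u im tsubspace_mk_tvec[OF F] by (rule subspace_graph[OF lin])
  show "tdim FA u (fibre connection u) = 2 * CARD('n)"
    unfolding fibre_connection[OF uU] unfolding u im tdim_mk_tvec[OF F] by (rule dim_graph[OF lin])
next
  fix u assume uU: "u \<in> unitary"
  obtain c x B where c: "c \<in> A" "x \<in> fst c" and B: "det B \<noteq> 0" and u: "u = frame_of c x B" using unitaryE[OF uU] .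
  \<comment> \<open>An enumeration of the real basis of the base coordinates; its images under the
    graph map are the spanning fields, and their number is the required rank.\<close>
  obtain b where b: "bij_betw b {0..<card (Basis :: (complex^'n) set)} (Basis :: (complex^'n) set)"
    using ex_bij_betw_nat_finite[OF finite_Basis] by blast
  have "card (Basis :: (complex^'n) set) = 2 * CARD('n)" by simp
  then have b: "b ` {..<2 * CARD('n)} = (Basis :: (complex^'n) set)"
    using b unfolding bij_betw_def lessThan_atLeast0 by metis
  let ?W = "fst (frame_chart c)"
  define X where "X i p = mk_tvec FA (frame_chart c) p (b i, Lam_rep c (snd (frame_chart c) p) (b i))" for i p
  have "fibre connection p = tspan FA p ((\<lambda>i. X i p) ` {..<2 * CARD('n)})" if p: "p \<in> ?W \<inter> unitary" for p
  proof -
    obtain y C where y: "y \<in> fst c" "det C \<noteq> 0" "p = frame_of c y C" using frame_chartE[OF c(1)] p by blast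
    have pU: "frame_of c y C \<in> unitary" and pW: "p \<in> unitary" using p y(3) by auto
    let ?G = "\<lambda>\<xi>. (\<xi>, Lam_rep c (snd c y, C) \<xi>)"
    have "(\<lambda>i. X i p) ` {..<2 * CARD('n)} = mk_frame_tvec c p ` ?G ` b ` {..<2 * CARD('n)}"
      unfolding X_def image_image y(3) frame_chart_coord[OF c(1) y(1)] ..
    also have "\<dots> = mk_frame_tvec c p ` ?G ` Basis" unfolding b ..
    finally have "tspan FA p ((\<lambda>i. X i p) ` {..<2 * CARD('n)}) = mk_frame_tvec c p ` span (?G ` Basis)"
      using tspan_mk_tvec[OF linear_atlas_frame frame_chart_in[OF c(1)], of p] p by simp
    also have "span (?G ` Basis) = ?G ` span Basis"
      by (rule linear_span_image[OF linear_graph[OF linear_Lam_rep[OF c(1) y(1,2) pU]]])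
    finally show ?thesis
      unfolding fibre_connection[OF pW] unfolding y(3) horizontal_eq_image[OF c(1) y(1,2) pU] by simp
  qed
  moreover have "openin (atlas_topology FA) ?W" by (rule openin_chart_domain[OF linear_atlas_frame frame_chart_in[OF c(1)]])
  moreover have "u \<in> ?W" unfolding u by (rule frame_of_in_chart[OF c B])
  moreover have "smooth_field FA ?W (X i)" for i unfolding X_def[abs_def] by (rule horizontal_field[OF c(1)])
  ultimately show "\<exists>W X. openin (atlas_topology FA) W \<and> u \<in> W \<and> (\<forall>i<2 * CARD('n). smooth_field FA W (X i)) \<and>
      (\<forall>p\<in>W \<inter> unitary. fibre connection p = tspan FA p ((\<lambda>i. X i p) ` {..<2 * CARD('n)}))"
    by (intro exI[of _ ?W] exI[of _ X]) blast
qed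

lemma vertical_mk_frame_tvec:
  assumes c: "c \<in> A" "x \<in> fst c" and B: "det B \<noteq> 0" and u: "frame_of c x B \<in> unitary"
  shows "mk_frame_tvec c (frame_of c x B) W \<in> vertical_space A F k0 (frame_of c x B) \<longleftrightarrow>
    mk_frame_tvec c (frame_of c x B) W \<in> sub_tspace FA unitary (frame_of c x B) \<and> fst W = 0"
  unfolding vertical_space_def mem_Collect_eq pushforward_frame_base[OF c B] frame_base_frame_of
  using mk_tvec_zero_iff[OF c] by simp

text \<open>The horizontal space is a graph over the base directions, while vertical vectors have
  base component 0. Subtracting from a tangent vector the graph vector over the same base component
  leaves a vertical one.\<close>

lemma connection_complementary:
  assumes uU: "u \<in> unitary"
  shows "fibre connection u \<inter> vertical_space A F k0 u = {tv_zero u}" (is "?C1")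
    and "{tv_add X Y | X Y. X \<in> fibre connection u \<and> Y \<in> vertical_space A F k0 u} = sub_tspace FA unitary u" (is "?C2")
proof -
  obtain c x B where c: "c \<in> A" "x \<in> fst c" and B: "det B \<noteq> 0" and u: "u = frame_of c x B" using unitaryE[OF uU] .
  interpret m: levi_matrix "snd c ` fst c" "finsler_chart_pre.Hm (F_rep c)" k0 by (rule levi_matrix_chart[OF c(1)])
  note U = uU[unfolded u]
  note F = linear_atlas_frame frame_chart_in[OF c(1)] frame_of_in_chart[OF c B, folded u]
  let ?mk = "mk_frame_tvec c u" and ?q = "(snd c x, B)"
  note hor = mk_frame_tvec_horizontal[OF c B U, folded u] and sub = sub_tspace_unitary[OF c B U, folded u]
    and ver = vertical_mk_frame_tvec[OF c B U, folded u]
  note fc = fibre_connection[OF uU]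
  have q: "?q \<in> m.dom" using m.orthonormal_dom frame_of_unitary_iff[OF c B] U by blast
  have lin: "linear (\<lambda>W. dd (m.Psi j k) W ?q)" for j k by (rule dd_linear[OF m.smooth_Psi m.open_dom q])
  have L0: "m.Lam ?q 0 = 0" by (rule linear_0[OF linear_Lam_rep[OF c B U]])
  have ex: "\<exists>W. X = ?mk W" if "X \<in> tspace FA u" for X
    using tspaceE[OF F that] by metis
  have h_sub: "?mk W \<in> sub_tspace FA unitary u" if "?mk W \<in> horizontal u" for W
    by (rule horizontal_sub_tspace[OF that])
  have z: "?mk 0 = tv_zero u" by (rule tv_zero_mk_tvec[OF F])
  have "?mk 0 \<in> sub_tspace FA unitary u" unfolding sub using linear_0[OF lin] by simp
  then have 0: "?mk 0 \<in> horizontal u" "?mk 0 \<in> vertical_space A F k0 u"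
    unfolding hor ver using L0 by simp_all
  show "?C1"
    unfolding fc
  proof
    show "{tv_zero u} \<subseteq> horizontal u \<inter> vertical_space A F k0 u" using 0 unfolding z by simp
    show "horizontal u \<inter> vertical_space A F k0 u \<subseteq> {tv_zero u}"
    proof
      fix X assume X: "X \<in> horizontal u \<inter> vertical_space A F k0 u"
      then have "X \<in> tspace FA u" using horizontal_tspace by blast
      then obtain W where W: "X = ?mk W" using ex by blast
      have "fst W = 0" "snd W = m.Lam ?q (fst W)" using X unfolding W Int_iff hor ver by auto
      then have "W = 0" using L0 by (simp add: prod_eq_iff)
      then show "X \<in> {tv_zero u}" unfolding W using z by simp
    qed
  qed
  show "?C2"
    unfolding fc
  proof (intro set_eqI iffI)
    fix Z assume "Z \<in> {tv_add X Y | X Y. X \<in> horizontal u \<and> Y \<in> vertical_space A F k0 u}"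
    then obtain X Y where Z: "Z = tv_add X Y" and X: "X \<in> horizontal u" and Y: "Y \<in> vertical_space A F k0 u" by blast
    have "Y \<in> sub_tspace FA unitary u" using Y unfolding vertical_space_def by simp
    then have "X \<in> tspace FA u" "Y \<in> tspace FA u"
      using horizontal_tspace[OF X] by (simp_all add: subsetD[OF sub_tspace_subset])
    then obtain V W where V: "X = ?mk V" and W: "Y = ?mk W" using ex by meson
    have "\<forall>j k. dd (m.Psi j k) V ?q = 0" "\<forall>j k. dd (m.Psi j k) W ?q = 0"
      using h_sub X Y unfolding V W ver sub by blast+
    then show "Z \<in> sub_tspace FA unitary u"
      unfolding Z V W tv_add_mk_tvec[OF F] sub using linear_add[OF lin] by simp
  next
    fix Z assume Z: "Z \<in> sub_tspace FA unitary u"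
    then have "Z \<in> tspace FA u" by (rule subsetD[OF sub_tspace_subset])
    then obtain W where W: "Z = ?mk W" using ex by blast
    let ?h = "(fst W, m.Lam ?q (fst W))"
    have h: "?mk ?h \<in> horizontal u" unfolding hor by simp
    have "\<forall>j k. dd (m.Psi j k) ?h ?q = 0" using h_sub[OF h] unfolding sub .
    moreover have "\<forall>j k. dd (m.Psi j k) W ?q = 0" using Z unfolding W sub .
    ultimately have "?mk (W - ?h) \<in> sub_tspace FA unitary u" unfolding sub using linear_diff[OF lin] by simp
    then have "?mk (W - ?h) \<in> vertical_space A F k0 u" unfolding ver by simp
    moreover have "Z = tv_add (?mk ?h) (?mk (W - ?h))" unfolding W tv_add_mk_tvec[OF F] by simp
    ultimately show "Z \<in> {tv_add X Y | X Y. X \<in> horizontal u \<and> Y \<in> vertical_space A F k0 u}" using h by blast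
  qed
qed

lemma nonlinear_connection_connection: "nonlinear_connection A F k0 connection"
  unfolding nonlinear_connection_def using distribution_connection connection_complementary by blast

lemma frame_J_frame_J:
  assumes "u \<in> unitary" "X \<in> tspace FA u"
  shows "frame_J (frame_J X) = tv_scale (- 1) X"
proof -
  obtain c x B where c: "c \<in> A" "x \<in> fst c" and B: "det B \<noteq> 0" and u: "u = frame_of c x B" using unitaryE[OF assms(1)] .
  note F = linear_atlas_frame frame_chart_in[OF c(1)] frame_of_in_chart[OF c B, folded u]
  obtain W where W: "X = mk_frame_tvec c u W" using tspaceE[OF F assms(2)] .
  have "I_frame (I_frame W) = - W" by (simp add: I_frame_def split_beta prod_eq_iff vec_eq_iff)
  then show ?thesis unfolding W frame_J_def tv_J_mk_tvec[OF F] tv_scale_mk_tvec[OF F] by simp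
qed

text \<open>Applying the complex structure exchanges the two conditions that define
  \<open>horizontal\<close>, up to the sign in J^2 = -1; the sign is absorbed because the fibre is a
  subspace.\<close>

lemma hermitian_type_connection: "hermitian_type A F k0 connection"
  unfolding hermitian_type_def
proof (intro ballI)
  fix u X assume uU: "u \<in> unitary" and X: "X \<in> fibre connection u"
  have X: "X \<in> horizontal u" using X unfolding fibre_connection[OF uU] .
  then have XT: "X \<in> tspace FA u" by (rule horizontal_tspace)
  obtain c x B where c: "c \<in> A" "x \<in> fst c" and B: "det B \<noteq> 0" and u: "u = frame_of c x B" using unitaryE[OF uU] .
  note F = linear_atlas_frame frame_chart_in[OF c(1)] frame_of_in_chart[OF c B, folded u]
  have "tsubspace FA u (fibre connection u)" using distribution_connection uU unfolding distribution_def by blast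
  then have "tv_scale (- 1) X \<in> horizontal u" using X unfolding fibre_connection[OF uU] tsubspace_def by blast
  then have "frame_J (frame_J X) \<in> sub_tspace FA unitary u"
    unfolding frame_J_frame_J[OF uU XT] horizontal_def by blast
  then show "frame_J X \<in> fibre connection u"
    unfolding fibre_connection[OF uU] using X by (simp add: horizontal_def)
qed

text \<open>Each fibre is tangent to the bundle and invariant under \<open>frame_J\<close>, hence
  contained in \<open>horizontal u\<close>; both are subspaces of the same dimension.\<close>

lemma hermitian_connection_unique:
  assumes H: "nonlinear_connection A F k0 H" "hermitian_type A F k0 H"
  shows "H = connection"
proof -
  have HD: "distribution FA unitary (2 * CARD('n)) H" using H(1) unfolding nonlinear_connection_def by blast
  have Hsub: "H \<subseteq> (\<Union>x\<in>unitary. sub_tspace FA unitary x)" using HD unfolding distribution_def by blast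
  have fst_sub: "fst X = x" if "X \<in> sub_tspace FA unitary x" for X x
    by (rule fst_tspace[OF subsetD[OF sub_tspace_subset that]])
  have fib: "fibre H u = horizontal u" if uU: "u \<in> unitary" for u
  proof -
    obtain c x B where c: "c \<in> A" "x \<in> fst c" and B: "det B \<noteq> 0" and u: "u = frame_of c x B" using unitaryE[OF uU] .
    note F = linear_atlas_frame frame_chart_in[OF c(1)] frame_of_in_chart[OF c B, folded u]
    note U = uU[unfolded u]
    let ?V0 = "range (\<lambda>\<xi>. (\<xi>, Lam_rep c (snd c x, B) \<xi>))"
    have in_sub: "X \<in> sub_tspace FA unitary u" if "X \<in> fibre H u" for X
      using that Hsub fst_sub unfolding fibre_def by blast
    have "tsubspace FA u (fibre H u)" and dimH: "tdim FA u (fibre H u) = 2 * CARD('n)"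
      using HD uU unfolding distribution_def by blast+
    then obtain V where V: "fibre H u = mk_frame_tvec c u ` V" "subspace V" using tsubspace_imp_image[OF F] by metis
    have "fibre H u \<subseteq> horizontal u"
      using in_sub H(2) uU unfolding horizontal_def hermitian_type_def by blast
    then have "mk_frame_tvec c u ` V \<subseteq> mk_frame_tvec c u ` ?V0"
      unfolding V(1) horizontal_eq_image[OF c B U, folded u] .
    then have "V \<subseteq> ?V0" by (simp only: inj_image_subset_iff[OF inj_mk_tvec[OF F]])
    moreover have "dim V = 2 * CARD('n)" using dimH unfolding V(1) tdim_mk_tvec[OF F] .
    moreover have "dim ?V0 = 2 * CARD('n)" by (rule dim_graph[OF linear_Lam_rep[OF c B U]])
    ultimately have "V = ?V0"
      by (intro subspace_dim_equal V(2) subspace_graph[OF linear_Lam_rep[OF c B U]]) auto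
    then show ?thesis unfolding V(1) horizontal_eq_image[OF c B U, folded u] by simp
  qed
  have "H = (\<Union>u\<in>unitary. fibre H u)"
    unfolding fibre_def using Hsub fst_sub by blast
  also have "\<dots> = connection" unfolding connection_def using fib by simp
  finally show ?thesis .
qed

section \<open>Invariance under biholomorphic isometries\<close>

text \<open>A description free of charts, in terms of \<open>finsler_h\<close> alone: once an
  isometry is known to preserve this form, it preserves the bundle, with no separate argument for
  the complex tangent spaces of the indicatrices.\<close>

lemma unitary_iff:
  assumes u: "u \<in> frame_bundle A"
  shows "u \<in> unitary \<longleftrightarrow>
    (\<forall>j k. finsler_h F (f_even u k0) (e_vec u j) (ct_cnj (e_vec u k)) = (if j = k then 1 else 0))"
proof -
  note c = chart_at[OF frame_base_in[OF u]]
  note e = frame_eq_frame_of[OF u c]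
  let ?c = "chart_at A (frame_base u)"
  obtain B where B: "u = frame_of ?c (frame_base u) B" "det B \<noteq> 0" using e by blast
  interpret f: finsler_chart "snd ?c ` fst ?c" "F_rep ?c" by (rule finsler_chart[OF c(1)])
  interpret m: levi_matrix "snd ?c ` fst ?c" f.Hm k0 by (rule levi_matrix_chart[OF c(1)])
  have v: "B $ k0 \<noteq> 0" by (rule row_nonzero_of_det[OF B(2)])
  have p: "(snd ?c (frame_base u), B $ k0) \<in> f.Dom" using imageI[OF c(2), of "snd ?c"] v by simp
  have "frame_of ?c (frame_base u) B \<in> unitary \<longleftrightarrow>
    (\<forall>j k. finsler_h F (f_even (frame_of ?c (frame_base u) B) k0) (e_vec (frame_of ?c (frame_base u) B) j)
      (ct_cnj (e_vec (frame_of ?c (frame_base u) B) k)) = (if j = k then 1 else 0))"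
    unfolding frame_of_unitary_iff[OF c B(2)] finsler_h_frame_of[OF c v] m.orthonormal_def m.Psi_def fst_conv snd_conv
    using imageI[OF c(2), of "snd ?c"] by (simp add: f.levi_hform[OF p])
  then show ?thesis unfolding B(1)[symmetric] .
qed

text \<open>The pushforward is linear on a tangent space, so it takes the lines used in
  \<open>dir_deriv\<close> to lines, and functions that correspond under it have corresponding
  derivatives. This is applied to the squared metric and then to its derivative.\<close>

lemma finsler_h_pushforward:
  assumes f: "atlas_holo I_vec A I_vec A f" and iso: "\<And>v. v \<in> tbundle A \<Longrightarrow> F (pushforward A A f v) = F v"
    and x: "x \<in> carrier_of A" and v: "v \<in> tspace A x"
    and w: "fst w \<in> tspace A x" "snd w \<in> tspace A x" and z: "fst z \<in> tspace A x" "snd z \<in> tspace A x"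
  shows "finsler_h F (pushforward A A f v) (map_prod (pushforward A A f) (pushforward A A f) w)
      (map_prod (pushforward A A f) (pushforward A A f) z) = finsler_h F v w z"
proof -
  let ?P = "pushforward A A f"
  note c = chart_at[OF x]
  have lin: "tv_add a (tv_scale t b) \<in> tspace A x" "?P (tv_add a (tv_scale t b)) = tv_add (?P a) (tv_scale t (?P b))"
    if a: "a \<in> tspace A x" and b: "b \<in> tspace A x" for a b t
  proof -
    have s: "tv_scale t b \<in> tspace A x"
      using tspaceE[OF atlas c b] tv_scale_mk_tvec[OF atlas c] mk_tvec_in[OF c] by metis
    then show "tv_add a (tv_scale t b) \<in> tspace A x"
      using tspaceE[OF atlas c a] tspaceE[OF atlas c s] tv_add_mk_tvec[OF atlas c] mk_tvec_in[OF c] by metis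
    show "?P (tv_add a (tv_scale t b)) = tv_add (?P a) (tv_scale t (?P b))"
      unfolding pushforward_tv_add[OF f x a s] pushforward_tv_scale[OF f x b] ..
  qed
  have dir: "dir_deriv g (?P b) (?P a) = dir_deriv g' b a"
    if g: "\<And>y. y \<in> tspace A x \<Longrightarrow> g (?P y) = g' y" and a: "a \<in> tspace A x" and b: "b \<in> tspace A x" for g g' a b
    unfolding dir_deriv_def lin(2)[OF a b, symmetric] g[OF lin(1)[OF a b]] ..
  have cf: "const_field (map_prod ?P ?P w) g (?P a) = const_field w g' a"
    if g: "\<And>y. y \<in> tspace A x \<Longrightarrow> g (?P y) = g' y" and a: "a \<in> tspace A x"
      and w: "fst w \<in> tspace A x" "snd w \<in> tspace A x" for g g' a w
  proof -
    have "dir_deriv g (?P (fst w)) (?P a) = dir_deriv g' (fst w) a"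
      by (rule dir[where g = g and g' = g', OF g a w(1)])
    moreover have "dir_deriv g (?P (snd w)) (?P a) = dir_deriv g' (snd w) a"
      by (rule dir[where g = g and g' = g', OF g a w(2)])
    ultimately show ?thesis by (simp add: const_field_def)
  qed
  have "y \<in> tbundle A" if "y \<in> tspace A x" for y using that x unfolding tbundle_def by blast
  then have sq: "complex_of_real ((F (?P y))\<^sup>2) = complex_of_real ((F y)\<^sup>2)" if "y \<in> tspace A x" for y
    using iso that by simp
  let ?g = "\<lambda>y. complex_of_real ((F y)\<^sup>2)"
  have 1: "const_field (map_prod ?P ?P z) ?g (?P y) = const_field z ?g y" if y: "y \<in> tspace A x" for y
    by (rule cf[where g = ?g and g' = ?g, OF sq y z])
  show ?thesis unfolding finsler_h_def
    by (rule cf[where g = "const_field (map_prod ?P ?P z) ?g" and g' = "const_field z ?g", OF 1 v w])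
qed

lemma frame_lift_unitary:
  assumes fg: "biholo f g" and iso: "\<And>v. v \<in> tbundle A \<Longrightarrow> F (pushforward A A f v) = F v" and uU: "u \<in> unitary"
  shows "frame_lift A f u \<in> unitary"
proof -
  have f: "atlas_holo I_vec A I_vec A f" using fg unfolding biholo_def by auto
  have u: "u \<in> frame_bundle A" using uU unitary_subset by blast
  note x = frame_base_in[OF u] and ut = frame_in_tspace[OF u]
  note c = chart_at[OF x]
  let ?P = "pushforward A A f"
  have st: "tv_scale r (u z) \<in> tspace A (frame_base u)" for r z
    using tspaceE[OF atlas c ut] tv_scale_mk_tvec[OF atlas c] mk_tvec_in[OF c] by metis
  have sst: "tv_scale s (tv_scale r (u z)) \<in> tspace A (frame_base u)" for r s z
    using tspaceE[OF atlas c st] tv_scale_mk_tvec[OF atlas c] mk_tvec_in[OF c] by metis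
  have e: "e_vec (frame_lift A f u) l = map_prod ?P ?P (e_vec u l)" for l
    by (simp add: e_vec_def frame_lift_def f_even_def f_odd_def pushforward_tv_scale[OF f x ut])
  have ce: "ct_cnj (e_vec (frame_lift A f u) l) = map_prod ?P ?P (ct_cnj (e_vec u l))" for l
    unfolding e by (simp add: ct_cnj_def e_vec_def f_odd_def pushforward_tv_scale[OF f x st])
  have k: "f_even (frame_lift A f u) k0 = ?P (f_even u k0)" by (simp add: f_even_def frame_lift_def)
  have "finsler_h F (f_even (frame_lift A f u) k0) (e_vec (frame_lift A f u) l) (ct_cnj (e_vec (frame_lift A f u) m)) =
    finsler_h F (f_even u k0) (e_vec u l) (ct_cnj (e_vec u m))" for l m
    unfolding e[of l] ce k
    by (rule finsler_h_pushforward[OF f iso x])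
      (simp_all add: ut st sst e_vec_def ct_cnj_def f_even_def f_odd_def)
  then show ?thesis using uU unfolding unitary_iff[OF u] unitary_iff[OF frame_lift_in(1)[OF fg u]] by simp
qed

section \<open>Invariance of the connection\<close>

lemma pushforward_connection_subset:
  assumes fg: "biholo f g" and iso: "\<And>v. v \<in> tbundle A \<Longrightarrow> F (pushforward A A f v) = F v" and X: "X \<in> connection"
  shows "pushforward FA FA (frame_lift A f) X \<in> connection"
proof -
  obtain u where u: "u \<in> unitary" and X: "X \<in> horizontal u" using X unfolding connection_def by blast
  note F = atlas_holo_frame_lift[OF fg]
  have uc: "u \<in> carrier_of FA" unfolding carrier_frame_atlas using u unitary_subset by blast
  have sub: "frame_lift A f ` unitary \<subseteq> unitary" using frame_lift_unitary[OF fg iso] by blast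
  have Xs: "X \<in> sub_tspace FA unitary u" "frame_J X \<in> sub_tspace FA unitary u" using X unfolding horizontal_def by auto
  have Xt: "X \<in> tspace FA u" by (rule horizontal_tspace[OF X])
  have "frame_J (pushforward FA FA (frame_lift A f) X) = pushforward FA FA (frame_lift A f) (frame_J X)"
    unfolding frame_J_def pushforward_tv_J[OF F uc Xt] ..
  then have "pushforward FA FA (frame_lift A f) X \<in> horizontal (frame_lift A f u)"
    using pushforward_sub_tspace[OF F uc Xs(1) sub] pushforward_sub_tspace[OF F uc Xs(2) sub]
    unfolding horizontal_def by simp
  then show ?thesis using frame_lift_unitary[OF fg iso u] unfolding connection_def by blast
qed

text \<open>The inverse is an isometry too: the metric of a vector pushed along \<open>g\<close>
  does not change when it is pushed back along \<open>f\<close>, which returns the original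
  vector.\<close>

lemma biholomorphic_isometry_biholo:
  assumes "biholomorphic_isometry A F f"
  shows "\<exists>g. biholo f g \<and> (\<forall>v\<in>tbundle A. F (pushforward A A f v) = F v) \<and>
    (\<forall>v\<in>tbundle A. F (pushforward A A g v) = F v)"
proof -
  let ?g = "inv_into (carrier_of A) f"
  have bij: "bij_betw f (carrier_of A) (carrier_of A)" and h: "holomorphic_map A A f" "holomorphic_map A A ?g"
    and iso: "\<And>v. v \<in> tbundle A \<Longrightarrow> F (pushforward A A f v) = F v"
    using assms unfolding biholomorphic_isometry_def by blast+
  note f = holomorphic_map_atlas_holo[OF atlas atlas h(1)] and g = holomorphic_map_atlas_holo[OF atlas atlas h(2)]
  have inv: "?g (f x) = x" "f (?g x) = x" if "x \<in> carrier_of A" for x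
    using bij that by (auto simp: bij_betw_inv_into_left bij_betw_inv_into_right)
  have fg: "biholo f ?g" unfolding biholo_def using f g inv by blast
  have "F (pushforward A A ?g v) = F v" if v: "v \<in> tbundle A" for v
  proof -
    have x: "fst v \<in> carrier_of A" and vt: "v \<in> tspace A (fst v)" using tbundleD[OF v] by auto
    have "pushforward A A f (pushforward A A ?g v) = pushforward A A (f \<circ> ?g) v" by (rule pushforward_comp[OF g f x vt])
    also have "\<dots> = pushforward A A id v"
      using pushforward_cong[OF atlas_holo_id[OF atlas] x vt, of "f \<circ> ?g"] inv by simp
    also have "\<dots> = v" by (rule pushforward_id[OF atlas x vt])
    finally have "F v = F (pushforward A A f (pushforward A A ?g v))" by simp
    also have "pushforward A A ?g v \<in> tbundle A"
      unfolding tbundle_def using pushforward_in_tspace[OF g x vt] atlas_holoD(3)[OF g x] by blast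
    then have "F (pushforward A A f (pushforward A A ?g v)) = F (pushforward A A ?g v)" by (rule iso)
    finally show ?thesis by simp
  qed
  then show ?thesis using fg iso by blast
qed

text \<open>The inclusion for the inverse isometry supplies the preimages, and thus equality in
  place of a mere inclusion.\<close>

lemma pushforward_connection:
  assumes "biholomorphic_isometry A F f"
  shows "pushforward FA FA (frame_lift A f) ` connection = connection"
proof -
  obtain g where fg: "biholo f g" and f: "\<And>v. v \<in> tbundle A \<Longrightarrow> F (pushforward A A f v) = F v"
    and g: "\<And>v. v \<in> tbundle A \<Longrightarrow> F (pushforward A A g v) = F v"
    using biholomorphic_isometry_biholo[OF assms] by blast
  note gf = biholo_sym[OF fg]
  have fh: "atlas_holo I_vec A I_vec A f" and gh: "atlas_holo I_vec A I_vec A g"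
    and inv: "\<And>x. x \<in> carrier_of A \<Longrightarrow> f (g x) = x"
    using fg unfolding biholo_def by auto
  have "X = pushforward FA FA (frame_lift A f) (pushforward FA FA (frame_lift A g) X)" if X: "X \<in> connection" for X
  proof -
    obtain u where u: "u \<in> unitary" "X \<in> horizontal u" using X unfolding connection_def by blast
    have uc: "u \<in> carrier_of FA" unfolding carrier_frame_atlas using u(1) unitary_subset by blast
    have Xt: "X \<in> tspace FA u" by (rule horizontal_tspace[OF u(2)])
    have "pushforward FA FA (frame_lift A f) (pushforward FA FA (frame_lift A g) X) =
        pushforward FA FA (frame_lift A f \<circ> frame_lift A g) X"
      by (rule pushforward_comp[OF atlas_holo_frame_lift[OF gf] atlas_holo_frame_lift[OF fg] uc Xt])
    also have "\<dots> = pushforward FA FA id X"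
    proof (rule pushforward_cong[OF atlas_holo_id[OF linear_atlas_frame] uc Xt, symmetric])
      show "id w = (frame_lift A f \<circ> frame_lift A g) w" if "w \<in> carrier_of FA" for w
        using frame_lift_comp[OF gh inv fh] that unfolding carrier_frame_atlas by simp
    qed
    also have "\<dots> = X" by (rule pushforward_id[OF linear_atlas_frame uc Xt])
    finally show ?thesis by simp
  qed
  moreover have "pushforward FA FA (frame_lift A g) X \<in> connection" if "X \<in> connection" for X
    by (rule pushforward_connection_subset[OF gf g that])
  ultimately have "connection \<subseteq> pushforward FA FA (frame_lift A f) ` connection" by blast
  moreover have "pushforward FA FA (frame_lift A f) ` connection \<subseteq> connection"
    using pushforward_connection_subset[OF fg f] by blast
  ultimately show ?thesis by blast
qed

end

theorem theorem1p4:
  fixes A :: "('a, complex^'n) chart set"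
    and F :: "('a, complex^'n) tvec \<Rightarrow> real"
    and k0 :: 'n
  assumes "complex_manifold A"
    and "complex_finsler A F"
    and "strongly_pseudoconvex A F"
  shows "(\<exists>!H. nonlinear_connection A F k0 H \<and> hermitian_type A F k0 H) \<and>
    (\<forall>H. nonlinear_connection A F k0 H \<and> hermitian_type A F k0 H \<longrightarrow>
      (\<forall>f. biholomorphic_isometry A F f \<longrightarrow>
        pushforward (frame_atlas A) (frame_atlas A) (frame_lift A f) ` H = H))"
proof -
  interpret finsler_manifold A F k0 using assms by unfold_locales
  show ?thesis
    using nonlinear_connection_connection hermitian_type_connection hermitian_connection_unique
      pushforward_connection by blast
qed

end
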